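(* Assume that the prior distribution $P(x)$ has support only on the interval $x\in[0,1]$ and that the observable variable $E$ has support only on $D$ distinct values. Then each component of the gradient of the utility function $\mathcal{U}$ (with respect to the decision variables $c=(c_1,c_2,\dots)$) can be computed within error $\epsilon$ using on average $$\tilde{O}\left(\frac{D\sqrt{\max_{c,j}\left|\frac{\partial^3\mathcal{U}(c)}{\partial c_j^3}\right|}}{\epsilon^{3/2}}\right)$$ queries to the likelihood function and the prior, for $\epsilon\le\min_d\frac12\int P(d|x,c)P(x)\,\mathrm{d}x$.
   Context: $x$ is a scalar latent variable with prior $P(x)$, $d$ denotes the value (outcome) of the observable variable $E$, $c$ is a vector of real decision variables (experimental controls), and $P(d|x,c)$ is the likelihood of outcome $d$ given $x$ and $c$. The posterior is $P(x|d,c)=P(d|x,c)P(x)/\int P(d|x',c)P(x')\,\mathrm{d}x'$. The utility function is the negative expected posterior variance, $$\mathcal{U}(c)=\mathcal{U}(P(x),c)=-\int P(x)\int P(d|x,c)\left(x-\int P(x'|d,c)\,x'\,\mathrm{d}x'\right)^2\mathrm{d}x\,\mathrm{d}d.$$ In the setting considered, $x$ and $d$ range over finite sets and all integrals are replaced by sums over the corresponding variables. A query to the prior is a use of a unitary preparing $\sum_x\sqrt{P(x)}|x\rangle$. A query to the likelihood function is a use of a quantum oracle that computes $P(d|x,c)$ as a bit string into a register conditioned on $x$ (and $d$, $c$). Only these queries are counted. $\tilde O$ suppresses polylogarithmic factors, and the computation is by a quantum algorithm succeeding with high probability. *)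

theory Defs
  imports "HOL-Analysis.Analysis"
begin

section \<open>Bayesian experiment design on finite sets\<close>

text \<open>
  Controls are points of \<open>\<real>\<^sup>n\<close>, represented as functions supported on \<open>{..<n}\<close> so
  that \<open>n\<close> can be quantified inside a formula. A likelihood \<open>L d x c\<close> stands for \<open>P(d|x,c)\<close>.
\<close>

type_synonym control = "nat \<Rightarrow> real"
type_synonym likelihood = "real \<Rightarrow> real \<Rightarrow> control \<Rightarrow> real"

definition controls :: "nat \<Rightarrow> control set" where
  "controls n = {c. \<forall>i\<ge>n. c i = 0}"

definition bayes_model ::
  "nat \<Rightarrow> real set \<Rightarrow> real set \<Rightarrow> (real \<Rightarrow> real) \<Rightarrow> likelihood \<Rightarrow> bool" where
  "bayes_model n X Y P L \<longleftrightarrow>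
     finite X \<and> finite Y \<and>
     (\<forall>x\<in>X. 0 \<le> P x) \<and> (\<Sum>x\<in>X. P x) = 1 \<and>
     (\<forall>c\<in>controls n. \<forall>x\<in>X. (\<forall>d\<in>Y. 0 \<le> L d x c) \<and> (\<Sum>d\<in>Y. L d x c) = 1)"

definition evidence ::
  "real set \<Rightarrow> (real \<Rightarrow> real) \<Rightarrow> likelihood \<Rightarrow> control \<Rightarrow> real \<Rightarrow> real" where
  "evidence X P L c d = (\<Sum>x\<in>X. L d x c * P x)"

text \<open>
  If the evidence of \<open>d\<close> vanishes then the posterior is \<open>0\<close> by the convention for division;
  in the utility such a \<open>d\<close> only occurs with weight \<open>P x * L d x c = 0\<close>.
\<close>

definition posterior ::
  "real set \<Rightarrow> (real \<Rightarrow> real) \<Rightarrow> likelihood \<Rightarrow> control \<Rightarrow> real \<Rightarrow> real \<Rightarrow> real" where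
  "posterior X P L c d x = L d x c * P x / evidence X P L c d"

definition utility ::
  "real set \<Rightarrow> real set \<Rightarrow> (real \<Rightarrow> real) \<Rightarrow> likelihood \<Rightarrow> control \<Rightarrow> real" where
  "utility X Y P L c =
     - (\<Sum>x\<in>X. P x * (\<Sum>d\<in>Y. L d x c * (x - (\<Sum>x'\<in>X. posterior X P L c d x' * x'))\<^sup>2))"

definition partial_deriv :: "nat \<Rightarrow> (control \<Rightarrow> real) \<Rightarrow> control \<Rightarrow> real" where
  "partial_deriv j g c = deriv (\<lambda>t. g (c(j := t))) (c j)"

definition thrice_partially_differentiable :: "nat \<Rightarrow> (control \<Rightarrow> real) \<Rightarrow> bool" where
  "thrice_partially_differentiable n g \<longleftrightarrow>
     (\<forall>j<n. \<forall>c\<in>controls n. \<forall>k<3.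
        (\<lambda>t. (partial_deriv j ^^ k) g (c(j := t))) field_differentiable at (c j))"

definition third_partials :: "nat \<Rightarrow> (control \<Rightarrow> real) \<Rightarrow> real set" where
  "third_partials n g = {\<bar>(partial_deriv j ^^ 3) g c\<bar> | c j. c \<in> controls n \<and> j < n}"


section \<open>Quantum query programs\<close>

text \<open>
  A basis state \<open>|x, d, c, y, w\<rangle>\<close> consists of a latent value, an outcome, a control, the register
  receiving the bit string of a likelihood, and a work register. The last component subsumes any
  number of ancillas; further copies of the other registers can be swapped in and out of it.
  The set \<open>K\<close> contains the finitely many controls on which a program may condition its queries.
\<close>

type_synonym basis = "real \<times> real \<times> control \<times> nat \<times> nat"
type_synonym state = "basis \<Rightarrow> complex"

definition basis_states ::
  "real set \<Rightarrow> real set \<Rightarrow> control set \<Rightarrow> nat \<Rightarrow> nat \<Rightarrow> basis set" where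
  "basis_states X Y K b W = X \<times> Y \<times> K \<times> {..<2 ^ (b + 1)} \<times> {..<W}"

definition unitary_on :: "'a set \<Rightarrow> ('a \<Rightarrow> 'a \<Rightarrow> complex) \<Rightarrow> bool" where
  "unitary_on B U \<longleftrightarrow>
     (\<forall>a\<in>B. \<forall>a'\<in>B.
        (\<Sum>e\<in>B. cnj (U e a) * U e a') = (if a = a' then 1 else 0) \<and>
        (\<Sum>e\<in>B. U a e * cnj (U a' e)) = (if a = a' then 1 else 0))"

definition adjoint_op :: "('a \<Rightarrow> 'a \<Rightarrow> complex) \<Rightarrow> 'a \<Rightarrow> 'a \<Rightarrow> complex" where
  "adjoint_op U a a' = cnj (U a' a)"

definition apply_op :: "basis set \<Rightarrow> (basis \<Rightarrow> basis \<Rightarrow> complex) \<Rightarrow> state \<Rightarrow> state" where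
  "apply_op B U \<psi> = (\<lambda>a. \<Sum>a'\<in>B. U a a' * \<psi> a')"

definition weight :: "basis set \<Rightarrow> state \<Rightarrow> real" where
  "weight B \<psi> = (\<Sum>a\<in>B. (cmod (\<psi> a))\<^sup>2)"

definition basis_vector :: "basis \<Rightarrow> state" where
  "basis_vector a = (\<lambda>a'. if a' = a then 1 else 0)"

text \<open>
  The prior is accessed through any unitary taking the fiducial state \<open>|x0\<rangle>\<close> to
  \<open>\<Sum>x. sqrt (P x) |x\<rangle>\<close>; its action on the other basis states is unspecified.
\<close>

definition prepares_prior ::
  "real set \<Rightarrow> real \<Rightarrow> (real \<Rightarrow> real) \<Rightarrow> (real \<Rightarrow> real \<Rightarrow> complex) \<Rightarrow> bool" where
  "prepares_prior X x0 P V \<longleftrightarrow>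
     unitary_on X V \<and> (\<forall>x\<in>X. V x x0 = complex_of_real (sqrt (P x)))"

definition on_latent :: "(real \<Rightarrow> real \<Rightarrow> complex) \<Rightarrow> basis \<Rightarrow> basis \<Rightarrow> complex" where
  "on_latent V a a' = (if snd a = snd a' then V (fst a) (fst a') else 0)"

text \<open>
  The likelihood is returned truncated to \<open>b\<close> binary places. One bit more is needed for the
  integer part, since the value \<open>1\<close> may occur.
\<close>

definition likelihood_bits :: "nat \<Rightarrow> real \<Rightarrow> nat" where
  "likelihood_bits b p = nat \<lfloor>2 ^ b * p\<rfloor>"

definition likelihood_op :: "nat \<Rightarrow> likelihood \<Rightarrow> basis \<Rightarrow> basis \<Rightarrow> complex" where
  "likelihood_op b L a a' =
     (case a' of (x, d, c, y, w) \<Rightarrow>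
        if a = (x, d, c, xor y (likelihood_bits b (L d x c)), w) then 1 else 0)"

text \<open>
  \<open>Measure m f\<close> measures which fibre of \<open>m\<close> the basis state lies in and continues with \<open>f i\<close> on
  result \<open>i\<close>, so later operations and the number of queries may depend on earlier measurements.
\<close>

datatype program =
    Output real
  | Unitary "basis \<Rightarrow> basis \<Rightarrow> complex" program
  | Query_Prior program
  | Query_Prior_Inverse program
  | Query_Likelihood program
  | Measure "basis \<Rightarrow> nat" "nat \<Rightarrow> program"

primrec well_formed :: "basis set \<Rightarrow> program \<Rightarrow> bool" where
  "well_formed B (Output r) \<longleftrightarrow> True"
| "well_formed B (Unitary U p) \<longleftrightarrow> unitary_on B U \<and> well_formed B p"
| "well_formed B (Query_Prior p) \<longleftrightarrow> well_formed B p"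
| "well_formed B (Query_Prior_Inverse p) \<longleftrightarrow> well_formed B p"
| "well_formed B (Query_Likelihood p) \<longleftrightarrow> well_formed B p"
| "well_formed B (Measure m f) \<longleftrightarrow> (\<forall>i. well_formed B (f i))"

text \<open>
  States along a branch are not renormalised after a measurement: the weight of the state is the
  probability of reaching the branch. In both functions below \<open>V\<close> is the unitary behind the prior
  queries and \<open>Q\<close> the operator behind the likelihood queries.
\<close>

primrec output_prob ::
  "basis set \<Rightarrow> (real \<Rightarrow> real \<Rightarrow> complex) \<Rightarrow> (basis \<Rightarrow> basis \<Rightarrow> complex) \<Rightarrow>
   program \<Rightarrow> state \<Rightarrow> real set \<Rightarrow> real" where
  "output_prob B V Q (Output r) \<psi> R = (if r \<in> R then weight B \<psi> else 0)"
| "output_prob B V Q (Unitary U p) \<psi> R = output_prob B V Q p (apply_op B U \<psi>) R"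
| "output_prob B V Q (Query_Prior p) \<psi> R =
     output_prob B V Q p (apply_op B (on_latent V) \<psi>) R"
| "output_prob B V Q (Query_Prior_Inverse p) \<psi> R =
     output_prob B V Q p (apply_op B (on_latent (adjoint_op V)) \<psi>) R"
| "output_prob B V Q (Query_Likelihood p) \<psi> R = output_prob B V Q p (apply_op B Q \<psi>) R"
| "output_prob B V Q (Measure m f) \<psi> R =
     (\<Sum>i\<in>m ` B. output_prob B V Q (f i) (\<lambda>a. if m a = i then \<psi> a else 0) R)"

primrec expected_queries ::
  "basis set \<Rightarrow> (real \<Rightarrow> real \<Rightarrow> complex) \<Rightarrow> (basis \<Rightarrow> basis \<Rightarrow> complex) \<Rightarrow>
   program \<Rightarrow> state \<Rightarrow> real" where
  "expected_queries B V Q (Output r) \<psi> = 0"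
| "expected_queries B V Q (Unitary U p) \<psi> = expected_queries B V Q p (apply_op B U \<psi>)"
| "expected_queries B V Q (Query_Prior p) \<psi> =
     weight B \<psi> + expected_queries B V Q p (apply_op B (on_latent V) \<psi>)"
| "expected_queries B V Q (Query_Prior_Inverse p) \<psi> =
     weight B \<psi> + expected_queries B V Q p (apply_op B (on_latent (adjoint_op V)) \<psi>)"
| "expected_queries B V Q (Query_Likelihood p) \<psi> =
     weight B \<psi> + expected_queries B V Q p (apply_op B Q \<psi>)"
| "expected_queries B V Q (Measure m f) \<psi> =
     (\<Sum>i\<in>m ` B. expected_queries B V Q (f i) (\<lambda>a. if m a = i then \<psi> a else 0))"

definition query_scale :: "nat \<Rightarrow> real \<Rightarrow> real \<Rightarrow> real" where
  "query_scale D T \<epsilon> = real D * sqrt T / \<epsilon> powr (3 / 2)"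

end

theory Submission
  imports Defs
begin

text \<open>
  The utility is minus the total posterior variance \<open>F = \<Sum>d. \<Sum>x. P x * L d x * (x - m d)\<^sup>2\<close>,
  and its derivative is approximated by a central difference of step \<open>h = \<surd>(3\<epsilon>/T)\<close>, so that \<open>F\<close> is needed
  at two points up to \<open>\<delta> = \<epsilon>h/2\<close>. If \<open>\<delta> \<ge> 1/2\<close> then the derivative is at most \<open>\<epsilon>\<close> because \<open>F\<close> is
  bounded by 1, and no query is made. Otherwise \<open>D/\<delta>\<close> is of the order of the query scale.

  A circuit with \<open>O(D + N)\<close> queries succeeds with probability close to \<open>F/4\<close>. It prepares
  \<open>\<Sum>x d. \<surd>(P x * L d x) * (x - \<mu> d)/2 |x, d\<rangle>\<close> and removes, for every \<open>d\<close>, the component along the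
  posterior state \<open>\<Sum>x. \<surd>(P x * L d x) |x\<rangle>\<close>. To this end the powers \<open>0, \<dots>, N - 1\<close> of the Grover step that
  amplifies the outcome \<open>d\<close> are averaged: that step fixes the complement of the component and rotates the
  component itself. The bias is at most \<open>\<Sum>d. e d * (m d - \<mu> d)\<^sup>2\<close>, where \<open>e d\<close> is the evidence, and also at
  most \<open>D/N\<^sup>2\<close>. If \<open>D\<delta> \<ge> 1\<close>, take \<open>\<mu> = 0\<close> and \<open>N = \<surd>(2D/\<delta>)\<close>. If \<open>D\<delta> < 1\<close>, take \<open>N = 1\<close> and first
  estimate every \<open>\<mu> d\<close> from the amplitudes of \<open>d\<close> with \<open>\<surd>(D/\<delta>)\<close> Grover steps. Amplitudes are estimated
  without the quantum Fourier transform, by shrinking an interval around the angle.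
\<close>

section \<open>Matrices on finite sets\<close>

text \<open>The factor D in the query scale is the price of a joint circuit: the oracle returns one
  likelihood per query, so creating the outcome register with amplitudes \<surd>(L d x) requires all
  D likelihoods of x, and reading F up to \<delta> from one amplitude repeats this about 1/\<delta>
  times. The obstacle is that the mean m d is unknown when the deviation is prepared. Averaging N
  Grover powers removes it coherently and is free as long as N is of order D; a bias of order
  \<delta> needs N of order \<surd>(D/\<delta>), which is of order D if D\<delta> \<ge> 1. Otherwise
  D separate estimates of the means cost D\<surd>(D/\<delta>), which is at most D/\<delta> if
  D\<delta> \<le> 1. So the two regimes meet at D\<delta> = 1. The step h makes the remainder of the
  central difference, \<open>T * h\<^sup>2 / 6\<close>, equal to \<epsilon>/2; the other half of the
  error is left for estimation, bias and truncation. Since the program is fixed before the prior and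
  the likelihood, its gates and thresholds depend on sizes and accuracies only, and whatever it
  learns about the model it learns from measurements.\<close>

definition mapply :: "'a set \<Rightarrow> ('a \<Rightarrow> 'a \<Rightarrow> complex) \<Rightarrow> ('a \<Rightarrow> complex) \<Rightarrow> 'a \<Rightarrow> complex" where
  "mapply B U \<psi> = (\<lambda>a. \<Sum>a'\<in>B. U a a' * \<psi> a')"

definition inner_on :: "'a set \<Rightarrow> ('a \<Rightarrow> complex) \<Rightarrow> ('a \<Rightarrow> complex) \<Rightarrow> complex" where
  "inner_on B \<phi> \<psi> = (\<Sum>a\<in>B. cnj (\<phi> a) * \<psi> a)"

definition norm2_on :: "'a set \<Rightarrow> ('a \<Rightarrow> complex) \<Rightarrow> real" where
  "norm2_on B \<psi> = (\<Sum>a\<in>B. (cmod (\<psi> a))\<^sup>2)"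

definition unit_at :: "'a \<Rightarrow> 'a \<Rightarrow> complex" where
  "unit_at z = (\<lambda>a. if a = z then 1 else 0)"

text \<open>The head of the list acts first, as in a circuit diagram and opposite to a matrix
  product.\<close>

definition run_ops :: "'a set \<Rightarrow> ('a \<Rightarrow> 'a \<Rightarrow> complex) list \<Rightarrow> ('a \<Rightarrow> complex) \<Rightarrow> 'a \<Rightarrow> complex" where
  "run_ops B Us \<psi> = fold (mapply B) Us \<psi>"

definition inv_ops :: "('a \<Rightarrow> 'a \<Rightarrow> complex) list \<Rightarrow> ('a \<Rightarrow> 'a \<Rightarrow> complex) list" where
  "inv_ops Us = rev (map adjoint_op Us)"

lemma apply_op_mapply: "apply_op = mapply"
  by (auto simp: apply_op_def mapply_def fun_eq_iff)

lemma weight_norm2_on: "weight = norm2_on"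
  by (auto simp: weight_def norm2_on_def fun_eq_iff)

lemma basis_vector_unit_at: "basis_vector = unit_at"
  by (auto simp: basis_vector_def unit_at_def fun_eq_iff)

lemma run_ops_Nil [simp]: "run_ops B [] \<psi> = \<psi>"
  and run_ops_Cons [simp]: "run_ops B (U # Us) \<psi> = run_ops B Us (mapply B U \<psi>)"
  and run_ops_append [simp]: "run_ops B (Us @ Vs) \<psi> = run_ops B Vs (run_ops B Us \<psi>)"
  by (simp_all add: run_ops_def)

text \<open>Vectors are total functions of which only the values on \<open>B\<close> are meaningful.
  A matrix reads no others, so its results coincide as functions; a list of matrices may be empty,
  and then agreement is available on \<open>B\<close> only.\<close>

lemma mapply_cong:
  "(\<And>a. a \<in> B \<Longrightarrow> \<phi> a = \<psi> a) \<Longrightarrow> mapply B U \<phi> = mapply B U \<psi>"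
  unfolding mapply_def by (intro ext sum.cong) auto

lemma run_ops_cong:
  assumes "\<And>a. a \<in> B \<Longrightarrow> \<phi> a = \<psi> a" "a \<in> B"
  shows "run_ops B Us \<phi> a = run_ops B Us \<psi> a"
proof (cases Us)
  case (Cons U Vs)
  then show ?thesis using mapply_cong[of B \<phi> \<psi> U] assms by simp
qed (use assms in simp)

lemma inner_on_cong:
  "(\<And>a. a \<in> B \<Longrightarrow> \<phi> a = \<phi>' a) \<Longrightarrow> (\<And>a. a \<in> B \<Longrightarrow> \<psi> a = \<psi>' a) \<Longrightarrow>
    inner_on B \<phi> \<psi> = inner_on B \<phi>' \<psi>'"
  unfolding inner_on_def by (intro sum.cong) auto

lemma norm2_on_cong:
  "(\<And>a. a \<in> B \<Longrightarrow> \<psi> a = \<psi>' a) \<Longrightarrow> norm2_on B \<psi> = norm2_on B \<psi>'"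
  unfolding norm2_on_def by (intro sum.cong) auto

lemma norm2_on_inner: "complex_of_real (norm2_on B \<psi>) = inner_on B \<psi> \<psi>"
  unfolding norm2_on_def inner_on_def of_real_sum
  by (intro sum.cong refl) (metis complex_norm_square mult.commute of_real_power)

lemma norm2_on_nonneg: "0 \<le> norm2_on B \<psi>"
  unfolding norm2_on_def by (intro sum_nonneg) auto

lemma mapply_add: "mapply B U (\<lambda>a. \<phi> a + \<psi> a) a = mapply B U \<phi> a + mapply B U \<psi> a"
  by (simp add: mapply_def algebra_simps sum.distrib)

lemma mapply_scale: "mapply B U (\<lambda>a. k * \<psi> a) = (\<lambda>a. k * mapply B U \<psi> a)"
  by (simp add: mapply_def sum_distrib_left mult_ac)

lemma run_ops_add: "run_ops B Us (\<lambda>a. \<phi> a + \<psi> a) = (\<lambda>a. run_ops B Us \<phi> a + run_ops B Us \<psi> a)"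
proof (induction Us arbitrary: \<phi> \<psi>)
  case (Cons U Us)
  have "mapply B U (\<lambda>a. \<phi> a + \<psi> a) = (\<lambda>a. mapply B U \<phi> a + mapply B U \<psi> a)"
    by (rule ext) (rule mapply_add)
  then show ?case by (simp add: Cons)
qed simp

lemma run_ops_scale: "run_ops B Us (\<lambda>a. k * \<psi> a) = (\<lambda>a. k * run_ops B Us \<psi> a)"
  by (induction Us arbitrary: \<psi>) (simp_all add: mapply_scale)

lemma run_ops_zero: "run_ops B Us (\<lambda>a. 0) = (\<lambda>a. 0)"
  using run_ops_scale[of B Us 0 "\<lambda>a. 0"] by simp

lemma run_ops_diff: "run_ops B Us (\<lambda>a. \<phi> a - \<psi> a) = (\<lambda>a. run_ops B Us \<phi> a - run_ops B Us \<psi> a)"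
  using run_ops_add[of B Us \<phi> "\<lambda>a. (-1) * \<psi> a"] run_ops_scale[of B Us "-1" \<psi>] by simp

lemma inner_on_add_right: "inner_on B \<phi> (\<lambda>a. \<psi> a + \<xi> a) = inner_on B \<phi> \<psi> + inner_on B \<phi> \<xi>"
  and inner_on_diff_right: "inner_on B \<phi> (\<lambda>a. \<psi> a - \<xi> a) = inner_on B \<phi> \<psi> - inner_on B \<phi> \<xi>"
  and inner_on_scale_right: "inner_on B \<phi> (\<lambda>a. k * \<psi> a) = k * inner_on B \<phi> \<psi>"
  by (simp_all add: inner_on_def algebra_simps sum.distrib sum_subtractf sum_distrib_left)

lemma inner_on_commute: "inner_on B \<phi> \<psi> = cnj (inner_on B \<psi> \<phi>)"
  by (simp add: inner_on_def mult.commute)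

lemma inner_on_add_left: "inner_on B (\<lambda>a. \<psi> a + \<xi> a) \<phi> = inner_on B \<psi> \<phi> + inner_on B \<xi> \<phi>"
  and inner_on_diff_left: "inner_on B (\<lambda>a. \<psi> a - \<xi> a) \<phi> = inner_on B \<psi> \<phi> - inner_on B \<xi> \<phi>"
  and inner_on_scale_left: "inner_on B (\<lambda>a. k * \<psi> a) \<phi> = cnj k * inner_on B \<psi> \<phi>"
  by (simp_all add: inner_on_def algebra_simps sum.distrib sum_subtractf sum_distrib_left)

lemma inner_on_unit_at: "finite B \<Longrightarrow> z \<in> B \<Longrightarrow> inner_on B (unit_at z) \<psi> = \<psi> z"
  by (simp add: inner_on_def unit_at_def if_distrib[where f=cnj] if_distrib[where f="\<lambda>u. u * _"] cong: if_cong)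

lemma norm2_on_unit_at: "finite B \<Longrightarrow> z \<in> B \<Longrightarrow> norm2_on B (unit_at z) = 1"
  by (simp add: norm2_on_def unit_at_def if_distrib[where f="cmod"] if_distrib[where f="\<lambda>u. u ^ _"] cong: if_cong)

lemma adjoint_op_adjoint [simp]: "adjoint_op (adjoint_op U) = U"
  by (simp add: adjoint_op_def fun_eq_iff)

lemma unitary_adjoint: "unitary_on B U \<Longrightarrow> unitary_on B (adjoint_op U)"
  unfolding unitary_on_def adjoint_op_def by (simp add: mult.commute)

lemma inner_on_adjoint:
  "inner_on B \<phi> (mapply B U \<psi>) = inner_on B (mapply B (adjoint_op U) \<phi>) \<psi>"
proof -
  have "inner_on B \<phi> (mapply B U \<psi>) = (\<Sum>a\<in>B. \<Sum>a'\<in>B. cnj (\<phi> a) * (U a a' * \<psi> a'))"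
    by (simp add: inner_on_def mapply_def sum_distrib_left)
  also have "\<dots> = (\<Sum>a'\<in>B. \<Sum>a\<in>B. cnj (\<phi> a) * (U a a' * \<psi> a'))" by (rule sum.swap)
  also have "\<dots> = inner_on B (mapply B (adjoint_op U) \<phi>) \<psi>"
    unfolding inner_on_def mapply_def adjoint_op_def cnj_sum sum_distrib_right
    by (intro sum.cong refl) simp
  finally show ?thesis .
qed

lemma mapply_adjoint_left:
  assumes "unitary_on B U" "finite B" "a \<in> B"
  shows "mapply B (adjoint_op U) (mapply B U \<psi>) a = \<psi> a"
proof -
  have "mapply B (adjoint_op U) (mapply B U \<psi>) a = (\<Sum>e\<in>B. \<Sum>a'\<in>B. cnj (U e a) * (U e a' * \<psi> a'))"
    by (simp add: mapply_def adjoint_op_def sum_distrib_left)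
  also have "\<dots> = (\<Sum>a'\<in>B. \<Sum>e\<in>B. cnj (U e a) * (U e a' * \<psi> a'))" by (rule sum.swap)
  also have "\<dots> = (\<Sum>a'\<in>B. (\<Sum>e\<in>B. cnj (U e a) * U e a') * \<psi> a')"
    unfolding sum_distrib_right by (intro sum.cong refl) simp
  also have "\<dots> = (\<Sum>a'\<in>B. (if a = a' then 1 else 0) * \<psi> a')"
    using assms by (intro sum.cong) (auto simp: unitary_on_def)
  also have "\<dots> = (\<Sum>a'\<in>B. if a = a' then \<psi> a' else 0)" by (intro sum.cong) auto
  also have "\<dots> = \<psi> a" using assms by simp
  finally show ?thesis .
qed

lemma inner_on_unitary:
  assumes "unitary_on B U" "finite B"
  shows "inner_on B (mapply B U \<phi>) (mapply B U \<psi>) = inner_on B \<phi> \<psi>"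
  unfolding inner_on_adjoint
  by (intro inner_on_cong) (simp_all add: mapply_adjoint_left[OF assms])

lemma norm2_on_unitary:
  assumes "unitary_on B U" "finite B"
  shows "norm2_on B (mapply B U \<psi>) = norm2_on B \<psi>"
proof -
  have "complex_of_real (norm2_on B (mapply B U \<psi>)) = complex_of_real (norm2_on B \<psi>)"
    by (simp only: norm2_on_inner inner_on_unitary[OF assms])
  then show ?thesis by simp
qed

lemma inner_on_run_ops:
  assumes "\<forall>U\<in>set Us. unitary_on B U" "finite B"
  shows "inner_on B (run_ops B Us \<phi>) (run_ops B Us \<psi>) = inner_on B \<phi> \<psi>"
  using assms by (induction Us arbitrary: \<phi> \<psi>) (simp_all add: inner_on_unitary)

lemma norm2_on_run_ops:
  assumes "\<forall>U\<in>set Us. unitary_on B U" "finite B"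
  shows "norm2_on B (run_ops B Us \<psi>) = norm2_on B \<psi>"
  using assms by (induction Us arbitrary: \<psi>) (simp_all add: norm2_on_unitary)

lemma unitary_inv_ops:
  "\<forall>U\<in>set Us. unitary_on B U \<Longrightarrow> \<forall>U\<in>set (inv_ops Us). unitary_on B U"
  by (auto simp: inv_ops_def unitary_adjoint)

lemma run_ops_inv_left:
  assumes "\<forall>U\<in>set Us. unitary_on B U" "finite B" "a \<in> B"
  shows "run_ops B (inv_ops Us) (run_ops B Us \<psi>) a = \<psi> a"
  using assms(1,3)
proof (induction Us arbitrary: \<psi> a)
  case (Cons U Us)
  have e: "inv_ops (U # Us) = inv_ops Us @ [adjoint_op U]" by (simp add: inv_ops_def)
  have "run_ops B (inv_ops (U # Us)) (run_ops B (U # Us) \<psi>) a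
    = mapply B (adjoint_op U) (run_ops B (inv_ops Us) (run_ops B Us (mapply B U \<psi>))) a"
    by (simp add: e)
  also have "\<dots> = mapply B (adjoint_op U) (mapply B U \<psi>) a"
    by (subst mapply_cong[where \<psi>="mapply B U \<psi>"]) (use Cons in auto)
  also have "\<dots> = \<psi> a" by (rule mapply_adjoint_left) (use Cons assms in auto)
  finally show ?case .
qed (simp add: inv_ops_def)

lemma inv_ops_inv [simp]: "inv_ops (inv_ops Us) = Us"
  by (simp add: inv_ops_def rev_map o_def)

lemma run_ops_inv_right:
  assumes "\<forall>U\<in>set Us. unitary_on B U" "finite B" "a \<in> B"
  shows "run_ops B Us (run_ops B (inv_ops Us) \<psi>) a = \<psi> a"
  using run_ops_inv_left[OF unitary_inv_ops[OF assms(1)] assms(2,3), of \<psi>] by simp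

lemma inner_on_run_ops_inv:
  assumes "\<forall>U\<in>set Us. unitary_on B U" "finite B"
  shows "inner_on B \<phi> (run_ops B (inv_ops Us) \<psi>) = inner_on B (run_ops B Us \<phi>) \<psi>"
proof -
  have "inner_on B \<phi> (run_ops B (inv_ops Us) \<psi>)
     = inner_on B (run_ops B Us \<phi>) (run_ops B Us (run_ops B (inv_ops Us) \<psi>))"
    by (simp add: inner_on_run_ops[OF assms])
  also have "\<dots> = inner_on B (run_ops B Us \<phi>) \<psi>"
    by (intro inner_on_cong) (simp_all add: run_ops_inv_right[OF assms])
  finally show ?thesis .
qed

section \<open>Diagonal, permutation and block-diagonal matrices\<close>

definition diag_op :: "('a \<Rightarrow> complex) \<Rightarrow> 'a \<Rightarrow> 'a \<Rightarrow> complex" where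
  "diag_op f a a' = (if a = a' then f a else 0)"

definition perm_op :: "('a \<Rightarrow> 'a) \<Rightarrow> 'a \<Rightarrow> 'a \<Rightarrow> complex" where
  "perm_op \<pi> a a' = (if a = \<pi> a' then 1 else 0)"

lemma mapply_diag: "finite B \<Longrightarrow> a \<in> B \<Longrightarrow> mapply B (diag_op f) \<psi> a = f a * \<psi> a"
  by (simp add: mapply_def diag_op_def if_distrib[where f="\<lambda>u. u * _"] cong: if_cong)

lemma unitary_diag:
  assumes "finite B" "\<And>a. a \<in> B \<Longrightarrow> cnj (f a) * f a = 1"
  shows "unitary_on B (diag_op f)"
proof -
  have 1: "(\<Sum>e\<in>B. cnj (diag_op f e a) * diag_op f e a') = (if a = a' then 1 else 0)"
    if "a \<in> B" "a' \<in> B" for a a'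
  proof -
    have "(\<Sum>e\<in>B. cnj (diag_op f e a) * diag_op f e a')
      = (\<Sum>e\<in>B. if e = a then cnj (f a) * (if a = a' then f a else 0) else 0)"
      by (intro sum.cong) (auto simp: diag_op_def)
    also have "\<dots> = (if a = a' then 1 else 0)" using that assms by simp
    finally show ?thesis .
  qed
  have 2: "(\<Sum>e\<in>B. diag_op f a e * cnj (diag_op f a' e)) = (if a = a' then 1 else 0)"
    if "a \<in> B" "a' \<in> B" for a a'
  proof -
    have "(\<Sum>e\<in>B. diag_op f a e * cnj (diag_op f a' e))
      = (\<Sum>e\<in>B. if e = a then (if a = a' then cnj (f a) * f a else 0) else 0)"
      by (intro sum.cong) (auto simp: diag_op_def)
    also have "\<dots> = (if a = a' then 1 else 0)" using that assms by simp
    finally show ?thesis .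
  qed
  show ?thesis unfolding unitary_on_def using 1 2 by blast
qed

text \<open>In general a permutation matrix composes a vector with the inverse permutation. All
  permutations used here (transpositions, xor, register swaps) are involutions, so
  \<open>\<pi>\<close> is its own inverse and the matrix is self-adjoint on
  \<open>B\<close>.\<close>

lemma mapply_perm:
  assumes "finite B" "a \<in> B" "\<And>a. a \<in> B \<Longrightarrow> \<pi> a \<in> B" "\<And>a. a \<in> B \<Longrightarrow> \<pi> (\<pi> a) = a"
  shows "mapply B (perm_op \<pi>) \<psi> a = \<psi> (\<pi> a)"
proof -
  have "mapply B (perm_op \<pi>) \<psi> a = (\<Sum>a'\<in>B. if a' = \<pi> a then \<psi> a' else 0)"
    unfolding mapply_def perm_op_def using assms by (intro sum.cong) auto
  also have "\<dots> = \<psi> (\<pi> a)" using assms by simp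
  finally show ?thesis .
qed

lemma mapply_adjoint_perm:
  assumes "finite B" "a \<in> B" "\<And>a. a \<in> B \<Longrightarrow> \<pi> a \<in> B" "\<And>a. a \<in> B \<Longrightarrow> \<pi> (\<pi> a) = a"
  shows "mapply B (adjoint_op (perm_op \<pi>)) \<psi> a = mapply B (perm_op \<pi>) \<psi> a"
  unfolding mapply_def adjoint_op_def perm_op_def using assms by (intro sum.cong) auto

lemma unitary_perm:
  assumes "finite B" "\<And>a. a \<in> B \<Longrightarrow> \<pi> a \<in> B" "\<And>a. a \<in> B \<Longrightarrow> \<pi> (\<pi> a) = a"
  shows "unitary_on B (perm_op \<pi>)"
proof -
  have 1: "(\<Sum>e\<in>B. cnj (perm_op \<pi> e a) * perm_op \<pi> e a') = (if a = a' then 1 else 0)"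
    if "a \<in> B" "a' \<in> B" for a a'
  proof -
    have "(\<Sum>e\<in>B. cnj (perm_op \<pi> e a) * perm_op \<pi> e a')
      = (\<Sum>e\<in>B. if e = \<pi> a then (if a = a' then 1 else 0) else 0)"
      using that assms by (intro sum.cong) (auto simp: perm_op_def dest: arg_cong[where f=\<pi>])
    also have "\<dots> = (if a = a' then 1 else 0)" using that assms by simp
    finally show ?thesis .
  qed
  have 2: "(\<Sum>e\<in>B. perm_op \<pi> a e * cnj (perm_op \<pi> a' e)) = (if a = a' then 1 else 0)"
    if "a \<in> B" "a' \<in> B" for a a'
  proof -
    have "(\<Sum>e\<in>B. perm_op \<pi> a e * cnj (perm_op \<pi> a' e))
      = (\<Sum>e\<in>B. if e = \<pi> a then (if a = a' then 1 else 0) else 0)"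
      using that assms by (intro sum.cong) (auto simp: perm_op_def)
    also have "\<dots> = (if a = a' then 1 else 0)" using that assms by simp
    finally show ?thesis .
  qed
  show ?thesis unfolding unitary_on_def using 1 2 by blast
qed

text \<open>\<open>jn i r\<close> glues an active coordinate \<open>i\<close> to a spectator
  coordinate \<open>r\<close>. This describes a controlled operation: \<open>r\<close> stays as it
  is and selects the matrix \<open>H r\<close> acting on \<open>i\<close>.\<close>

definition block_diag :: "'i set \<Rightarrow> 'r set \<Rightarrow> ('i \<Rightarrow> 'r \<Rightarrow> 'a) \<Rightarrow> ('r \<Rightarrow> 'i \<Rightarrow> 'i \<Rightarrow> complex) \<Rightarrow>
    ('a \<Rightarrow> 'a \<Rightarrow> complex) \<Rightarrow> bool" where
  "block_diag I Rs jn H M \<longleftrightarrow> (\<forall>i\<in>I. \<forall>i'\<in>I. \<forall>r\<in>Rs. \<forall>r'\<in>Rs.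
     M (jn i r) (jn i' r') = (if r = r' then H r i i' else 0))"

lemma sum_product_decomp:
  assumes "bij_betw (\<lambda>(i, r). jn i r) (I \<times> Rs) B"
  shows "(\<Sum>a\<in>B. F a) = (\<Sum>i\<in>I. \<Sum>r\<in>Rs. F (jn i r))"
proof -
  have "(\<Sum>a\<in>B. F a) = (\<Sum>z\<in>I \<times> Rs. F (case z of (i, r) \<Rightarrow> jn i r))"
    by (rule sum.reindex_bij_betw[OF assms, symmetric])
  also have "\<dots> = (\<Sum>i\<in>I. \<Sum>r\<in>Rs. F (jn i r))"
    by (simp add: sum.cartesian_product case_prod_beta)
  finally show ?thesis .
qed

lemma mapply_block:
  assumes "bij_betw (\<lambda>(i, r). jn i r) (I \<times> Rs) B" "finite Rs" "block_diag I Rs jn H M"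
    "i \<in> I" "r \<in> Rs"
  shows "mapply B M \<psi> (jn i r) = (\<Sum>i'\<in>I. H r i i' * \<psi> (jn i' r))"
proof -
  have "mapply B M \<psi> (jn i r) = (\<Sum>i'\<in>I. \<Sum>r'\<in>Rs. M (jn i r) (jn i' r') * \<psi> (jn i' r'))"
    unfolding mapply_def by (rule sum_product_decomp[OF assms(1)])
  also have "\<dots> = (\<Sum>i'\<in>I. \<Sum>r'\<in>Rs. if r' = r then H r i i' * \<psi> (jn i' r) else 0)"
    using assms by (intro sum.cong refl) (auto simp: block_diag_def)
  also have "\<dots> = (\<Sum>i'\<in>I. H r i i' * \<psi> (jn i' r))"
    using assms by simp
  finally show ?thesis .
qed

lemma unitary_block:
  assumes bij: "bij_betw (\<lambda>(i, r). jn i r) (I \<times> Rs) B" and fin: "finite Rs"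
    and blk: "block_diag I Rs jn H M" and U: "\<And>r. r \<in> Rs \<Longrightarrow> unitary_on I (H r)"
  shows "unitary_on B M"
proof -
  have B: "\<exists>i\<in>I. \<exists>r\<in>Rs. a = jn i r" if "a \<in> B" for a
    using that bij by (auto simp: bij_betw_def)
  have inj: "jn i r = jn i' r' \<longleftrightarrow> i = i' \<and> r = r'" if "i \<in> I" "i' \<in> I" "r \<in> Rs" "r' \<in> Rs" for i i' r r'
    using that bij by (auto simp: bij_betw_def inj_on_def)
  have "(\<Sum>e\<in>B. cnj (M e (jn i r)) * M e (jn i' r')) = (if jn i r = jn i' r' then 1 else 0) \<and>
        (\<Sum>e\<in>B. M (jn i r) e * cnj (M (jn i' r') e)) = (if jn i r = jn i' r' then 1 else 0)"
    if m: "i \<in> I" "i' \<in> I" "r \<in> Rs" "r' \<in> Rs" for i i' r r'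
  proof
    have "(\<Sum>e\<in>B. cnj (M e (jn i r)) * M e (jn i' r'))
       = (\<Sum>k\<in>I. \<Sum>s\<in>Rs. cnj (M (jn k s) (jn i r)) * M (jn k s) (jn i' r'))"
      by (rule sum_product_decomp[OF bij])
    also have "\<dots> = (\<Sum>k\<in>I. \<Sum>s\<in>Rs. if s = r then (if r = r' then cnj (H r k i) * H r k i' else 0) else 0)"
      using m blk by (intro sum.cong refl) (auto simp: block_diag_def)
    also have "\<dots> = (if r = r' then \<Sum>k\<in>I. cnj (H r k i) * H r k i' else 0)"
      using m fin by simp
    also have "\<dots> = (if jn i r = jn i' r' then 1 else 0)"
      using U[OF m(3)] m by (cases "r = r'") (simp_all add: unitary_on_def inj)
    finally show "(\<Sum>e\<in>B. cnj (M e (jn i r)) * M e (jn i' r')) = (if jn i r = jn i' r' then 1 else 0)" .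
    have "(\<Sum>e\<in>B. M (jn i r) e * cnj (M (jn i' r') e))
       = (\<Sum>k\<in>I. \<Sum>s\<in>Rs. M (jn i r) (jn k s) * cnj (M (jn i' r') (jn k s)))"
      by (rule sum_product_decomp[OF bij])
    also have "\<dots> = (\<Sum>k\<in>I. \<Sum>s\<in>Rs. if s = r then (if r = r' then H r i k * cnj (H r i' k) else 0) else 0)"
      using m blk by (intro sum.cong refl) (auto simp: block_diag_def)
    also have "\<dots> = (if r = r' then \<Sum>k\<in>I. H r i k * cnj (H r i' k) else 0)"
      using m fin by simp
    also have "\<dots> = (if jn i r = jn i' r' then 1 else 0)"
      using U[OF m(3)] m by (cases "r = r'") (simp_all add: unitary_on_def inj)
    finally show "(\<Sum>e\<in>B. M (jn i r) e * cnj (M (jn i' r') e)) = (if jn i r = jn i' r' then 1 else 0)" .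
  qed
  note main = this
  show ?thesis unfolding unitary_on_def
  proof (intro ballI)
    fix a a' assume "a \<in> B" "a' \<in> B"
    then obtain i r i' r' where "i \<in> I" "r \<in> Rs" "a = jn i r" "i' \<in> I" "r' \<in> Rs" "a' = jn i' r'"
      using B by meson
    then show "(\<Sum>e\<in>B. cnj (M e a) * M e a') = (if a = a' then 1 else 0) \<and>
        (\<Sum>e\<in>B. M a e * cnj (M a' e)) = (if a = a' then 1 else 0)"
      using main by blast
  qed
qed

text \<open>The matrix is the Householder reflection that exchanges \<open>u\<close> and the \<open>i0\<close>-th unit vector.\<close>

lemma unitary_with_column:
  fixes u :: "'i \<Rightarrow> real"
  assumes fin: "finite I" and i0: "i0 \<in> I" and u: "(\<Sum>i\<in>I. (u i)\<^sup>2) = 1"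
  shows "\<exists>H. unitary_on I H \<and> (\<forall>i\<in>I. H i i0 = complex_of_real (u i))"
proof (cases "\<forall>i\<in>I. u i = (if i = i0 then 1 else 0)")
  case True
  have "unitary_on I (diag_op (\<lambda>_. 1))" by (rule unitary_diag) (use fin in auto)
  then show ?thesis using True by (intro exI[of _ "diag_op (\<lambda>_. 1)"]) (auto simp: diag_op_def)
next
  case False
  define e :: "'i \<Rightarrow> real" where "e i = (if i = i0 then 1 else 0)" for i
  define w where "w i = u i - e i" for i
  define N where "N = (\<Sum>i\<in>I. (w i)\<^sup>2)"
  define h :: "'i \<Rightarrow> 'i \<Rightarrow> real" where "h i j = (if i = j then 1 else 0) - 2 * w i * w j / N" for i j
  have N0: "N \<noteq> 0"
  proof
    assume "N = 0"
    then have "\<forall>i\<in>I. (w i)\<^sup>2 = 0" unfolding N_def using fin by (subst (asm) sum_nonneg_eq_0_iff) auto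
    then show False using False by (auto simp: w_def e_def)
  qed
  have "N = (\<Sum>i\<in>I. (u i)\<^sup>2) + (\<Sum>i\<in>I. (e i)\<^sup>2) - 2 * (\<Sum>i\<in>I. u i * e i)"
    by (simp add: N_def w_def power2_diff sum.distrib sum_subtractf sum_distrib_left mult_ac)
  also have "(\<Sum>i\<in>I. (e i)\<^sup>2) = 1"
    using fin i0 by (simp add: e_def if_distrib[where f="\<lambda>x. x ^ 2"] cong: if_cong)
  also have "(\<Sum>i\<in>I. u i * e i) = u i0"
    using fin i0 by (simp add: e_def if_distrib[where f="\<lambda>x. _ * x"] cong: if_cong)
  \<comment> \<open>For unit vectors \<open>u\<close> and \<open>e\<close> the squared distance is
    \<open>2 - 2 * u i0\<close>. Hence \<open>w i0 = - N / 2\<close>, and the column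
    \<open>i0\<close> of the reflection becomes \<open>e + w = u\<close>.\<close>
  finally have N: "N = 2 - 2 * u i0" using u by simp
  have wi0: "2 * w i0 = - N" unfolding N by (simp add: w_def e_def)
  have col: "h i i0 = u i" if "i \<in> I" for i
  proof -
    have "2 * w i * w i0 / N = w i * (2 * w i0) / N" by simp
    also have "\<dots> = - w i" unfolding wi0 using N0 by simp
    finally show ?thesis by (simp add: h_def w_def e_def)
  qed
  have Nsum: "(\<Sum>k\<in>I. c * (w k)\<^sup>2 / M) = c * N / M" for c M
    by (simp add: N_def sum_distrib_left sum_divide_distrib)
  have sym: "h i j = h j i" for i j by (simp add: h_def)
  have orth: "(\<Sum>k\<in>I. h k i * h k j) = (if i = j then 1 else 0)" if "i \<in> I" "j \<in> I" for i j
  proof -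
    have "(\<Sum>k\<in>I. h k i * h k j) = (\<Sum>k\<in>I. (if k = i then if k = j then 1 else 0 else 0)
       - (if k = i then 2 * w k * w j / N else 0) - (if k = j then 2 * w k * w i / N else 0)
       + (4 * w i * w j / N\<^sup>2) * (w k)\<^sup>2)"
      by (intro sum.cong refl) (simp add: h_def algebra_simps power2_eq_square)
    also have "\<dots> = (if i = j then 1 else 0) - 2 * w i * w j / N - 2 * w j * w i / N + (4 * w i * w j / N\<^sup>2) * N"
      using fin that Nsum[of "4 * w i * w j" "N\<^sup>2"] by (simp add: sum.distrib sum_subtractf)
    also have "\<dots> = (if i = j then 1 else 0)"
      using N0 by (simp add: power2_eq_square)
    finally show ?thesis .
  qed
  have "unitary_on I (\<lambda>i j. complex_of_real (h i j))"
    unfolding unitary_on_def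
  proof (intro ballI conjI)
    fix a a' assume m: "a \<in> I" "a' \<in> I"
    have "complex_of_real (\<Sum>k\<in>I. h k a * h k a') = (if a = a' then 1 else 0)"
      using orth[OF m] by simp
    then show "(\<Sum>e\<in>I. cnj (complex_of_real (h e a)) * complex_of_real (h e a')) = (if a = a' then 1 else 0)"
      and "(\<Sum>e\<in>I. complex_of_real (h a e) * cnj (complex_of_real (h a' e))) = (if a = a' then 1 else 0)"
      by (simp_all add: sym[of a] sym[of a'])
  qed
  then show ?thesis using col by (intro exI[of _ "\<lambda>i j. complex_of_real (h i j)"]) simp
qed

text \<open>A fixed completion of the prescribed column to a unitary, so that a preparation gate is
  a function of the vector to be prepared.\<close>

definition prep_op :: "'i set \<Rightarrow> 'i \<Rightarrow> ('i \<Rightarrow> real) \<Rightarrow> 'i \<Rightarrow> 'i \<Rightarrow> complex" where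
  "prep_op I i0 u = (SOME H. unitary_on I H \<and> (\<forall>i\<in>I. H i i0 = complex_of_real (u i)))"

lemma prep_op:
  assumes "finite I" "i0 \<in> I" "(\<Sum>i\<in>I. (u i)\<^sup>2) = 1"
  shows "unitary_on I (prep_op I i0 u)" "i \<in> I \<Longrightarrow> prep_op I i0 u i i0 = complex_of_real (u i)"
  using someI_ex[OF unitary_with_column[OF assms]] unfolding prep_op_def by auto

text \<open>Transport along the bijection \<open>J\<close>: gates are written on structured
  registers and used on the flat basis states.\<close>

definition relabel :: "'a set \<Rightarrow> ('a \<Rightarrow> 'b) \<Rightarrow> ('a \<Rightarrow> 'a \<Rightarrow> complex) \<Rightarrow> 'b \<Rightarrow> 'b \<Rightarrow> complex" where
  "relabel A J M b b' = M (inv_into A J b) (inv_into A J b')"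

lemma mapply_relabel:
  assumes "bij_betw J A B" "\<And>a a'. a \<in> A \<Longrightarrow> a' \<in> A \<Longrightarrow> U (J a) (J a') = M a a'" "a \<in> A"
  shows "mapply B U \<psi> (J a) = mapply A M (\<psi> \<circ> J) a"
proof -
  have "mapply B U \<psi> (J a) = (\<Sum>a'\<in>A. U (J a) (J a') * \<psi> (J a'))"
    unfolding mapply_def by (rule sum.reindex_bij_betw[OF assms(1), symmetric])
  also have "\<dots> = mapply A M (\<psi> \<circ> J) a" using assms by (auto simp: mapply_def intro!: sum.cong)
  finally show ?thesis .
qed

lemma relabel_apply:
  "bij_betw J A B \<Longrightarrow> a \<in> A \<Longrightarrow> a' \<in> A \<Longrightarrow> relabel A J M (J a) (J a') = M a a'"
  by (simp add: relabel_def bij_betw_inv_into_left)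

lemma unitary_relabel:
  assumes bij: "bij_betw J A B" and U: "unitary_on A M"
  shows "unitary_on B (relabel A J M)"
proof -
  have s: "(\<Sum>e\<in>B. F e) = (\<Sum>e\<in>A. F (J e))" for F :: "_ \<Rightarrow> complex"
    by (rule sum.reindex_bij_betw[OF bij, symmetric])
  have B: "\<exists>x\<in>A. a = J x" if "a \<in> B" for a using that bij by (auto simp: bij_betw_def)
  have inj: "J a = J a' \<longleftrightarrow> a = a'" if "a \<in> A" "a' \<in> A" for a a'
    using that bij by (auto simp: bij_betw_def inj_on_def)
  have "(\<Sum>e\<in>B. cnj (relabel A J M e (J a)) * relabel A J M e (J a')) = (if J a = J a' then 1 else 0) \<and>
    (\<Sum>e\<in>B. relabel A J M (J a) e * cnj (relabel A J M (J a') e)) = (if J a = J a' then 1 else 0)"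
    if m: "a \<in> A" "a' \<in> A" for a a'
  proof -
    have "(\<Sum>e\<in>B. cnj (relabel A J M e (J a)) * relabel A J M e (J a')) = (\<Sum>e\<in>A. cnj (M e a) * M e a')"
      "(\<Sum>e\<in>B. relabel A J M (J a) e * cnj (relabel A J M (J a') e)) = (\<Sum>e\<in>A. M a e * cnj (M a' e))"
      unfolding s using m by (simp_all add: relabel_apply[OF bij])
    then show ?thesis using U m unfolding unitary_on_def inj[OF m] by simp
  qed
  note main = this
  show ?thesis unfolding unitary_on_def
  proof (intro ballI)
    fix a a' assume "a \<in> B" "a' \<in> B"
    then obtain x x' where "x \<in> A" "a = J x" "x' \<in> A" "a' = J x'"
      using B by meson
    then show "(\<Sum>e\<in>B. cnj (relabel A J M e a) * relabel A J M e a') = (if a = a' then 1 else 0) \<and>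
        (\<Sum>e\<in>B. relabel A J M a e * cnj (relabel A J M a' e)) = (if a = a' then 1 else 0)"
      using main by blast
  qed
qed

section \<open>Amplitude amplification\<close>

definition flip_sign :: "('a \<Rightarrow> bool) \<Rightarrow> ('a \<Rightarrow> complex) \<Rightarrow> 'a \<Rightarrow> complex" where
  "flip_sign good \<phi> = (\<lambda>a. if good a then - \<phi> a else \<phi> a)"

definition reflect_about :: "'a set \<Rightarrow> ('a \<Rightarrow> complex) \<Rightarrow> ('a \<Rightarrow> complex) \<Rightarrow> 'a \<Rightarrow> complex" where
  "reflect_about B \<psi> \<phi> = (\<lambda>a. 2 * inner_on B \<psi> \<phi> * \<psi> a - \<phi> a)"

definition grover_step :: "'a set \<Rightarrow> ('a \<Rightarrow> bool) \<Rightarrow> ('a \<Rightarrow> complex) \<Rightarrow> ('a \<Rightarrow> complex) \<Rightarrow> 'a \<Rightarrow> complex" where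
  "grover_step B good \<psi> \<phi> = reflect_about B \<psi> (flip_sign good \<phi>)"

lemma grover_step_cong:
  assumes "\<And>a. a \<in> B \<Longrightarrow> \<phi> a = \<phi>' a" "a \<in> B"
  shows "grover_step B good \<psi> \<phi> a = grover_step B good \<psi> \<phi>' a"
proof -
  have "inner_on B \<psi> (flip_sign good \<phi>) = inner_on B \<psi> (flip_sign good \<phi>')"
    by (intro inner_on_cong) (auto simp: flip_sign_def assms)
  then show ?thesis by (simp add: grover_step_def reflect_about_def flip_sign_def assms)
qed

lemma grover_step_add:
  "grover_step B good \<psi> (\<lambda>a. \<phi> a + k * \<xi> a) = (\<lambda>a. grover_step B good \<psi> \<phi> a + k * grover_step B good \<psi> \<xi> a)"
proof -
  have "flip_sign good (\<lambda>a. \<phi> a + k * \<xi> a) = (\<lambda>a. flip_sign good \<phi> a + k * flip_sign good \<xi> a)"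
    by (auto simp: flip_sign_def)
  then show ?thesis
    by (simp add: grover_step_def reflect_about_def inner_on_add_right inner_on_scale_right algebra_simps)
qed

lemma grover_pow_add:
  "(grover_step B good \<psi> ^^ t) (\<lambda>a. \<phi> a + k * \<xi> a)
    = (\<lambda>a. (grover_step B good \<psi> ^^ t) \<phi> a + k * (grover_step B good \<psi> ^^ t) \<xi> a)"
  by (induction t) (simp_all add: grover_step_add)

lemma grover_pow_zero: "(grover_step B good \<psi> ^^ t) (\<lambda>a. 0) = (\<lambda>a. 0)"
proof -
  have "flip_sign good (\<lambda>a. 0) = (\<lambda>a. 0)" by (auto simp: flip_sign_def)
  then have "grover_step B good \<psi> (\<lambda>a. 0) = (\<lambda>a. 0)"
    by (simp add: grover_step_def reflect_about_def inner_on_def)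
  then show ?thesis by (induction t) simp_all
qed

lemma grover_pow_scale:
  "(grover_step B good \<psi> ^^ t) (\<lambda>a. k * \<phi> a) = (\<lambda>a. k * (grover_step B good \<psi> ^^ t) \<phi> a)"
  using grover_pow_add[of t B good \<psi> "\<lambda>a. 0" k \<phi>] by (simp add: grover_pow_zero)

lemma grover_pow_cong:
  assumes "\<And>a. a \<in> B \<Longrightarrow> \<phi> a = \<phi>' a" "a \<in> B"
  shows "(grover_step B good \<psi> ^^ t) \<phi> a = (grover_step B good \<psi> ^^ t) \<phi>' a"
  using assms(2)
proof (induction t arbitrary: a)
  case (Suc t)
  show ?case unfolding funpow.simps o_def by (rule grover_step_cong) (use Suc in auto)
qed (use assms(1) in simp)

lemma inner_on_flip_sign:
  "inner_on B (flip_sign good \<phi>) (flip_sign good \<xi>) = inner_on B \<phi> \<xi>"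
  unfolding inner_on_def flip_sign_def by (intro sum.cong) auto

lemma inner_on_reflect:
  assumes "inner_on B \<psi> \<psi> = 1"
  shows "inner_on B (reflect_about B \<psi> \<phi>) (reflect_about B \<psi> \<xi>) = inner_on B \<phi> \<xi>"
proof -
  have e: "reflect_about B \<psi> \<phi> = (\<lambda>a. 2 * inner_on B \<psi> \<phi> * \<psi> a - \<phi> a)" for \<phi>
    by (simp add: reflect_about_def)
  show ?thesis
    unfolding e inner_on_diff_left inner_on_diff_right inner_on_scale_left inner_on_scale_right
    using inner_on_commute[of B \<phi> \<psi>] by (simp add: assms algebra_simps)
qed

lemma inner_on_grover_pow:
  assumes "inner_on B \<psi> \<psi> = 1"
  shows "inner_on B ((grover_step B good \<psi> ^^ t) \<phi>) ((grover_step B good \<psi> ^^ t) \<xi>) = inner_on B \<phi> \<xi>"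
  by (induction t) (simp_all add: grover_step_def inner_on_reflect[OF assms] inner_on_flip_sign)

lemma inner_on_split_good:
  fixes \<alpha> \<beta> :: complex
  assumes "finite B" "\<And>a. a \<in> B \<Longrightarrow> \<phi> a = (if good a then \<alpha> else \<beta>) * \<psi> a"
  shows "inner_on B \<psi> \<phi> = \<alpha> * of_real (\<Sum>a | a \<in> B \<and> good a. (cmod (\<psi> a))\<^sup>2)
     + \<beta> * of_real (\<Sum>a | a \<in> B \<and> \<not> good a. (cmod (\<psi> a))\<^sup>2)"
proof -
  have "inner_on B \<psi> \<phi> = (\<Sum>a\<in>B. (if good a then \<alpha> else \<beta>) * of_real ((cmod (\<psi> a))\<^sup>2))"
    unfolding inner_on_def complex_norm_square using assms(2) by (intro sum.cong) (auto simp: mult_ac)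
  also have "\<dots> = (\<Sum>a\<in>B. if good a then \<alpha> * of_real ((cmod (\<psi> a))\<^sup>2) else 0)
      + (\<Sum>a\<in>B. if \<not> good a then \<beta> * of_real ((cmod (\<psi> a))\<^sup>2) else 0)"
    unfolding sum.distrib[symmetric] by (intro sum.cong) auto
  also have "\<dots> = \<alpha> * of_real (\<Sum>a | a \<in> B \<and> good a. (cmod (\<psi> a))\<^sup>2)
     + \<beta> * of_real (\<Sum>a | a \<in> B \<and> \<not> good a. (cmod (\<psi> a))\<^sup>2)"
    using assms(1) by (simp add: sum.inter_filter[symmetric] sum_distrib_left)
  finally show ?thesis .
qed

text \<open>In the plane of the good and the bad part of \<open>\<psi>\<close> the step is a
  rotation by \<open>2 * \<theta>\<close>. The coefficients are specified through their products
  with \<open>sin \<theta>\<close> and \<open>cos \<theta>\<close>, so no case distinction arises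
  when one of the two parts is zero.\<close>

lemma grover_pow_amplitudes:
  assumes fin: "finite B" and unit: "inner_on B \<psi> \<psi> = 1"
    and g: "(\<Sum>a | a \<in> B \<and> good a. (cmod (\<psi> a))\<^sup>2) = (sin \<theta>)\<^sup>2"
  shows "\<exists>\<alpha> \<beta> :: real. \<alpha> * sin \<theta> = sin ((2 * real m + 1) * \<theta>) \<and> \<beta> * cos \<theta> = cos ((2 * real m + 1) * \<theta>) \<and>
    (\<forall>a. (grover_step B good \<psi> ^^ m) \<psi> a = (if good a then of_real \<alpha> else of_real \<beta>) * \<psi> a)"
proof (induction m)
  case 0
  then show ?case by (intro exI[of _ 1]) simp
next
  case (Suc m)
  have "(\<Sum>a | a \<in> B \<and> good a. (cmod (\<psi> a))\<^sup>2) + (\<Sum>a | a \<in> B \<and> \<not> good a. (cmod (\<psi> a))\<^sup>2) = 1"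
  proof -
    have "inner_on B \<psi> \<psi> = 1 * of_real (\<Sum>a | a \<in> B \<and> good a. (cmod (\<psi> a))\<^sup>2)
     + 1 * of_real (\<Sum>a | a \<in> B \<and> \<not> good a. (cmod (\<psi> a))\<^sup>2)"
      by (rule inner_on_split_good) (use fin in auto)
    then have "complex_of_real 1 = of_real ((\<Sum>a | a \<in> B \<and> good a. (cmod (\<psi> a))\<^sup>2) + (\<Sum>a | a \<in> B \<and> \<not> good a. (cmod (\<psi> a))\<^sup>2))"
      by (simp only: unit of_real_add of_real_1 mult_1_left)
    then show ?thesis by (simp only: of_real_eq_iff)
  qed
  then have b: "(\<Sum>a | a \<in> B \<and> \<not> good a. (cmod (\<psi> a))\<^sup>2) = (cos \<theta>)\<^sup>2"
    using g sin_cos_squared_add[of \<theta>] by linarith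
  obtain \<alpha> \<beta> :: real where ab: "\<alpha> * sin \<theta> = sin ((2 * real m + 1) * \<theta>)" "\<beta> * cos \<theta> = cos ((2 * real m + 1) * \<theta>)"
    "\<And>a. (grover_step B good \<psi> ^^ m) \<psi> a = (if good a then of_real \<alpha> else of_real \<beta>) * \<psi> a"
    using Suc by blast
  \<comment> \<open>The overlap of \<open>\<psi>\<close> with the sign-flipped vector. By the
    addition formula it is the cosine of \<open>(2 * m + 2) * \<theta>\<close>.\<close>
  define c where "c = - \<alpha> * (sin \<theta>)\<^sup>2 + \<beta> * (cos \<theta>)\<^sup>2"
  define \<alpha>' \<beta>' where "\<alpha>' = 2 * c + \<alpha>" and "\<beta>' = 2 * c - \<beta>"
  have fl: "flip_sign good ((grover_step B good \<psi> ^^ m) \<psi>) a = (if good a then of_real (- \<alpha>) else of_real \<beta>) * \<psi> a" for a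
    by (simp add: flip_sign_def ab(3))
  have ip: "inner_on B \<psi> (flip_sign good ((grover_step B good \<psi> ^^ m) \<psi>)) = of_real c"
    by (subst inner_on_split_good[OF fin fl]) (simp add: g b c_def)
  have step: "(grover_step B good \<psi> ^^ Suc m) \<psi> a = (if good a then of_real \<alpha>' else of_real \<beta>') * \<psi> a" for a
    unfolding funpow.simps o_def grover_step_def[of B good \<psi> "(grover_step B good \<psi> ^^ m) \<psi>"] reflect_about_def ip fl
    by (simp add: \<alpha>'_def \<beta>'_def algebra_simps)
  have cc: "c = - sin \<theta> * sin ((2 * real m + 1) * \<theta>) + cos \<theta> * cos ((2 * real m + 1) * \<theta>)"
    unfolding c_def ab(1,2)[symmetric] by (simp add: power2_eq_square)
  have ang: "(2 * real (Suc m) + 1) * \<theta> = (2 * real m + 1) * \<theta> + 2 * \<theta>" by (simp add: algebra_simps)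
  have s2: "(sin \<theta>)\<^sup>2 = 1 - (cos \<theta>)\<^sup>2" using sin_cos_squared_add[of \<theta>] by linarith
  have "\<alpha>' * sin \<theta> = 2 * c * sin \<theta> + sin ((2 * real m + 1) * \<theta>)"
    by (simp add: \<alpha>'_def ab(1) distrib_right)
  also have "\<dots> = sin ((2 * real m + 1) * \<theta>) * (1 - 2 * (sin \<theta>)\<^sup>2) + cos ((2 * real m + 1) * \<theta>) * (2 * sin \<theta> * cos \<theta>)"
    unfolding cc by (simp add: algebra_simps power2_eq_square)
  also have "\<dots> = sin ((2 * real (Suc m) + 1) * \<theta>)"
    unfolding ang sin_add[of _ "2 * \<theta>"] cos_double_sin sin_double by simp
  finally have a1: "\<alpha>' * sin \<theta> = sin ((2 * real (Suc m) + 1) * \<theta>)" .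
  have "\<beta>' * cos \<theta> = 2 * c * cos \<theta> - cos ((2 * real m + 1) * \<theta>)"
    by (simp add: \<beta>'_def ab(2) left_diff_distrib)
  also have "\<dots> = cos ((2 * real m + 1) * \<theta>) * (2 * (cos \<theta>)\<^sup>2 - 1) - sin ((2 * real m + 1) * \<theta>) * (2 * sin \<theta> * cos \<theta>)"
    unfolding cc by (simp add: algebra_simps power2_eq_square)
  also have "\<dots> = cos ((2 * real (Suc m) + 1) * \<theta>)"
    unfolding ang cos_add[of _ "2 * \<theta>"] cos_double_cos sin_double by simp
  finally have b1: "\<beta>' * cos \<theta> = cos ((2 * real (Suc m) + 1) * \<theta>)" .
  show ?case using a1 b1 step by blast
qed

lemma grover_pow_success:
  assumes fin: "finite B" and unit: "inner_on B \<psi> \<psi> = 1"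
    and g: "(\<Sum>a | a \<in> B \<and> good a. (cmod (\<psi> a))\<^sup>2) = (sin \<theta>)\<^sup>2"
  shows "(\<Sum>a | a \<in> B \<and> good a. (cmod ((grover_step B good \<psi> ^^ m) \<psi> a))\<^sup>2) = (sin ((2 * real m + 1) * \<theta>))\<^sup>2"
proof -
  obtain \<alpha> \<beta> :: real where ab: "\<alpha> * sin \<theta> = sin ((2 * real m + 1) * \<theta>)"
    "\<And>a. (grover_step B good \<psi> ^^ m) \<psi> a = (if good a then of_real \<alpha> else of_real \<beta>) * \<psi> a"
    using grover_pow_amplitudes[OF assms] by blast
  have "(\<Sum>a | a \<in> B \<and> good a. (cmod ((grover_step B good \<psi> ^^ m) \<psi> a))\<^sup>2)
    = (\<Sum>a | a \<in> B \<and> good a. \<alpha>\<^sup>2 * (cmod (\<psi> a))\<^sup>2)"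
    by (intro sum.cong) (auto simp: ab(2) norm_mult power_mult_distrib)
  also have "\<dots> = (\<alpha> * sin \<theta>)\<^sup>2" by (simp add: g power_mult_distrib flip: sum_distrib_left)
  finally show ?thesis by (simp add: ab(1))
qed

text \<open>
  On vectors supported on the good subspace and orthogonal to \<open>\<psi>\<close> the Grover step is the identity,
  whereas the average of its powers nearly annihilates the good part \<open>\<gamma>\<close> of \<open>\<psi>\<close>: if \<open>\<eta>\<close> is half the
  difference of the bad and the good part, then \<open>G \<eta> - \<eta> = \<gamma>\<close>, so the sum of the powers telescopes.
\<close>

lemma grover_step_orthogonal:
  assumes "\<And>a. a \<in> B \<Longrightarrow> \<not> good a \<Longrightarrow> \<phi> a = 0" "inner_on B \<psi> \<phi> = 0" "a \<in> B"
  shows "grover_step B good \<psi> \<phi> a = \<phi> a"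
proof -
  have fl: "flip_sign good \<phi> a = (-1) * \<phi> a" if "a \<in> B" for a
    using assms(1) that by (auto simp: flip_sign_def)
  have "inner_on B \<psi> (flip_sign good \<phi>) = inner_on B \<psi> (\<lambda>a. (-1) * \<phi> a)"
    by (intro inner_on_cong) (simp_all add: fl)
  also have "\<dots> = 0" using assms(2) by (subst inner_on_scale_right) simp
  finally show ?thesis using fl[OF assms(3)] by (simp add: grover_step_def reflect_about_def)
qed

lemma grover_pow_orthogonal:
  assumes "\<And>a. a \<in> B \<Longrightarrow> \<not> good a \<Longrightarrow> \<phi> a = 0" "inner_on B \<psi> \<phi> = 0" "a \<in> B"
  shows "(grover_step B good \<psi> ^^ t) \<phi> a = \<phi> a"
  using assms(3)
proof (induction t arbitrary: a)
  case (Suc t)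
  have "(grover_step B good \<psi> ^^ Suc t) \<phi> a = grover_step B good \<psi> \<phi> a"
    unfolding funpow.simps o_def by (rule grover_step_cong) (use Suc in auto)
  then show ?case using grover_step_orthogonal[OF assms(1,2) Suc.prems] by simp
qed simp

lemma grover_average_norm:
  assumes fin: "finite B" and unit: "inner_on B \<psi> \<psi> = 1" and n: "n > 0"
    and perp0: "\<And>a. a \<in> B \<Longrightarrow> \<not> good a \<Longrightarrow> \<phi> a = 0" and perp: "inner_on B \<psi> \<phi> = 0"
    and \<gamma>: "\<gamma> = (\<lambda>a. if good a then \<psi> a else 0)"
  shows "norm2_on B \<phi> \<le> norm2_on B (\<lambda>a. (\<Sum>t<n. (grover_step B good \<psi> ^^ t) (\<lambda>a. \<phi> a + of_real k * \<gamma> a) a) / of_nat n)"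
    and "norm2_on B (\<lambda>a. (\<Sum>t<n. (grover_step B good \<psi> ^^ t) (\<lambda>a. \<phi> a + of_real k * \<gamma> a) a) / of_nat n)
      \<le> norm2_on B \<phi> + k\<^sup>2 / (real n)\<^sup>2"
proof -
  let ?G = "grover_step B good \<psi>"
  define h where "h = (\<lambda>a. (if good a then - \<psi> a else \<psi> a) / 2)"
  define H where "H = (\<lambda>a. (?G ^^ n) h a - h a)"
  have flh: "flip_sign good h = (\<lambda>a. 1 / 2 * \<psi> a)" by (auto simp: flip_sign_def h_def)
  have Gh: "?G h = (\<lambda>a. h a + \<gamma> a)"
    unfolding grover_step_def flh reflect_about_def inner_on_scale_right unit
    by (auto simp: h_def \<gamma> field_simps)
  have pow: "(\<Sum>t<m. (?G ^^ t) \<gamma> a) = (?G ^^ m) h a - h a" for m a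
  proof (induction m)
    case (Suc m)
    have "(?G ^^ Suc m) h = (?G ^^ m) (\<lambda>a. h a + 1 * \<gamma> a)"
      unfolding funpow_Suc_right o_def Gh by simp
    also have "\<dots> = (\<lambda>a. (?G ^^ m) h a + 1 * (?G ^^ m) \<gamma> a)" by (rule grover_pow_add)
    finally show ?case using Suc by simp
  qed simp
  have avg: "(\<Sum>t<n. (?G ^^ t) (\<lambda>a. \<phi> a + of_real k * \<gamma> a) a) / of_nat n = \<phi> a + (of_real (k / n)) * H a" if "a \<in> B" for a
  proof -
    have "(\<Sum>t<n. (?G ^^ t) (\<lambda>a. \<phi> a + of_real k * \<gamma> a) a) = (\<Sum>t<n. \<phi> a + of_real k * (?G ^^ t) \<gamma> a)"
      unfolding grover_pow_add
      by (intro sum.cong refl) (simp add: grover_pow_orthogonal[where \<phi>=\<phi>, OF perp0 perp that])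
    also have "\<dots> = of_nat n * \<phi> a + of_real k * H a"
      by (simp add: sum.distrib H_def pow flip: sum_distrib_left)
    finally show ?thesis using n by (simp add: field_simps)
  qed
  \<comment> \<open>\<open>h\<close> agrees with \<open>- \<psi> / 2\<close> on good indices, and
    \<open>\<phi>\<close> vanishes on the others.\<close>
  have phih: "inner_on B \<phi> h = 0"
  proof -
    have "inner_on B \<phi> h = inner_on B \<phi> (\<lambda>a. - 1 / 2 * \<psi> a)"
      unfolding inner_on_def using perp0 by (intro sum.cong) (auto simp: h_def)
    also have "\<dots> = - 1 / 2 * inner_on B \<phi> \<psi>" by (rule inner_on_scale_right)
    also have "\<dots> = 0" using perp inner_on_commute[of B \<phi> \<psi>] by simp
    finally show ?thesis .
  qed
  \<comment> \<open>The powers of the step fix \<open>\<phi>\<close> and preserve inner products, so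
    \<open>h\<close> stays orthogonal to \<open>\<phi>\<close> while it is rotated. This lets the
    squared norm of the average split by Pythagoras.\<close>
  have "inner_on B \<phi> ((?G ^^ n) h) = inner_on B ((?G ^^ n) \<phi>) ((?G ^^ n) h)"
    by (intro inner_on_cong) (simp_all add: grover_pow_orthogonal[where \<phi>=\<phi>, OF perp0 perp])
  also have "\<dots> = 0" by (simp add: inner_on_grover_pow[OF unit] phih)
  finally have phiH: "inner_on B \<phi> H = 0" unfolding H_def inner_on_diff_right phih by simp
  then have Hphi: "inner_on B H \<phi> = 0" using inner_on_commute[of B H \<phi>] by simp
  have eq: "norm2_on B (\<lambda>a. (\<Sum>t<n. (?G ^^ t) (\<lambda>a. \<phi> a + of_real k * \<gamma> a) a) / of_nat n)
    = norm2_on B \<phi> + (k / n)\<^sup>2 * norm2_on B H"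
  proof -
    have "norm2_on B (\<lambda>a. (\<Sum>t<n. (?G ^^ t) (\<lambda>a. \<phi> a + of_real k * \<gamma> a) a) / of_nat n)
      = norm2_on B (\<lambda>a. \<phi> a + (of_real (k / n)) * H a)" by (intro norm2_on_cong avg)
    moreover have "complex_of_real (norm2_on B (\<lambda>a. \<phi> a + (of_real (k / n)) * H a))
      = complex_of_real (norm2_on B \<phi> + (k / n)\<^sup>2 * norm2_on B H)"
      unfolding of_real_add of_real_mult norm2_on_inner inner_on_add_left inner_on_add_right
        inner_on_scale_left inner_on_scale_right phiH Hphi by (simp add: power2_eq_square)
    ultimately show ?thesis by (simp only: of_real_eq_iff)
  qed
  have nh: "norm2_on B h = 1 / 4"
  proof -
    have "norm2_on B h = norm2_on B \<psi> / 4"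
      unfolding norm2_on_def sum_divide_distrib by (intro sum.cong) (auto simp: h_def norm_divide power_divide)
    moreover have "norm2_on B \<psi> = 1" using norm2_on_inner[of B \<psi>] unit by simp
    ultimately show ?thesis by simp
  qed
  have nGh: "norm2_on B ((?G ^^ n) h) = 1 / 4"
    using norm2_on_inner[of B "(?G ^^ n) h"] norm2_on_inner[of B h] inner_on_grover_pow[OF unit, of n good h h] nh
    by (metis of_real_eq_iff)
  \<comment> \<open>A difference of two vectors of squared norm 1/4 has squared norm at most 1,
    whatever \<open>n\<close> is. Dividing the telescoped sum by \<open>n\<close> therefore leaves
    at most \<open>1 / n\<^sup>2\<close>.\<close>
  have "norm2_on B H \<le> 2 * norm2_on B ((?G ^^ n) h) + 2 * norm2_on B h"
    unfolding norm2_on_def sum_distrib_left sum.distrib[symmetric]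
  proof (intro sum_mono)
    fix a
    have "cmod (H a) \<le> cmod ((?G ^^ n) h a) + cmod (h a)" unfolding H_def by (rule norm_triangle_ineq4)
    then have "(cmod (H a))\<^sup>2 \<le> (cmod ((?G ^^ n) h a) + cmod (h a))\<^sup>2" by (intro power_mono) auto
    also have "\<dots> \<le> 2 * (cmod ((?G ^^ n) h a))\<^sup>2 + 2 * (cmod (h a))\<^sup>2"
      using sum_squares_bound[of "cmod ((?G ^^ n) h a)" "cmod (h a)"] by (simp add: power2_sum)
    finally show "(cmod (H a))\<^sup>2 \<le> 2 * (cmod ((?G ^^ n) h a))\<^sup>2 + 2 * (cmod (h a))\<^sup>2" .
  qed
  then have H1: "norm2_on B H \<le> 1" using nh nGh by simp
  show "norm2_on B \<phi> \<le> norm2_on B (\<lambda>a. (\<Sum>t<n. (?G ^^ t) (\<lambda>a. \<phi> a + of_real k * \<gamma> a) a) / of_nat n)"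
    unfolding eq using norm2_on_nonneg[of B H] by simp
  have "(k / n)\<^sup>2 * norm2_on B H \<le> (k / n)\<^sup>2 * 1" using H1 by (intro mult_left_mono) auto
  then show "norm2_on B (\<lambda>a. (\<Sum>t<n. (?G ^^ t) (\<lambda>a. \<phi> a + of_real k * \<gamma> a) a) / of_nat n)
      \<le> norm2_on B \<phi> + k\<^sup>2 / (real n)\<^sup>2"
    unfolding eq by (simp add: power_divide)
qed

text \<open>The first factor is the sign flip. The others conjugate the reflection about
  \<open>z0\<close> by the preparation, which yields the reflection about the prepared state without
  that state being known.\<close>

definition grover_ops :: "('a \<Rightarrow> bool) \<Rightarrow> 'a \<Rightarrow> ('a \<Rightarrow> 'a \<Rightarrow> complex) list \<Rightarrow> ('a \<Rightarrow> 'a \<Rightarrow> complex) list" where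
  "grover_ops good z0 Us = [diag_op (\<lambda>a. if good a then -1 else 1)] @ inv_ops Us @
     [diag_op (\<lambda>a. if a = z0 then 1 else -1)] @ Us"

lemma run_reflect_ops:
  assumes U: "\<forall>U\<in>set Us. unitary_on B U" and fin: "finite B" and z0: "z0 \<in> B" and a: "a \<in> B"
  shows "run_ops B (inv_ops Us @ [diag_op (\<lambda>a. if a = z0 then 1 else -1)] @ Us) \<phi> a
     = reflect_about B (run_ops B Us (unit_at z0)) \<phi> a"
proof -
  define \<phi>' where "\<phi>' = run_ops B (inv_ops Us) \<phi>"
  have d: "mapply B (diag_op (\<lambda>a. if a = z0 then 1 else -1)) \<phi>' a = 2 * \<phi>' z0 * unit_at z0 a - \<phi>' a" if "a \<in> B" for a
    using mapply_diag[OF fin that] by (auto simp: unit_at_def)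
  have "run_ops B (inv_ops Us @ [diag_op (\<lambda>a. if a = z0 then 1 else -1)] @ Us) \<phi> a
    = run_ops B Us (mapply B (diag_op (\<lambda>a. if a = z0 then 1 else -1)) \<phi>') a"
    by (simp add: \<phi>'_def)
  also have "\<dots> = run_ops B Us (\<lambda>a. 2 * \<phi>' z0 * unit_at z0 a - \<phi>' a) a"
    by (rule run_ops_cong) (use d a in auto)
  also have "\<dots> = 2 * \<phi>' z0 * run_ops B Us (unit_at z0) a - run_ops B Us \<phi>' a"
    unfolding run_ops_diff run_ops_scale ..
  also have "run_ops B Us \<phi>' a = \<phi> a" unfolding \<phi>'_def by (rule run_ops_inv_right[OF U fin a])
  also have "\<phi>' z0 = inner_on B (unit_at z0) \<phi>'" by (rule inner_on_unit_at[OF fin z0, symmetric])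
  also have "\<dots> = inner_on B (run_ops B Us (unit_at z0)) \<phi>"
    unfolding \<phi>'_def by (rule inner_on_run_ops_inv[OF U fin])
  finally show ?thesis by (simp add: reflect_about_def)
qed

lemma run_grover_ops:
  assumes U: "\<forall>U\<in>set Us. unitary_on B U" and fin: "finite B" and z0: "z0 \<in> B" and a: "a \<in> B"
  shows "run_ops B (grover_ops good z0 Us) \<phi> a = grover_step B good (run_ops B Us (unit_at z0)) \<phi> a"
proof -
  have "run_ops B (grover_ops good z0 Us) \<phi> a = run_ops B (inv_ops Us @ [diag_op (\<lambda>a. if a = z0 then 1 else -1)] @ Us)
     (mapply B (diag_op (\<lambda>a. if good a then -1 else 1)) \<phi>) a"
    by (simp add: grover_ops_def)
  also have "\<dots> = run_ops B (inv_ops Us @ [diag_op (\<lambda>a. if a = z0 then 1 else -1)] @ Us) (flip_sign good \<phi>) a"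
    by (rule run_ops_cong) (use mapply_diag[OF fin] a in \<open>auto simp: flip_sign_def\<close>)
  also have "\<dots> = grover_step B good (run_ops B Us (unit_at z0)) \<phi> a"
    unfolding grover_step_def by (rule run_reflect_ops[OF assms])
  finally show ?thesis .
qed

lemma run_grover_ops_pow:
  assumes U: "\<forall>U\<in>set Us. unitary_on B U" and fin: "finite B" and z0: "z0 \<in> B" and a: "a \<in> B"
  shows "run_ops B (concat (replicate m (grover_ops good z0 Us))) \<phi> a
    = (grover_step B good (run_ops B Us (unit_at z0)) ^^ m) \<phi> a"
  using a
proof (induction m arbitrary: \<phi> a)
  case (Suc m)
  let ?G = "grover_step B good (run_ops B Us (unit_at z0))"
  have "run_ops B (concat (replicate (Suc m) (grover_ops good z0 Us))) \<phi> a
     = run_ops B (concat (replicate m (grover_ops good z0 Us))) (run_ops B (grover_ops good z0 Us) \<phi>) a"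
    by simp
  also have "\<dots> = run_ops B (concat (replicate m (grover_ops good z0 Us))) (?G \<phi>) a"
    by (rule run_ops_cong) (use Suc.prems run_grover_ops[OF U fin z0] in auto)
  also have "\<dots> = (?G ^^ Suc m) \<phi> a" unfolding funpow_Suc_right o_def using Suc by simp
  finally show ?case .
qed simp

lemma amplitude_amplification:
  assumes U: "\<forall>U\<in>set Us. unitary_on B U" and fin: "finite B" and z0: "z0 \<in> B"
    and g: "(\<Sum>a | a \<in> B \<and> good a. (cmod (run_ops B Us (unit_at z0) a))\<^sup>2) = (sin \<theta>)\<^sup>2"
  shows "(\<Sum>a | a \<in> B \<and> good a.
      (cmod (run_ops B (Us @ concat (replicate m (grover_ops good z0 Us))) (unit_at z0) a))\<^sup>2)
    = (sin ((2 * real m + 1) * \<theta>))\<^sup>2"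
proof -
  let ?\<psi> = "run_ops B Us (unit_at z0)"
  have unit: "inner_on B ?\<psi> ?\<psi> = 1"
    unfolding inner_on_run_ops[OF U fin] inner_on_unit_at[OF fin z0] by (simp add: unit_at_def)
  have "(\<Sum>a | a \<in> B \<and> good a.
      (cmod (run_ops B (Us @ concat (replicate m (grover_ops good z0 Us))) (unit_at z0) a))\<^sup>2)
    = (\<Sum>a | a \<in> B \<and> good a. (cmod ((grover_step B good ?\<psi> ^^ m) ?\<psi> a))\<^sup>2)"
    by (intro sum.cong refl) (simp add: run_grover_ops_pow[OF U fin z0])
  also have "\<dots> = (sin ((2 * real m + 1) * \<theta>))\<^sup>2" by (rule grover_pow_success[OF fin unit g])
  finally show ?thesis .
qed

section \<open>Circuits and repeated measurement\<close>

text \<open>Circuits are the measurement-free pieces of programs. Unlike programs they can be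
  inverted, as amplitude amplification demands. The index type is a parameter because they are first
  written on structured registers.\<close>

datatype 'a gate = Apply "'a \<Rightarrow> 'a \<Rightarrow> complex" | Prior | Prior_Inverse | Likelihood

primrec gate_op ::
  "(real \<Rightarrow> real \<Rightarrow> complex) \<Rightarrow> (basis \<Rightarrow> basis \<Rightarrow> complex) \<Rightarrow> basis gate \<Rightarrow> basis \<Rightarrow> basis \<Rightarrow> complex" where
  "gate_op V Q (Apply U) = U"
| "gate_op V Q Prior = on_latent V"
| "gate_op V Q Prior_Inverse = on_latent (adjoint_op V)"
| "gate_op V Q Likelihood = Q"

primrec gate_cost :: "'a gate \<Rightarrow> nat" where
  "gate_cost (Apply U) = 0"
| "gate_cost Prior = 1"
| "gate_cost Prior_Inverse = 1"
| "gate_cost Likelihood = 1"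

text \<open>A likelihood query undoes itself since xor with the same string twice cancels. Inversion
  thus preserves the number of queries.\<close>

primrec gate_inverse :: "'a gate \<Rightarrow> 'a gate" where
  "gate_inverse (Apply U) = Apply (adjoint_op U)"
| "gate_inverse Prior = Prior_Inverse"
| "gate_inverse Prior_Inverse = Prior"
| "gate_inverse Likelihood = Likelihood"

primrec add_gate :: "basis gate \<Rightarrow> program \<Rightarrow> program" where
  "add_gate (Apply U) p = Unitary U p"
| "add_gate Prior p = Query_Prior p"
| "add_gate Prior_Inverse p = Query_Prior_Inverse p"
| "add_gate Likelihood p = Query_Likelihood p"

definition circuit_cost :: "'a gate list \<Rightarrow> nat" where
  "circuit_cost cs = sum_list (map gate_cost cs)"

definition circuit_inverse :: "'a gate list \<Rightarrow> 'a gate list" where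
  "circuit_inverse cs = rev (map gate_inverse cs)"

definition circuit_ok :: "'a set \<Rightarrow> 'a gate list \<Rightarrow> bool" where
  "circuit_ok B cs \<longleftrightarrow> (\<forall>U. Apply U \<in> set cs \<longrightarrow> unitary_on B U)"

lemma circuit_cost_simps [simp]:
  "circuit_cost [] = 0" "circuit_cost (g # cs) = gate_cost g + circuit_cost cs"
  "circuit_cost (cs @ ds) = circuit_cost cs + circuit_cost ds"
  by (simp_all add: circuit_cost_def)

lemma gate_cost_inverse [simp]: "gate_cost (gate_inverse g) = gate_cost g"
  by (cases g) auto

lemma circuit_cost_inverse [simp]: "circuit_cost (circuit_inverse cs) = circuit_cost cs"
  by (simp add: circuit_cost_def circuit_inverse_def rev_map[symmetric] o_def)

lemma circuit_cost_concat_replicate [simp]: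
  "circuit_cost (concat (replicate m cs)) = m * circuit_cost cs"
  by (induction m) auto

lemma circuit_ok_simps [simp]:
  "circuit_ok B []" "circuit_ok B (Apply U # cs) \<longleftrightarrow> unitary_on B U \<and> circuit_ok B cs"
  "circuit_ok B (Prior # cs) \<longleftrightarrow> circuit_ok B cs" "circuit_ok B (Prior_Inverse # cs) \<longleftrightarrow> circuit_ok B cs"
  "circuit_ok B (Likelihood # cs) \<longleftrightarrow> circuit_ok B cs"
  "circuit_ok B (cs @ ds) \<longleftrightarrow> circuit_ok B cs \<and> circuit_ok B ds"
  by (auto simp: circuit_ok_def)

lemma circuit_ok_concat: "circuit_ok B (concat css) \<longleftrightarrow> (\<forall>cs\<in>set css. circuit_ok B cs)"
  by (induction css) auto

lemma circuit_ok_inverse: "circuit_ok B cs \<Longrightarrow> circuit_ok B (circuit_inverse cs)"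
proof (induction cs)
  case (Cons g cs)
  then show ?case by (cases g) (auto simp: circuit_inverse_def unitary_adjoint)
qed (simp add: circuit_inverse_def)

lemma output_prob_cong:
  "(\<And>a. a \<in> B \<Longrightarrow> \<phi> a = \<psi> a) \<Longrightarrow> output_prob B V Q p \<phi> R = output_prob B V Q p \<psi> R"
proof (induction p arbitrary: \<phi> \<psi>)
  case (Output r)
  then show ?case using norm2_on_cong[of B \<phi> \<psi>] by (simp add: weight_norm2_on)
next
  case (Measure m f)
  show ?case unfolding output_prob.simps
    by (intro sum.cong refl Measure.IH) (use Measure.prems in auto)
next
  case (Unitary U p)
  have "mapply B (U) \<phi> = mapply B (U) \<psi>" by (rule mapply_cong) (use Unitary.prems in auto)
  then show ?case by (simp add: apply_op_mapply)
next
  case (Query_Prior p)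
  have "mapply B (on_latent V) \<phi> = mapply B (on_latent V) \<psi>" by (rule mapply_cong) (use Query_Prior.prems in auto)
  then show ?case by (simp add: apply_op_mapply)
next
  case (Query_Prior_Inverse p)
  have "mapply B (on_latent (adjoint_op V)) \<phi> = mapply B (on_latent (adjoint_op V)) \<psi>" by (rule mapply_cong) (use Query_Prior_Inverse.prems in auto)
  then show ?case by (simp add: apply_op_mapply)
next
  case (Query_Likelihood p)
  have "mapply B (Q) \<phi> = mapply B (Q) \<psi>" by (rule mapply_cong) (use Query_Likelihood.prems in auto)
  then show ?case by (simp add: apply_op_mapply)
qed

lemma expected_queries_cong:
  "(\<And>a. a \<in> B \<Longrightarrow> \<phi> a = \<psi> a) \<Longrightarrow> expected_queries B V Q p \<phi> = expected_queries B V Q p \<psi>"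
proof (induction p arbitrary: \<phi> \<psi>)
  case (Measure m f)
  show ?case unfolding expected_queries.simps
    by (intro sum.cong refl Measure.IH) (use Measure.prems in auto)
next
  case (Output r)
  then show ?case by simp
next
  case (Unitary U p)
  have "mapply B (U) \<phi> = mapply B (U) \<psi>" by (rule mapply_cong) (use Unitary.prems in auto)
  then show ?case by (simp add: apply_op_mapply)
next
  case (Query_Prior p)
  have "mapply B (on_latent V) \<phi> = mapply B (on_latent V) \<psi>" by (rule mapply_cong) (use Query_Prior.prems in auto)
  then show ?case using norm2_on_cong[of B \<phi> \<psi>] Query_Prior.prems by (simp add: apply_op_mapply weight_norm2_on)
next
  case (Query_Prior_Inverse p)
  have "mapply B (on_latent (adjoint_op V)) \<phi> = mapply B (on_latent (adjoint_op V)) \<psi>" by (rule mapply_cong) (use Query_Prior_Inverse.prems in auto)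
  then show ?case using norm2_on_cong[of B \<phi> \<psi>] Query_Prior_Inverse.prems by (simp add: apply_op_mapply weight_norm2_on)
next
  case (Query_Likelihood p)
  have "mapply B (Q) \<phi> = mapply B (Q) \<psi>" by (rule mapply_cong) (use Query_Likelihood.prems in auto)
  then show ?case using norm2_on_cong[of B \<phi> \<psi>] Query_Likelihood.prems by (simp add: apply_op_mapply weight_norm2_on)
qed

lemma norm2_on_scale: "norm2_on B (\<lambda>a. k * \<psi> a) = (cmod k)\<^sup>2 * norm2_on B \<psi>"
  by (simp add: norm2_on_def norm_mult power_mult_distrib sum_distrib_left)

text \<open>Probabilities are quadratic in the unnormalised state. This turns the amplitude of a
  measured outcome into the weight of its branch.\<close>

lemma output_prob_scale:
  "output_prob B V Q p (\<lambda>a. k * \<psi> a) R = (cmod k)\<^sup>2 * output_prob B V Q p \<psi> R"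
proof (induction p arbitrary: \<psi>)
  case (Measure m f)
  have e: "(\<lambda>a. if m a = i then k * \<psi> a else 0) = (\<lambda>a. k * (if m a = i then \<psi> a else 0))" for i
    by auto
  show ?case unfolding output_prob.simps e sum_distrib_left by (intro sum.cong refl Measure.IH) auto
qed (simp_all add: apply_op_mapply mapply_scale weight_norm2_on norm2_on_scale)

lemma expected_queries_scale:
  "expected_queries B V Q p (\<lambda>a. k * \<psi> a) = (cmod k)\<^sup>2 * expected_queries B V Q p \<psi>"
proof (induction p arbitrary: \<psi>)
  case (Measure m f)
  have e: "(\<lambda>a. if m a = i then k * \<psi> a else 0) = (\<lambda>a. k * (if m a = i then \<psi> a else 0))" for i
    by auto
  show ?case unfolding expected_queries.simps e sum_distrib_left by (intro sum.cong refl Measure.IH) auto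
qed (simp_all add: apply_op_mapply mapply_scale weight_norm2_on norm2_on_scale algebra_simps)

lemma output_prob_nonneg: "0 \<le> output_prob B V Q p \<psi> R"
  by (induction p arbitrary: \<psi>) (auto simp: weight_norm2_on norm2_on_nonneg intro: sum_nonneg)

definition exchange :: "'a \<Rightarrow> 'a \<Rightarrow> 'a \<Rightarrow> 'a" where
  "exchange a b c = (if c = a then b else if c = b then a else c)"

definition outcome_code :: "basis set \<Rightarrow> basis \<Rightarrow> nat" where
  "outcome_code B = (SOME f. inj_on f B)"

text \<open>Results of \<open>Measure\<close> are natural numbers, so a full measurement needs a
  numbering of \<open>B\<close>. Numbers that code no state are sent to \<open>a0\<close>:
  \<open>well_formed\<close> ranges over all results, and the exchange that follows must be unitary
  for impossible ones too.\<close>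

definition outcome_decode :: "basis set \<Rightarrow> basis \<Rightarrow> nat \<Rightarrow> basis" where
  "outcome_decode B a0 i = (if i \<in> outcome_code B ` B then inv_into B (outcome_code B) i else a0)"

text \<open>
  All registers are measured and a permutation returns the known outcome to \<open>a0\<close>, so that every
  circuit of a program starts from the same basis state.
\<close>

definition run_circuit :: "basis set \<Rightarrow> basis \<Rightarrow> basis gate list \<Rightarrow> (basis \<Rightarrow> program) \<Rightarrow> program" where
  "run_circuit B a0 cs k = foldr add_gate cs (Measure (outcome_code B)
     (\<lambda>i. Unitary (perm_op (exchange (outcome_decode B a0 i) a0)) (k (outcome_decode B a0 i))))"

lemma inj_outcome_code: "finite B \<Longrightarrow> inj_on (outcome_code B) B"
  unfolding outcome_code_def using finite_imp_inj_to_nat_seg[of B] by (intro someI_ex[of "\<lambda>f. inj_on f B"]) blast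

lemma outcome_decode_in: "finite B \<Longrightarrow> a0 \<in> B \<Longrightarrow> outcome_decode B a0 i \<in> B"
  by (auto simp: outcome_decode_def inv_into_into)

lemma outcome_decode_code: "finite B \<Longrightarrow> a \<in> B \<Longrightarrow> outcome_decode B a0 (outcome_code B a) = a"
  by (simp add: outcome_decode_def inj_outcome_code inv_into_f_f)

lemma unitary_exchange: "finite B \<Longrightarrow> a \<in> B \<Longrightarrow> b \<in> B \<Longrightarrow> unitary_on B (perm_op (exchange a b))"
  by (rule unitary_perm) (auto simp: exchange_def)

lemma well_formed_gates:
  "circuit_ok B cs \<Longrightarrow> well_formed B p \<Longrightarrow> well_formed B (foldr add_gate cs p)"
proof (induction cs)
  case (Cons g cs)
  then show ?case by (cases g) auto
qed simp

lemma well_formed_run_circuit: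
  "finite B \<Longrightarrow> a0 \<in> B \<Longrightarrow> circuit_ok B cs \<Longrightarrow> (\<And>a. well_formed B (k a)) \<Longrightarrow> well_formed B (run_circuit B a0 cs k)"
  unfolding run_circuit_def
  by (rule well_formed_gates) (auto intro!: unitary_exchange outcome_decode_in)

text \<open>The model enters the analysis of programs only through these properties of its two
  operators; what they say about the prior and the likelihood is added by later locales.\<close>

locale query_model =
  fixes B :: "basis set" and V :: "real \<Rightarrow> real \<Rightarrow> complex" and Q :: "basis \<Rightarrow> basis \<Rightarrow> complex"
    and a0 :: basis
  assumes fin: "finite B" and a0: "a0 \<in> B"
    and V: "unitary_on B (on_latent V)" and Q: "unitary_on B Q"
    and Q_self: "\<And>a a'. a \<in> B \<Longrightarrow> a' \<in> B \<Longrightarrow> adjoint_op Q a a' = Q a a'"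
begin

abbreviation "ops cs \<equiv> map (gate_op V Q) cs"

definition outp where "outp p R = output_prob B V Q p (unit_at a0) R"
definition expq where "expq p = expected_queries B V Q p (unit_at a0)"

lemma on_latent_adjoint: "on_latent (adjoint_op V) = adjoint_op (on_latent V)"
  by (auto simp: on_latent_def adjoint_op_def fun_eq_iff)

lemma ops_unitary: "circuit_ok B cs \<Longrightarrow> \<forall>U\<in>set (ops cs). unitary_on B U"
proof (induction cs)
  case (Cons g cs)
  then show ?case by (cases g) (auto simp: V Q on_latent_adjoint unitary_adjoint)
qed simp

lemma mapply_ops_inverse:
  "mapply B (gate_op V Q (gate_inverse g)) \<psi> a = mapply B (adjoint_op (gate_op V Q g)) \<psi> a" if "a \<in> B"
proof (cases g)
  case Likelihood
  then show ?thesis using Q_self that by (auto simp: mapply_def intro!: sum.cong)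
next
  case Prior_Inverse
  then show ?thesis by (simp add: on_latent_adjoint)
qed (simp_all add: on_latent_adjoint)

lemma run_ops_inverse:
  assumes "a \<in> B"
  shows "run_ops B (ops (circuit_inverse cs)) \<psi> a = run_ops B (inv_ops (ops cs)) \<psi> a"
  using assms
proof (induction cs arbitrary: \<psi> a)
  case (Cons g cs)
  have "run_ops B (ops (circuit_inverse (g # cs))) \<psi> a
     = mapply B (gate_op V Q (gate_inverse g)) (run_ops B (ops (circuit_inverse cs)) \<psi>) a"
    by (simp add: circuit_inverse_def)
  also have "\<dots> = mapply B (adjoint_op (gate_op V Q g)) (run_ops B (ops (circuit_inverse cs)) \<psi>) a"
    by (rule mapply_ops_inverse[OF Cons.prems])
  also have "\<dots> = mapply B (adjoint_op (gate_op V Q g)) (run_ops B (inv_ops (ops cs)) \<psi>) a"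
    by (subst mapply_cong[where \<psi>="run_ops B (inv_ops (ops cs)) \<psi>"]) (use Cons.IH in auto)
  also have "\<dots> = run_ops B (inv_ops (ops (g # cs))) \<psi> a" by (simp add: inv_ops_def)
  finally show ?case .
qed (simp add: circuit_inverse_def inv_ops_def)

lemma outp_gates:
  "output_prob B V Q (foldr add_gate cs p) \<psi> R = output_prob B V Q p (run_ops B (ops cs) \<psi>) R"
proof (induction cs arbitrary: \<psi>)
  case (Cons g cs)
  then show ?case by (cases g) (simp_all add: apply_op_mapply)
qed simp

text \<open>Gates preserve the weight of the branch, so every query of a circuit is charged the same
  amount.\<close>

lemma expq_gates:
  "circuit_ok B cs \<Longrightarrow> expected_queries B V Q (foldr add_gate cs p) \<psi>
    = real (circuit_cost cs) * norm2_on B \<psi> + expected_queries B V Q p (run_ops B (ops cs) \<psi>)"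
proof (induction cs arbitrary: \<psi>)
  case (Cons g cs)
  have u: "unitary_on B (gate_op V Q g)" using ops_unitary[OF Cons.prems] by simp
  show ?case using Cons norm2_on_unitary[OF u fin, of \<psi>]
    by (cases g) (simp_all add: apply_op_mapply weight_norm2_on algebra_simps)
qed simp

definition circuit_prob :: "basis gate list \<Rightarrow> basis \<Rightarrow> real" where
  "circuit_prob cs a = (cmod (run_ops B (ops cs) (unit_at a0) a))\<^sup>2"

lemma circuit_prob_nonneg: "0 \<le> circuit_prob cs a"
  by (simp add: circuit_prob_def)

lemma circuit_prob_sum: "circuit_ok B cs \<Longrightarrow> (\<Sum>a\<in>B. circuit_prob cs a) = 1"
  using norm2_on_run_ops[OF ops_unitary fin, of cs "unit_at a0"] norm2_on_unit_at[OF fin a0]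
  by (simp add: circuit_prob_def norm2_on_def)

text \<open>The surviving branch is a multiple of the state \<open>b\<close>, and the exchange moves
  it to \<open>a0\<close>. Hence the continuation starts from a multiple of the initial state and
  can be analysed on its own.\<close>

lemma measured_state:
  assumes "a \<in> B" "b \<in> B"
  shows "mapply B (perm_op (exchange b a0)) (\<lambda>a. if outcome_code B a = outcome_code B b then \<psi> a else 0) a
     = \<psi> b * unit_at a0 a"
proof -
  have "mapply B (perm_op (exchange b a0)) (\<lambda>a. if outcome_code B a = outcome_code B b then \<psi> a else 0) a
    = (\<lambda>a. if outcome_code B a = outcome_code B b then \<psi> a else 0) (exchange b a0 a)"
    by (rule mapply_perm) (use fin assms a0 in \<open>auto simp: exchange_def\<close>)
  also have "\<dots> = (if exchange b a0 a = b then \<psi> b else 0)"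
    using inj_onD[OF inj_outcome_code[OF fin], of "exchange b a0 a" b] assms a0 by (auto simp: exchange_def)
  also have "\<dots> = \<psi> b * unit_at a0 a" by (auto simp: exchange_def unit_at_def)
  finally show ?thesis .
qed

text \<open>The law of total probability for a circuit followed by a classical choice of the
  continuation.\<close>

lemma outp_run_circuit:
  "outp (run_circuit B a0 cs k) R = (\<Sum>a\<in>B. circuit_prob cs a * outp (k a) R)"
proof -
  let ?\<psi> = "run_ops B (ops cs) (unit_at a0)"
  have "outp (run_circuit B a0 cs k) R = (\<Sum>b\<in>B. output_prob B V Q
      (Unitary (perm_op (exchange (outcome_decode B a0 (outcome_code B b)) a0)) (k (outcome_decode B a0 (outcome_code B b))))
      (\<lambda>a. if outcome_code B a = outcome_code B b then ?\<psi> a else 0) R)"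
    unfolding outp_def run_circuit_def outp_gates output_prob.simps(6)
    by (rule sum.reindex[OF inj_outcome_code[OF fin], unfolded o_def])
  also have "\<dots> = (\<Sum>b\<in>B. output_prob B V Q (k b) (\<lambda>a. ?\<psi> b * unit_at a0 a) R)"
    by (intro sum.cong refl)
      (auto simp: outcome_decode_code[OF fin] apply_op_mapply measured_state intro!: output_prob_cong)
  finally show ?thesis by (simp add: output_prob_scale circuit_prob_def outp_def)
qed

lemma expq_run_circuit:
  assumes "circuit_ok B cs"
  shows "expq (run_circuit B a0 cs k) = real (circuit_cost cs) + (\<Sum>a\<in>B. circuit_prob cs a * expq (k a))"
proof -
  let ?\<psi> = "run_ops B (ops cs) (unit_at a0)"
  have "expq (run_circuit B a0 cs k) = real (circuit_cost cs) + (\<Sum>b\<in>B. expected_queries B V Q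
      (Unitary (perm_op (exchange (outcome_decode B a0 (outcome_code B b)) a0)) (k (outcome_decode B a0 (outcome_code B b))))
      (\<lambda>a. if outcome_code B a = outcome_code B b then ?\<psi> a else 0))"
    unfolding expq_def run_circuit_def expq_gates[OF assms] norm2_on_unit_at[OF fin a0] expected_queries.simps(6) mult_1_right
    by (subst sum.reindex[OF inj_outcome_code[OF fin], unfolded o_def]) (rule refl)
  also have "\<dots> = real (circuit_cost cs) + (\<Sum>b\<in>B. expected_queries B V Q (k b) (\<lambda>a. ?\<psi> b * unit_at a0 a))"
    by (intro sum.cong refl arg_cong2[where f="(+)"])
      (auto simp: outcome_decode_code[OF fin] apply_op_mapply measured_state intro!: expected_queries_cong)
  finally show ?thesis by (simp add: expected_queries_scale circuit_prob_def expq_def)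
qed

end

section \<open>Estimating the angle of an amplitude\<close>

text \<open>
  The square of the sine is monotone on each quadrant. If the interval is long compared with its
  distance from 0, it can be stretched to lie in the first quadrant; otherwise the multiple is chosen
  such that the left end lands just to the right of a multiple of \<open>pi / 2\<close>.
\<close>

lemma odd_multiple_in_quadrant:
  assumes l: "0 \<le> l" and lu: "l < u" and u: "u \<le> pi / 6"
  shows "\<exists>(m::nat) (i::nat). real i * (pi / 2) \<le> (2 * real m + 1) * l \<and>
    (2 * real m + 1) * u \<le> (real i + 1) * (pi / 2) \<and> pi / 78 \<le> (2 * real m + 1) * (u - l)"
proof (cases "l \<le> 12 * (u - l)")
  case True
  define t where "t = pi / (2 * u)"
  \<comment> \<open>\<open>2 * m + 1\<close> is the largest odd integer not above \<open>t\<close>,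
    the factor that carries \<open>u\<close> exactly to \<open>pi / 2\<close>.\<close>
  define m where "m = nat \<lfloor>(t - 1) / 2\<rfloor>"
  have tu: "t * u = pi / 2" using l lu by (simp add: t_def)
  have t3: "3 \<le> t" using l lu u by (simp add: t_def field_simps)
  have m: "(t - 1) / 2 - 1 < real m" "real m \<le> (t - 1) / 2"
  proof -
    have "0 \<le> \<lfloor>(t - 1) / 2\<rfloor>" using t3 by simp
    then show "(t - 1) / 2 - 1 < real m" "real m \<le> (t - 1) / 2" unfolding m_def by linarith+
  qed
  have "(2 * real m + 1) * u \<le> t * u" using m l lu by (intro mult_right_mono) auto
  moreover have "pi / 78 \<le> (2 * real m + 1) * (u - l)"
  proof -
    \<comment> \<open>In this case \<open>u \<le> 13 * (u - l)\<close>, and passing to an odd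
      integer loses at most a factor 3 because \<open>t \<ge> 3\<close>. This gives 78 as 2 * 13 *
      3.\<close>
    have "pi / 2 \<le> t * (13 * (u - l))" unfolding tu[symmetric] using True t3 by (intro mult_left_mono) auto
    then have "pi / 78 \<le> t / 3 * (u - l)" by (simp add: algebra_simps)
    also have "\<dots> \<le> (2 * real m + 1) * (u - l)"
    proof (rule mult_right_mono)
      show "t / 3 \<le> 2 * real m + 1" using m(1) t3 by (simp add: field_simps)
    qed (use lu in simp)
    finally show ?thesis .
  qed
  ultimately show ?thesis using l tu by (intro exI[of _ m] exI[of _ 0]) auto
next
  case False
  define w where "w = u - l"
  have w: "0 < w" "12 * w < l" using lu False by (auto simp: w_def)
  \<comment> \<open>The number of the quadrant is such that stretching \<open>l\<close> to its left
    end stretches the width \<open>w\<close> to a length between \<open>pi / 24\<close> and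
    \<open>pi / 12\<close>.\<close>
  define i where "i = nat \<lfloor>l / (6 * w)\<rfloor>"
  have lw: "2 \<le> l / (6 * w)" using w by (simp add: field_simps)
  have i: "l / (12 * w) \<le> real i" "real i \<le> l / (6 * w)"
  proof -
    have "l / (6 * w) - 1 < real i" "real i \<le> l / (6 * w)"
    proof -
      have "0 \<le> \<lfloor>l / (6 * w)\<rfloor>" using lw by simp
      then show "l / (6 * w) - 1 < real i" "real i \<le> l / (6 * w)" unfolding i_def by linarith+
    qed
    moreover have "l / (12 * w) = (l / (6 * w)) / 2" by simp
    ultimately show "l / (12 * w) \<le> real i" "real i \<le> l / (6 * w)" using lw by linarith+
  qed
  define t where "t = real i * (pi / 2) / l"
  define m where "m = nat \<lceil>(t - 1) / 2\<rceil>"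
  have l0: "0 < l" using w by linarith
  have tl: "t * l = real i * (pi / 2)" using l0 by (simp add: t_def)
  have tw: "pi / 24 \<le> t * w" "t * w \<le> pi / 12"
  proof -
    have e: "t * w = (real i * (w / l)) * (pi / 2)" by (simp add: t_def field_simps)
    have "1 / 12 \<le> real i * (w / l)" "real i * (w / l) \<le> 1 / 6"
      using i w l0 by (auto simp: field_simps)
    then have "1 / 12 * (pi / 2) \<le> t * w" "t * w \<le> 1 / 6 * (pi / 2)"
      unfolding e by (intro mult_right_mono; simp)+
    then show "pi / 24 \<le> t * w" "t * w \<le> pi / 12" by simp_all
  qed
  have t0: "0 \<le> t" using l0 by (simp add: t_def)
  have m: "t \<le> 2 * real m + 1" "2 * real m + 1 \<le> t + 2"
  proof -
    have "- 1 < (t - 1) / 2" using t0 by (simp add: field_simps)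
    then have "0 \<le> \<lceil>(t - 1) / 2\<rceil>" by linarith
    then have "(t - 1) / 2 \<le> real m" "real m < (t - 1) / 2 + 1" unfolding m_def by linarith+
    then show "t \<le> 2 * real m + 1" "2 * real m + 1 \<le> t + 2" by (simp_all add: field_simps)
  qed
  have "t * l \<le> (2 * real m + 1) * l" using m l0 by (intro mult_right_mono) auto
  moreover have "(2 * real m + 1) * u \<le> (real i + 1) * (pi / 2)"
  proof -
    \<comment> \<open>Rounding \<open>t\<close> up to an odd integer moves the right end by at most
      \<open>2 * u \<le> pi / 3\<close>. Together with \<open>t * w \<le> pi / 12\<close> this stays
      within one quadrant; the bound \<open>pi / 6\<close> on \<open>u\<close> is needed for
      it.\<close>
    have "(2 * real m + 1) * u \<le> (t + 2) * (l + w)" using m w l0 by (simp add: w_def mult_right_mono)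
    also have "\<dots> = t * l + t * w + 2 * u" by (simp add: w_def algebra_simps)
    also have "\<dots> \<le> t * l + pi / 12 + 2 * (pi / 6)" using tw u by simp
    also have "\<dots> \<le> (real i + 1) * (pi / 2)" unfolding tl by (simp add: algebra_simps)
    finally show ?thesis .
  qed
  moreover have "pi / 78 \<le> (2 * real m + 1) * w"
  proof -
    have "pi / 78 \<le> pi / 24" by simp
    also have "\<dots> \<le> t * w" by (rule tw)
    also have "\<dots> \<le> (2 * real m + 1) * w" using m w by (intro mult_right_mono) auto
    finally show ?thesis .
  qed
  ultimately show ?thesis unfolding tl w_def by blast
qed

text \<open>After stretching, the doubled angles at the inner ends of the two outer quarters have a
  half-sum between \<open>pi / 78\<close> and \<open>pi - pi / 78\<close> and a half-difference of
  at least \<open>pi / 156\<close>. By the product formula their cosines differ by at least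
  \<open>4 * sep_gap\<close> and the squared sines by half of that, so a threshold in the middle has
  this margin on both sides.\<close>

definition sep_gap :: real where
  "sep_gap = sin (pi / 78) * sin (pi / 156) / 2"

lemma sep_gap_pos: "0 < sep_gap"
  unfolding sep_gap_def by (intro divide_pos_pos mult_pos_pos sin_gt_zero) auto

lemma sep_gap_le: "sep_gap \<le> 1"
proof -
  have "sin (pi / 78) * sin (pi / 156) \<le> 1 * 1" by (intro mult_mono sin_le_one sin_ge_zero) auto
  then show ?thesis unfolding sep_gap_def by linarith
qed

text \<open>For \<open>y\<close> in quadrant \<open>i\<close> the shifted double angle lies in
  \<open>[0, pi]\<close>, where the cosine decreases; the sign tells whether the squared sine rises
  or falls there.\<close>

lemma sin_squared_quadrant:
  "(sin y)\<^sup>2 = (1 - (if even i then 1 else -1) * cos (2 * y - real i * pi)) / 2"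
proof -
  have "cos (2 * y - real i * pi) = (if even i then 1 else -1) * cos (2 * y)"
    by (simp add: cos_diff mult.commute)
  then show ?thesis by (simp add: cos_double_sin)
qed

text \<open>A test able to rule out one of the two outer quarters: the amplified success probability
  is on one side of \<open>\<tau>\<close> on the left quarter and on the other side on the right
  one, with nothing demanded in between. \<open>up\<close> records whether it rises. The first
  conjunct bounds the amplification by the inverse length of the interval.\<close>

definition separates :: "real \<Rightarrow> real \<Rightarrow> nat \<Rightarrow> real \<Rightarrow> bool \<Rightarrow> bool" where
  "separates l u m \<tau> up \<longleftrightarrow> (2 * real m + 1) * (u - l) \<le> pi / 2 \<and>
    (\<forall>\<theta>\<in>{l..l + (u - l) / 4}. if up then (sin ((2 * real m + 1) * \<theta>))\<^sup>2 \<le> \<tau> - sep_gap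
       else \<tau> + sep_gap \<le> (sin ((2 * real m + 1) * \<theta>))\<^sup>2) \<and>
    (\<forall>\<theta>\<in>{u - (u - l) / 4..u}. if up then \<tau> + sep_gap \<le> (sin ((2 * real m + 1) * \<theta>))\<^sup>2
       else (sin ((2 * real m + 1) * \<theta>))\<^sup>2 \<le> \<tau> - sep_gap)"

lemma separates_left:
  "separates l u m \<tau> up \<Longrightarrow> \<theta> \<in> {l..l + (u - l) / 4} \<Longrightarrow>
    (up \<longrightarrow> (sin ((2 * real m + 1) * \<theta>))\<^sup>2 \<le> \<tau> - sep_gap) \<and> (\<not> up \<longrightarrow> \<tau> + sep_gap \<le> (sin ((2 * real m + 1) * \<theta>))\<^sup>2)"
  unfolding separates_def by (cases up) simp_all

lemma separates_right:
  "separates l u m \<tau> up \<Longrightarrow> \<theta> \<in> {u - (u - l) / 4..u} \<Longrightarrow>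
    (up \<longrightarrow> \<tau> + sep_gap \<le> (sin ((2 * real m + 1) * \<theta>))\<^sup>2) \<and> (\<not> up \<longrightarrow> (sin ((2 * real m + 1) * \<theta>))\<^sup>2 \<le> \<tau> - sep_gap)"
  unfolding separates_def by (cases up) simp_all

lemma separates_exists:
  assumes l: "0 \<le> l" and lu: "l < u" and u: "u \<le> pi / 6"
  shows "\<exists>m \<tau> up. separates l u m \<tau> up"
proof -
  obtain m i :: nat where mi: "real i * (pi / 2) \<le> (2 * real m + 1) * l"
    "(2 * real m + 1) * u \<le> (real i + 1) * (pi / 2)" "pi / 78 \<le> (2 * real m + 1) * (u - l)"
    using odd_multiple_in_quadrant[OF assms] by blast
  define K where "K = 2 * real m + 1"
  define z where "z \<theta> = 2 * (K * \<theta>) - real i * pi" for \<theta>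
  define a where "a = l + (u - l) / 4"
  define b where "b = u - (u - l) / 4"
  define s :: real where "s = (if even i then 1 else -1)"
  define \<tau> where "\<tau> = (1 - s * ((cos (z a) + cos (z b)) / 2)) / 2"
  have K: "0 < K" by (simp add: K_def)
  have zl: "0 \<le> z l" and zu: "z u \<le> pi" using mi(1,2) by (auto simp: z_def K_def algebra_simps)
  have mono: "z x \<le> z y" if "x \<le> y" for x y using that K by (simp add: z_def)
  have Kw: "pi / 78 \<le> K * (u - l)" "K * (u - l) \<le> pi / 2"
    using mi(3) zl zu by (auto simp: K_def z_def algebra_simps)
  have sum: "(z a + z b) / 2 = K * (u - l) + z l" and dif: "(z b - z a) / 2 = K * (u - l) / 2"
    by (simp_all add: z_def a_def b_def algebra_simps) (simp_all add: field_simps)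
  have sum': "(z a + z b) / 2 = z u - K * (u - l)"
    by (simp add: z_def a_def b_def field_simps)
  \<comment> \<open>The half-sum keeps the distance \<open>K * (u - l)\<close> both from
    \<open>z l \<ge> 0\<close> and from \<open>z u \<le> pi\<close>; beyond \<open>pi / 2\<close>
    the sine is reflected.\<close>
  have s1: "sin (pi / 78) \<le> sin ((z a + z b) / 2)"
  proof (cases "(z a + z b) / 2 \<le> pi / 2")
    case True
    then show ?thesis unfolding sum using zl Kw by (intro sin_monotone_2pi_le) auto
  next
    case False
    have "sin ((z a + z b) / 2) = sin (pi - (z a + z b) / 2)" by simp
    moreover have "sin (pi / 78) \<le> sin (pi - (z a + z b) / 2)"
      using False zu Kw sum' by (intro sin_monotone_2pi_le) auto
    ultimately show ?thesis by simp
  qed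
  have s2: "sin (pi / 156) \<le> sin ((z b - z a) / 2)"
    unfolding dif using Kw by (intro sin_monotone_2pi_le) auto
  have s0: "0 \<le> sin (pi / 78)" "0 \<le> sin (pi / 156)" by (intro sin_ge_zero; simp)+
  have "sin (pi / 78) * sin (pi / 156) \<le> sin ((z a + z b) / 2) * sin ((z b - z a) / 2)"
    by (rule mult_mono[OF s1 s2 order_trans[OF s0(1) s1] s0(2)])
  then have gap: "4 * sep_gap \<le> cos (z a) - cos (z b)" by (simp add: cos_diff_cos sep_gap_def)
  have lo: "cos (z a) \<le> cos (z \<theta>)" if "\<theta> \<in> {l..a}" for \<theta>
    using that zl zu lu mono[of l \<theta>] mono[of \<theta> a] mono[of a u]
    by (intro cos_monotone_0_pi_le) (auto simp: a_def field_simps)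
  have hi: "cos (z \<theta>) \<le> cos (z b)" if "\<theta> \<in> {b..u}" for \<theta>
    using that zl zu lu mono[of l b] mono[of b \<theta>] mono[of \<theta> u]
    by (intro cos_monotone_0_pi_le) (auto simp: b_def field_simps)
  have sq: "(sin (K * \<theta>))\<^sup>2 = (1 - s * cos (z \<theta>)) / 2" for \<theta>
    unfolding z_def s_def by (rule sin_squared_quadrant)
  have "separates l u m \<tau> (even i)"
    unfolding separates_def K_def[symmetric] a_def[symmetric] b_def[symmetric]
  proof (intro conjI ballI)
    show "K * (u - l) \<le> pi / 2" by (rule Kw)
  next
    fix \<theta> assume "\<theta> \<in> {l..a}"
    note lb = lo[OF this]
    show "if even i then (sin (K * \<theta>))\<^sup>2 \<le> \<tau> - sep_gap else \<tau> + sep_gap \<le> (sin (K * \<theta>))\<^sup>2"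
    proof (cases "even i")
      case True
      then have "s = 1" by (simp add: s_def)
      then show ?thesis using True lb gap unfolding sq \<tau>_def by (simp add: field_simps)
    next
      case False
      then have "s = -1" by (simp add: s_def)
      then show ?thesis using False lb gap unfolding sq \<tau>_def by (simp add: field_simps)
    qed
  next
    fix \<theta> assume "\<theta> \<in> {b..u}"
    note lb = hi[OF this]
    show "if even i then \<tau> + sep_gap \<le> (sin (K * \<theta>))\<^sup>2 else (sin (K * \<theta>))\<^sup>2 \<le> \<tau> - sep_gap"
    proof (cases "even i")
      case True
      then have "s = 1" by (simp add: s_def)
      then show ?thesis using True lb gap unfolding sq \<tau>_def by (simp add: field_simps)
    next
      case False
      then have "s = -1" by (simp add: s_def)
      then show ?thesis using False lb gap unfolding sq \<tau>_def by (simp add: field_simps)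
    qed
  qed
  then show ?thesis by blast
qed

section \<open>An exponential tail bound for repeated trials\<close>

lemma exp_le_quadratic:
  fixes x :: real
  assumes "\<bar>x\<bar> \<le> 1"
  shows "exp x \<le> 1 + x + x\<^sup>2"
proof (cases "0 \<le> x")
  case True
  then show ?thesis using exp_bound[of x] assms by simp
next
  case False
  define y where "y = - x"
  have y: "0 < y" using False by (simp add: y_def)
  have "0 \<le> y ^ 3" using y by simp
  \<comment> \<open>The product is \<open>1 + y ^ 3\<close>; combined with
    \<open>1 + y \<le> exp y\<close> it bounds \<open>exp (- y)\<close> from above.\<close>
  then have "1 \<le> (1 + y) * (1 - y + y\<^sup>2)" by (simp add: algebra_simps power2_eq_square power3_eq_cube)
  also have "\<dots> \<le> exp y * (1 - y + y\<^sup>2)"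
  proof (rule mult_right_mono)
    have "0 \<le> (1 - y / 2)\<^sup>2 + 3 / 4 * y\<^sup>2" by simp
    also have "\<dots> = 1 - y + y\<^sup>2" by (simp add: power2_eq_square algebra_simps)
    finally show "0 \<le> 1 - y + y\<^sup>2" .
  qed simp
  finally show ?thesis by (simp add: y_def exp_minus field_simps)
qed

text \<open>\<open>1 - p + p * exp \<mu>\<close> is the moment generating function of one trial. The
  sign of \<open>\<mu>\<close> selects the tail, so both are covered at once, and
  \<open>\<gamma> / 2\<close> is the minimiser of the exponent
  \<open>\<mu>\<^sup>2 - \<bar>\<mu>\<bar> * \<gamma>\<close>.\<close>

lemma chernoff_factor:
  fixes p \<tau> \<gamma> \<mu> :: real
  assumes p: "0 \<le> p" "p \<le> 1" and l: "\<bar>\<mu>\<bar> = \<gamma> / 2" and g: "0 < \<gamma>" "\<gamma> \<le> 1" and d: "\<mu> * (p - \<tau>) \<le> - (\<bar>\<mu>\<bar> * \<gamma>)"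
  shows "exp (- (\<mu> * (real r * \<tau>))) * (1 - p + p * exp \<mu>) ^ r \<le> exp (- (real r * \<gamma>\<^sup>2 / 4))"
proof -
  have "\<bar>\<mu>\<bar> \<le> 1" using l g by simp
  then have "p * exp \<mu> \<le> p * (1 + \<mu> + \<mu>\<^sup>2)" using p exp_le_quadratic by (intro mult_left_mono) auto
  moreover have "p * \<mu>\<^sup>2 \<le> \<mu>\<^sup>2" using p mult_right_mono[of p 1 "\<mu>\<^sup>2"] by simp
  ultimately have "1 - p + p * exp \<mu> \<le> 1 + (p * \<mu> + \<mu>\<^sup>2)" by (simp add: algebra_simps)
  also have "\<dots> \<le> exp (p * \<mu> + \<mu>\<^sup>2)" by (rule exp_ge_add_one_self)
  finally have "(1 - p + p * exp \<mu>) ^ r \<le> exp (p * \<mu> + \<mu>\<^sup>2) ^ r"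
    using p by (intro power_mono add_nonneg_nonneg) auto
  also have "\<dots> = exp (real r * (p * \<mu> + \<mu>\<^sup>2))" by (simp add: exp_of_nat_mult)
  finally have "exp (- (\<mu> * (real r * \<tau>))) * (1 - p + p * exp \<mu>) ^ r
    \<le> exp (- (\<mu> * (real r * \<tau>))) * exp (real r * (p * \<mu> + \<mu>\<^sup>2))" by (intro mult_left_mono) auto
  also have "\<dots> = exp (real r * (\<mu> * (p - \<tau>) + \<mu>\<^sup>2))" by (simp add: exp_add[symmetric] algebra_simps)
  also have "\<dots> \<le> exp (real r * (- \<gamma>\<^sup>2 / 4))"
  proof -
    have "\<mu>\<^sup>2 = \<bar>\<mu>\<bar>\<^sup>2" by simp
    then have l2: "\<mu>\<^sup>2 = \<gamma>\<^sup>2 / 4" by (simp only: l) (simp add: power_divide)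
    have "\<mu> * (p - \<tau>) \<le> - \<gamma>\<^sup>2 / 2" using d unfolding l by (simp add: power2_eq_square)
    then have "\<mu> * (p - \<tau>) + \<mu>\<^sup>2 \<le> - \<gamma>\<^sup>2 / 4" unfolding l2 by simp
    then show ?thesis using mult_left_mono[of "\<mu> * (p - \<tau>) + \<mu>\<^sup>2" "- \<gamma>\<^sup>2 / 4" "real r"] by simp
  qed
  finally show ?thesis by simp
qed

section \<open>Programs that test a threshold and shrink an interval\<close>

primrec shots ::
  "basis set \<Rightarrow> basis \<Rightarrow> basis gate list \<Rightarrow> (basis \<Rightarrow> bool) \<Rightarrow> nat \<Rightarrow> nat \<Rightarrow> (nat \<Rightarrow> program) \<Rightarrow> program" where
  "shots B a0 cs good 0 cnt k = k cnt"
| "shots B a0 cs good (Suc r) cnt k =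
     run_circuit B a0 cs (\<lambda>a. shots B a0 cs good r (if good a then Suc cnt else cnt) k)"

definition threshold_test ::
  "basis set \<Rightarrow> basis \<Rightarrow> basis gate list \<Rightarrow> (basis \<Rightarrow> bool) \<Rightarrow> nat \<Rightarrow> real \<Rightarrow> (bool \<Rightarrow> program) \<Rightarrow> program" where
  "threshold_test B a0 cs good r \<tau> k = shots B a0 cs good r 0 (\<lambda>cnt. k (real r * \<tau> \<le> real cnt))"

definition grover_gates :: "(basis \<Rightarrow> bool) \<Rightarrow> basis \<Rightarrow> basis gate list \<Rightarrow> basis gate list" where
  "grover_gates good a0 cs = [Apply (diag_op (\<lambda>a. if good a then -1 else 1))] @ circuit_inverse cs @
     [Apply (diag_op (\<lambda>a. if a = a0 then 1 else -1))] @ cs"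

definition amplified :: "(basis \<Rightarrow> bool) \<Rightarrow> basis \<Rightarrow> basis gate list \<Rightarrow> nat \<Rightarrow> basis gate list" where
  "amplified good a0 cs m = cs @ concat (replicate m (grover_gates good a0 cs))"

text \<open>The test is chosen from the interval alone, which the program knows, and not from the
  angle, which it does not.\<close>

definition separation :: "real \<Rightarrow> real \<Rightarrow> nat \<times> real \<times> bool" where
  "separation l u = (SOME (m, \<tau>, up). separates l u m \<tau> up)"

text \<open>Each round removes the quarter that the test rules out. An angle in the middle half
  survives either answer, so no test ever has to decide a borderline case.\<close>

primrec estimate_angle ::
  "basis set \<Rightarrow> basis \<Rightarrow> basis gate list \<Rightarrow> (basis \<Rightarrow> bool) \<Rightarrow> nat \<Rightarrow> nat \<Rightarrow> real \<Rightarrow> real \<Rightarrow> (real \<Rightarrow> program) \<Rightarrow> program" where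
  "estimate_angle B a0 cs good r 0 l u k = k ((l + u) / 2)"
| "estimate_angle B a0 cs good r (Suc J) l u k =
     (case separation l u of (m, \<tau>, up) \<Rightarrow>
        threshold_test B a0 (amplified good a0 cs m) good r \<tau>
          (\<lambda>b. if b = up then estimate_angle B a0 cs good r J (l + (u - l) / 4) u k
               else estimate_angle B a0 cs good r J l (u - (u - l) / 4) k))"

lemma separation:
  assumes "0 \<le> l" "l < u" "u \<le> pi / 6"
  obtains m \<tau> up where "separation l u = (m, \<tau>, up)" "separates l u m \<tau> up"
proof -
  have "case separation l u of (m, \<tau>, up) \<Rightarrow> separates l u m \<tau> up"
    unfolding separation_def using separates_exists[OF assms] by (intro someI_ex[of "\<lambda>(m, \<tau>, up). separates l u m \<tau> up"]) auto
  then show thesis using that by (cases "separation l u") auto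
qed

lemma circuit_cost_amplified: "circuit_cost (amplified good a0 cs m) = (2 * m + 1) * circuit_cost cs"
  by (simp add: amplified_def grover_gates_def algebra_simps)

lemma circuit_ok_amplified:
  assumes "finite B" "circuit_ok B cs"
  shows "circuit_ok B (amplified good a0 cs m)"
  using assms by (auto simp: amplified_def grover_gates_def circuit_ok_concat circuit_ok_inverse intro!: unitary_diag)

lemma well_formed_shots:
  assumes "finite B" "a0 \<in> B" "circuit_ok B cs" "\<And>i. well_formed B (k i)"
  shows "well_formed B (shots B a0 cs good r cnt k)"
  using assms by (induction r arbitrary: cnt) (auto intro!: well_formed_run_circuit)

lemma well_formed_estimate_angle:
  assumes "finite B" "a0 \<in> B" "circuit_ok B cs" "\<And>i. well_formed B (k i)"
  shows "well_formed B (estimate_angle B a0 cs good r J l u k)"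
  using assms
  by (induction J arbitrary: l u)
    (auto simp: threshold_test_def circuit_ok_amplified split: prod.split intro!: well_formed_shots)

context query_model
begin

text \<open>
  A subroutine in continuation-passing style succeeds if, up to failure probability \<open>\<eta>\<close>, it passes
  an element of \<open>G\<close> to its continuation.
\<close>

definition succeeds :: "(('r \<Rightarrow> program) \<Rightarrow> program) \<Rightarrow> 'r set \<Rightarrow> real \<Rightarrow> bool" where
  "succeeds S G \<eta> \<longleftrightarrow> (\<forall>k R \<eta>'. 0 \<le> \<eta>' \<longrightarrow> (\<forall>r\<in>G. 1 - \<eta>' \<le> outp (k r) R) \<longrightarrow> 1 - \<eta> - \<eta>' \<le> outp (S k) R)"

text \<open>The cost of the continuation is bounded for all results, wrong ones included, so that
  costs add up irrespective of success.\<close>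

definition costs :: "(('r \<Rightarrow> program) \<Rightarrow> program) \<Rightarrow> real \<Rightarrow> bool" where
  "costs S N \<longleftrightarrow> (\<forall>k N'. (\<forall>r. expq (k r) \<le> N') \<longrightarrow> expq (S k) \<le> N + N')"

lemma succeedsD:
  "succeeds S G \<eta> \<Longrightarrow> 0 \<le> \<eta>' \<Longrightarrow> (\<And>r. r \<in> G \<Longrightarrow> 1 - \<eta>' \<le> outp (k r) R) \<Longrightarrow> 1 - \<eta> - \<eta>' \<le> outp (S k) R"
  unfolding succeeds_def by blast

lemma costsD: "costs S N \<Longrightarrow> (\<And>r. expq (k r) \<le> N') \<Longrightarrow> expq (S k) \<le> N + N'"
  unfolding costs_def by blast

lemma succeeds_return: "r \<in> G \<Longrightarrow> succeeds (\<lambda>k. k r) G 0"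
  by (auto simp: succeeds_def)

lemma costs_return: "costs (\<lambda>k. k r) 0"
  by (auto simp: costs_def)

lemma succeeds_bind:
  assumes "succeeds S G1 \<eta>1" "\<And>r. r \<in> G1 \<Longrightarrow> succeeds (T r) G2 \<eta>2" "0 \<le> \<eta>2"
  shows "succeeds (\<lambda>k. S (\<lambda>r. T r k)) G2 (\<eta>1 + \<eta>2)"
  unfolding succeeds_def
proof (intro allI impI)
  fix k :: "'b \<Rightarrow> program" and R :: "real set" and \<eta>' :: real
  assume h: "0 \<le> \<eta>'" "\<forall>r\<in>G2. 1 - \<eta>' \<le> outp (k r) R"
  have "1 - (\<eta>2 + \<eta>') \<le> outp (T r k) R" if "r \<in> G1" for r
    using assms(2)[OF that] h unfolding succeeds_def by fastforce
  then have "1 - \<eta>1 - (\<eta>2 + \<eta>') \<le> outp (S (\<lambda>r. T r k)) R"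
    using assms(1,3) h(1) unfolding succeeds_def by (metis add_nonneg_nonneg)
  then show "1 - (\<eta>1 + \<eta>2) - \<eta>' \<le> outp (S (\<lambda>r. T r k)) R" by simp
qed

lemma succeeds_mono:
  assumes "succeeds S G \<eta>" "G \<subseteq> G'" "\<eta> \<le> \<eta>'"
  shows "succeeds S G' \<eta>'"
  unfolding succeeds_def
proof (intro allI impI)
  fix k R \<eta>'' assume h: "0 \<le> (\<eta>''::real)" "\<forall>r\<in>G'. 1 - \<eta>'' \<le> outp (k r) R"
  then have "1 - \<eta> - \<eta>'' \<le> outp (S k) R" using assms(1,2) unfolding succeeds_def by blast
  then show "1 - \<eta>' - \<eta>'' \<le> outp (S k) R" using assms(3) by simp
qed

lemma costs_bind:
  assumes "costs S N1" "\<And>r. costs (T r) N2"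
  shows "costs (\<lambda>k. S (\<lambda>r. T r k)) (N1 + N2)"
  using assms unfolding costs_def by (metis (no_types, lifting) add.assoc)

lemma costs_mono: "costs S N \<Longrightarrow> N \<le> N' \<Longrightarrow> costs S N'"
  unfolding costs_def by (meson add_right_mono order_trans)

definition success_prob :: "basis gate list \<Rightarrow> (basis \<Rightarrow> bool) \<Rightarrow> real" where
  "success_prob cs good = (\<Sum>a | a \<in> B \<and> good a. circuit_prob cs a)"

lemma outp_nonneg: "0 \<le> outp p R"
  by (simp add: outp_def output_prob_nonneg)

lemma success_prob_split:
  assumes "circuit_ok B cs"
  shows "(\<Sum>a\<in>B. circuit_prob cs a * (if good a then x else y)) = success_prob cs good * x + (1 - success_prob cs good) * y"
proof -
  have s: "(\<Sum>a\<in>B. circuit_prob cs a) = (\<Sum>a\<in>B. if good a then circuit_prob cs a else 0) + (\<Sum>a\<in>B. if good a then 0 else circuit_prob cs a)"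
    unfolding sum.distrib[symmetric] by (intro sum.cong) auto
  have p: "success_prob cs good = (\<Sum>a\<in>B. if good a then circuit_prob cs a else 0)"
    unfolding success_prob_def using fin by (simp add: sum.inter_filter[symmetric])
  have q: "1 - success_prob cs good = (\<Sum>a\<in>B. if good a then 0 else circuit_prob cs a)"
    using s circuit_prob_sum[OF assms] p by simp
  show ?thesis unfolding q unfolding p sum_distrib_right sum.distrib[symmetric]
    by (intro sum.cong) auto
qed

lemma success_prob_bounds:
  assumes "circuit_ok B cs"
  shows "0 \<le> success_prob cs good" "success_prob cs good \<le> 1"
proof -
  show "0 \<le> success_prob cs good" by (simp add: success_prob_def sum_nonneg circuit_prob_nonneg)
  have "success_prob cs good \<le> (\<Sum>a\<in>B. circuit_prob cs a)"
    unfolding success_prob_def using fin circuit_prob_nonneg by (intro sum_mono2) auto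
  then show "success_prob cs good \<le> 1" using circuit_prob_sum[OF assms] by simp
qed

text \<open>The exponential of \<open>\<mu>\<close> times the excess of the count over the threshold
  serves as a potential: each trial multiplies its expectation by the moment generating function. At
  the end either the potential is below 1, so that the count is on the right side, or the bound is
  trivial.\<close>

lemma outp_shots:
  fixes good :: "basis \<Rightarrow> bool"
  assumes ok: "circuit_ok B cs" and h: "0 \<le> \<eta>'" "\<And>i. exp (\<mu> * (real i - \<tau>)) < 1 \<Longrightarrow> 1 - \<eta>' \<le> outp (k i) R"
  defines "p \<equiv> success_prob cs good"
  shows "1 - \<eta>' - exp (\<mu> * (real cnt - \<tau>)) * (1 - p + p * exp \<mu>) ^ r \<le> outp (shots B a0 cs good r cnt k) R"
proof (induction r arbitrary: cnt)
  case 0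
  show ?case
  proof (cases "exp (\<mu> * (real cnt - \<tau>)) < 1")
    case True
    have "0 \<le> exp (\<mu> * (real cnt - \<tau>))" by simp
    then show ?thesis using h(2)[OF True] by (simp del: exp_ge_zero)
  next
    case False
    then have "1 - \<eta>' - exp (\<mu> * (real cnt - \<tau>)) \<le> 0" using h(1) by linarith
    then show ?thesis using outp_nonneg[of "k cnt" R] by simp
  qed
next
  case (Suc r)
  let ?q = "1 - p + p * exp \<mu>"
  let ?f = "\<lambda>c. outp (shots B a0 cs good r c k) R"
  have p: "0 \<le> p" "p \<le> 1" unfolding p_def using success_prob_bounds[OF ok] by auto
  have "outp (shots B a0 cs good (Suc r) cnt k) R
    = (\<Sum>a\<in>B. circuit_prob cs a * (if good a then ?f (Suc cnt) else ?f cnt))"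
    unfolding shots.simps outp_run_circuit by (intro sum.cong) auto
  also have "\<dots> = p * ?f (Suc cnt) + (1 - p) * ?f cnt"
    unfolding p_def by (rule success_prob_split[OF ok])
  finally have e: "outp (shots B a0 cs good (Suc r) cnt k) R = p * ?f (Suc cnt) + (1 - p) * ?f cnt" .
  have "p * (1 - \<eta>' - exp (\<mu> * (real (Suc cnt) - \<tau>)) * ?q ^ r) + (1 - p) * (1 - \<eta>' - exp (\<mu> * (real cnt - \<tau>)) * ?q ^ r)
    \<le> p * ?f (Suc cnt) + (1 - p) * ?f cnt"
    using p by (intro add_mono mult_left_mono Suc) auto
  moreover have "exp (\<mu> * (real (Suc cnt) - \<tau>)) = exp \<mu> * exp (\<mu> * (real cnt - \<tau>))"
    unfolding exp_add[symmetric] by (simp add: algebra_simps)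
  ultimately show ?case unfolding e by (simp add: algebra_simps)
qed

text \<open>For the band around the threshold where both answers are acceptable.\<close>

lemma outp_shots_all:
  assumes ok: "circuit_ok B cs" and h: "\<And>i. 1 - \<eta>' \<le> outp (k i) R"
  shows "1 - \<eta>' \<le> outp (shots B a0 cs good r cnt k) R"
proof (induction r arbitrary: cnt)
  case (Suc r)
  have "1 - \<eta>' = (\<Sum>a\<in>B. circuit_prob cs a * (1 - \<eta>'))"
    using circuit_prob_sum[OF ok] by (simp flip: sum_distrib_right)
  also have "\<dots> \<le> (\<Sum>a\<in>B. circuit_prob cs a * outp (shots B a0 cs good r (if good a then Suc cnt else cnt) k) R)"
    using Suc by (intro sum_mono mult_left_mono circuit_prob_nonneg)
  finally show ?case by (simp add: outp_run_circuit)
qed (use h in simp)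

lemma costs_shots:
  assumes ok: "circuit_ok B cs"
  shows "costs (shots B a0 cs good r cnt) (real r * real (circuit_cost cs))"
  unfolding costs_def
proof (intro allI impI)
  fix k :: "nat \<Rightarrow> program" and N' assume h: "\<forall>r. expq (k r) \<le> N'"
  show "expq (shots B a0 cs good r cnt k) \<le> real r * real (circuit_cost cs) + N'"
  proof (induction r arbitrary: cnt)
    case (Suc r)
    have "(\<Sum>a\<in>B. circuit_prob cs a * expq (shots B a0 cs good r (if good a then Suc cnt else cnt) k))
      \<le> (\<Sum>a\<in>B. circuit_prob cs a * (real r * real (circuit_cost cs) + N'))"
      using Suc by (intro sum_mono mult_left_mono circuit_prob_nonneg)
    also have "\<dots> = real r * real (circuit_cost cs) + N'"
      using circuit_prob_sum[OF ok] by (simp flip: sum_distrib_right)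
    finally show ?case by (simp add: expq_run_circuit[OF ok] algebra_simps)
  qed (use h in simp)
qed

lemma costs_threshold_test:
  assumes "circuit_ok B cs"
  shows "costs (threshold_test B a0 cs good r \<tau>) (real r * real (circuit_cost cs))"
  using costs_shots[OF assms, of good r 0] unfolding costs_def threshold_test_def by simp

lemma succeeds_threshold_test:
  assumes ok: "circuit_ok B cs"
  shows "succeeds (threshold_test B a0 cs good r \<tau>)
    {b. (\<tau> + sep_gap \<le> success_prob cs good \<longrightarrow> b) \<and> (success_prob cs good \<le> \<tau> - sep_gap \<longrightarrow> \<not> b)}
    (exp (- (real r * sep_gap\<^sup>2 / 4)))"
  unfolding succeeds_def
proof (intro allI impI)
  fix k :: "bool \<Rightarrow> program" and R \<eta>'
  define p where "p = success_prob cs good"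
  assume h: "0 \<le> \<eta>'" and G: "\<forall>b\<in>{b. (\<tau> + sep_gap \<le> success_prob cs good \<longrightarrow> b) \<and> (success_prob cs good \<le> \<tau> - sep_gap \<longrightarrow> \<not> b)}. 1 - \<eta>' \<le> outp (k b) R"
  have p: "0 \<le> p" "p \<le> 1" unfolding p_def using success_prob_bounds[OF ok] by auto
  \<comment> \<open>For a probability above the threshold a low count is the failure, which a
    negative \<open>\<mu>\<close> penalises; otherwise it is a high count.\<close>
  define \<mu> where "\<mu> = (if \<tau> + sep_gap \<le> p then - sep_gap / 2 else sep_gap / 2)"
  have al: "\<bar>\<mu>\<bar> = sep_gap / 2" using sep_gap_pos by (simp add: \<mu>_def)
  have main: "1 - exp (- (real r * sep_gap\<^sup>2 / 4)) - \<eta>' \<le> outp (threshold_test B a0 cs good r \<tau> k) R"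
    if d: "\<mu> * (p - \<tau>) \<le> - (\<bar>\<mu>\<bar> * sep_gap)" 
      and g: "\<And>i. exp (\<mu> * (real i - real r * \<tau>)) < 1 \<Longrightarrow> 1 - \<eta>' \<le> outp (k (real r * \<tau> \<le> real i)) R"
  proof -
    have "1 - \<eta>' - exp (\<mu> * (real 0 - real r * \<tau>)) * (1 - p + p * exp \<mu>) ^ r
      \<le> outp (threshold_test B a0 cs good r \<tau> k) R"
      unfolding threshold_test_def p_def by (rule outp_shots[OF ok h g])
    moreover have "exp (\<mu> * (real 0 - real r * \<tau>)) * (1 - p + p * exp \<mu>) ^ r \<le> exp (- (real r * sep_gap\<^sup>2 / 4))"
      using chernoff_factor[OF p al sep_gap_pos sep_gap_le d, of r] by simp
    ultimately show ?thesis by simp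
  qed
  consider "\<tau> + sep_gap \<le> p" | "p \<le> \<tau> - sep_gap" | "\<not> \<tau> + sep_gap \<le> p" "\<not> p \<le> \<tau> - sep_gap" by blast
  then show "1 - exp (- (real r * sep_gap\<^sup>2 / 4)) - \<eta>' \<le> outp (threshold_test B a0 cs good r \<tau> k) R"
  proof cases
    case 1
    then have l: "\<mu> = - (sep_gap / 2)" by (simp add: \<mu>_def)
    show ?thesis
    proof (rule main)
      show "\<mu> * (p - \<tau>) \<le> - (\<bar>\<mu>\<bar> * sep_gap)" unfolding al unfolding l
        using 1 sep_gap_pos mult_left_mono[of sep_gap "p - \<tau>" "sep_gap / 2"] by simp
      fix i assume "exp (\<mu> * (real i - real r * \<tau>)) < 1"
      then have "real r * \<tau> \<le> real i" unfolding l using sep_gap_pos by (auto simp: zero_less_mult_iff)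
      then show "1 - \<eta>' \<le> outp (k (real r * \<tau> \<le> real i)) R" using G 1 sep_gap_pos by (auto simp: p_def)
    qed
  next
    case 2
    then have l: "\<mu> = sep_gap / 2" using sep_gap_pos by (simp add: \<mu>_def)
    show ?thesis
    proof (rule main)
      show "\<mu> * (p - \<tau>) \<le> - (\<bar>\<mu>\<bar> * sep_gap)" unfolding al unfolding l
        using 2 sep_gap_pos mult_left_mono[of sep_gap "\<tau> - p" "sep_gap / 2"] by (simp add: algebra_simps)
      fix i assume "exp (\<mu> * (real i - real r * \<tau>)) < 1"
      then have "\<not> real r * \<tau> \<le> real i" unfolding l using sep_gap_pos by (auto simp: mult_less_0_iff)
      then show "1 - \<eta>' \<le> outp (k (real r * \<tau> \<le> real i)) R" using G 2 sep_gap_pos by (auto simp: p_def)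
    qed
  next
    case 3
    then have "1 - \<eta>' \<le> outp (k b) R" for b using G by (auto simp: p_def)
    then have "1 - \<eta>' \<le> outp (threshold_test B a0 cs good r \<tau> k) R"
      unfolding threshold_test_def by (intro outp_shots_all[OF ok])
    then show ?thesis by (smt (verit) exp_ge_zero)
  qed
qed

lemma run_amplified:
  assumes ok: "circuit_ok B cs" and a: "a \<in> B"
  shows "run_ops B (ops (amplified good a0 cs m)) \<psi> a
    = run_ops B (ops cs @ concat (replicate m (grover_ops good a0 (ops cs)))) \<psi> a"
proof -
  have step: "run_ops B (ops (grover_gates good a0 cs)) \<phi> a = run_ops B (grover_ops good a0 (ops cs)) \<phi> a"
    if "a \<in> B" for \<phi> a
  proof -
    have "mapply B (diag_op (\<lambda>a. if a = a0 then 1 else - 1)) (run_ops B (ops (circuit_inverse cs)) \<xi>)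
      = mapply B (diag_op (\<lambda>a. if a = a0 then 1 else - 1)) (run_ops B (inv_ops (ops cs)) \<xi>)" for \<xi>
      by (rule mapply_cong) (rule run_ops_inverse)
    then show ?thesis by (simp add: grover_gates_def grover_ops_def)
  qed
  have "run_ops B (ops (concat (replicate m (grover_gates good a0 cs)))) \<phi> a
     = run_ops B (concat (replicate m (grover_ops good a0 (ops cs)))) \<phi> a" if "a \<in> B" for \<phi> a
    using that
  proof (induction m arbitrary: \<phi> a)
    case (Suc m)
    have "run_ops B (ops (concat (replicate (Suc m) (grover_gates good a0 cs)))) \<phi> a
      = run_ops B (concat (replicate m (grover_ops good a0 (ops cs)))) (run_ops B (ops (grover_gates good a0 cs)) \<phi>) a"
      using Suc by simp
    also have "\<dots> = run_ops B (concat (replicate m (grover_ops good a0 (ops cs)))) (run_ops B (grover_ops good a0 (ops cs)) \<phi>) a"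
      by (rule run_ops_cong) (use step Suc.prems in auto)
    finally show ?case by simp
  qed simp
  then show ?thesis using a by (simp add: amplified_def)
qed

lemma success_prob_amplified:
  assumes ok: "circuit_ok B cs" and p: "success_prob cs good = (sin \<theta>)\<^sup>2"
  shows "success_prob (amplified good a0 cs m) good = (sin ((2 * real m + 1) * \<theta>))\<^sup>2"
proof -
  have "success_prob (amplified good a0 cs m) good
    = (\<Sum>a | a \<in> B \<and> good a. (cmod (run_ops B (ops cs @ concat (replicate m (grover_ops good a0 (ops cs)))) (unit_at a0) a))\<^sup>2)"
    unfolding success_prob_def circuit_prob_def by (intro sum.cong refl) (simp add: run_amplified[OF ok])
  also have "\<dots> = (sin ((2 * real m + 1) * \<theta>))\<^sup>2"
    by (rule amplitude_amplification[OF ops_unitary[OF ok] fin a0])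
      (use p in \<open>simp add: success_prob_def circuit_prob_def\<close>)
  finally show ?thesis .
qed

text \<open>A correct test never answers against an outer quarter that contains
  \<open>\<theta>\<close>, so \<open>\<theta>\<close> stays in an interval whose length shrinks by
  the factor 3/4. The failure probabilities of the rounds add up.\<close>

lemma succeeds_estimate_angle:
  assumes ok: "circuit_ok B cs" and p: "success_prob cs good = (sin \<theta>)\<^sup>2"
    and lu: "0 \<le> l" "l < u" "u \<le> pi / 6" "\<theta> \<in> {l..u}"
  shows "succeeds (estimate_angle B a0 cs good r J l u) {x. \<bar>x - \<theta>\<bar> \<le> (3 / 4) ^ J * (u - l)}
    (real J * exp (- (real r * sep_gap\<^sup>2 / 4)))"
  using lu
proof (induction J arbitrary: l u)
  case 0
  have "\<bar>(l + u) / 2 - \<theta>\<bar> \<le> u - l" using 0 by (auto simp: field_simps abs_le_iff)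
  then show ?case unfolding succeeds_def by auto
next
  case (Suc J)
  let ?\<delta> = "exp (- (real r * sep_gap\<^sup>2 / 4))"
  have e: "(3 / 4) ^ Suc J * (u - l) = (3 / 4) ^ J * (3 / 4 * (u - l))" by simp
  have quarter: "l + (u - l) / 4 < u" "l < u - (u - l) / 4" "0 \<le> l + (u - l) / 4" "u - (u - l) / 4 \<le> pi / 6"
    using Suc.prems by (simp_all add: field_simps)
  obtain m \<tau> up where sep: "separation l u = (m, \<tau>, up)" "separates l u m \<tau> up"
    using separation Suc.prems by blast
  let ?C = "amplified good a0 cs m"
  have okC: "circuit_ok B ?C" by (rule circuit_ok_amplified[OF fin ok])
  have pr: "success_prob ?C good = (sin ((2 * real m + 1) * \<theta>))\<^sup>2" by (rule success_prob_amplified[OF ok p])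
  let ?G = "{b. (\<tau> + sep_gap \<le> success_prob ?C good \<longrightarrow> b) \<and> (success_prob ?C good \<le> \<tau> - sep_gap \<longrightarrow> \<not> b)}"
  let ?T = "\<lambda>b k. if b = up then estimate_angle B a0 cs good r J (l + (u - l) / 4) u k
               else estimate_angle B a0 cs good r J l (u - (u - l) / 4) k"
  have "succeeds (\<lambda>k. threshold_test B a0 ?C good r \<tau> (\<lambda>b. ?T b k)) {x. \<bar>x - \<theta>\<bar> \<le> (3 / 4) ^ Suc J * (u - l)}
    (?\<delta> + real J * ?\<delta>)"
  proof (rule succeeds_bind[OF succeeds_threshold_test[OF okC]])
    fix b assume b: "b \<in> ?G"
    show "succeeds (?T b) {x. \<bar>x - \<theta>\<bar> \<le> (3 / 4) ^ Suc J * (u - l)} (real J * ?\<delta>)"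
    proof (cases "b = up")
      case True
      have "\<not> \<theta> < l + (u - l) / 4"
      proof
        assume "\<theta> < l + (u - l) / 4"
        then have "\<theta> \<in> {l..l + (u - l) / 4}" using Suc.prems by simp
        from separates_left[OF sep(2) this] show False using b True unfolding pr[symmetric] by (cases up) simp_all
      qed
      then have "succeeds (estimate_angle B a0 cs good r J (l + (u - l) / 4) u)
        {x. \<bar>x - \<theta>\<bar> \<le> (3 / 4) ^ J * (u - (l + (u - l) / 4))} (real J * ?\<delta>)"
        using Suc.prems quarter by (intro Suc.IH) auto
      moreover have "u - (l + (u - l) / 4) = 3 / 4 * (u - l)" by (simp add: field_simps)
      ultimately show ?thesis using True by (simp only: if_True e refl)
    next
      case False
      have "\<not> u - (u - l) / 4 < \<theta>"
      proof
        assume "u - (u - l) / 4 < \<theta>"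
        then have "\<theta> \<in> {u - (u - l) / 4..u}" using Suc.prems by simp
        from separates_right[OF sep(2) this] show False using b False unfolding pr[symmetric] by (cases up) simp_all
      qed
      then have "succeeds (estimate_angle B a0 cs good r J l (u - (u - l) / 4))
        {x. \<bar>x - \<theta>\<bar> \<le> (3 / 4) ^ J * (u - (u - l) / 4 - l)} (real J * ?\<delta>)"
        using Suc.prems quarter by (intro Suc.IH) auto
      moreover have "u - (u - l) / 4 - l = 3 / 4 * (u - l)" by (simp add: field_simps)
      ultimately show ?thesis using False by (simp only: if_False e refl)
    qed
  qed simp
  then show ?case by (simp add: sep(1) algebra_simps)
qed

text \<open>The amplification is inversely proportional to the length of the current interval. All
  rounds are charged with a bound valid for the shortest interval, which costs one logarithmic
  factor.\<close>

lemma costs_estimate_angle: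
  assumes ok: "circuit_ok B cs" and lu: "0 \<le> l" "l < u" "u \<le> pi / 6"
  shows "costs (estimate_angle B a0 cs good r J l u)
    (real J * (real r * real (circuit_cost cs) * (pi / 2 / (u - l) * (4 / 3) ^ J)))"
  using lu
proof (induction J arbitrary: l u)
  case 0
  then show ?case by (simp add: costs_def)
next
  case (Suc J)
  obtain m \<tau> up where sep: "separation l u = (m, \<tau>, up)" "separates l u m \<tau> up"
    using separation Suc.prems by blast
  define M where "M = real r * real (circuit_cost cs) * (pi / 2 / (u - l) * (4 / 3) ^ Suc J)"
  let ?C = "amplified good a0 cs m"
  have okC: "circuit_ok B ?C" by (rule circuit_ok_amplified[OF fin ok])
  have w: "0 < u - l" using Suc.prems by simp
  have quarter: "l + (u - l) / 4 < u" "l < u - (u - l) / 4" "0 \<le> l + (u - l) / 4" "u - (u - l) / 4 \<le> pi / 6"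
    using Suc.prems by (simp_all add: field_simps)
  have len: "u - (l + (u - l) / 4) = 3 / 4 * (u - l)" "u - (u - l) / 4 - l = 3 / 4 * (u - l)"
    by (simp_all add: field_simps)
  have "2 * real m + 1 \<le> pi / 2 / (u - l)" using sep(2) w by (simp add: separates_def field_simps)
  also have "\<dots> = pi / 2 / (u - l) * 1" by simp
  also have "\<dots> \<le> pi / 2 / (u - l) * (4 / 3) ^ Suc J"
    using w by (intro mult_left_mono one_le_power) auto
  finally have "real r * real (circuit_cost cs) * (2 * real m + 1) \<le> M"
    unfolding M_def by (intro mult_left_mono) auto
  then have c1: "costs (threshold_test B a0 ?C good r \<tau>) M"
    using costs_mono[OF costs_threshold_test[OF okC, of good r \<tau>], of M]
    by (simp add: circuit_cost_amplified algebra_simps)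
  let ?T = "\<lambda>b k. if b = up then estimate_angle B a0 cs good r J (l + (u - l) / 4) u k
               else estimate_angle B a0 cs good r J l (u - (u - l) / 4) k"
  \<comment> \<open>Shortening the interval by the factor 3/4 and having one round less cancel, so
    the charge per round is the same \<open>M\<close> in the induction hypothesis.\<close>
  have M: "real r * real (circuit_cost cs) * (pi / 2 / (3 / 4 * (u - l)) * (4 / 3) ^ J) = M"
    unfolding M_def using w by (simp add: field_simps)
  have "costs (?T b) (real J * M)" for b
  proof -
    have "costs (estimate_angle B a0 cs good r J (l + (u - l) / 4) u) (real J * M)"
      using Suc.IH[OF quarter(3,1) Suc.prems(3)] unfolding len M .
    moreover have "costs (estimate_angle B a0 cs good r J l (u - (u - l) / 4)) (real J * M)"
      using Suc.IH[OF Suc.prems(1) quarter(2,4)] unfolding len M .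
    ultimately show ?thesis by (cases "b = up") simp_all
  qed
  then have "costs (\<lambda>k. threshold_test B a0 ?C good r \<tau> (\<lambda>b. ?T b k)) (M + real J * M)"
    by (rule costs_bind[OF c1])
  moreover have "estimate_angle B a0 cs good r (Suc J) l u = (\<lambda>k. threshold_test B a0 ?C good r \<tau> (\<lambda>b. ?T b k))"
    by (rule ext) (simp add: sep(1))
  moreover have "M + real J * M = real (Suc J) * M" by (simp add: algebra_simps)
  ultimately show ?case unfolding M_def[symmetric] by (simp only:)
qed

end

section \<open>Registers\<close>

text \<open>
  A core state \<open>(x, y, f)\<close> consists of the latent value, the likelihood register and a flag. The
  spectators \<open>(d, c, v, e, t, g)\<close> are the outcome, the control, a table \<open>v\<close> of likelihoods, a second
  outcome register, a counter and another flag. All but \<open>x, y, d, c\<close> are kept in the work register.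
\<close>

type_synonym core = "real \<times> nat \<times> nat"
type_synonym spectators = "real \<times> control \<times> (real \<Rightarrow> nat) \<times> real \<times> nat \<times> nat"

lemma xor_less_two_power:
  fixes a b :: nat
  assumes "a < 2 ^ k" "b < 2 ^ k"
  shows "xor a b < 2 ^ k"
proof -
  have "take_bit k (xor a b) = xor a b" using assms by (simp add: take_bit_nat_eq_self)
  then show ?thesis by (metis take_bit_nat_less_exp)
qed

definition flag_vec :: "real \<Rightarrow> nat \<Rightarrow> real" where
  "flag_vec r f = (if f = 1 then sqrt r else sqrt (1 - r))"

lemma flag_vec_unit: "0 \<le> r \<Longrightarrow> r \<le> 1 \<Longrightarrow> (\<Sum>f\<in>{..<2}. (flag_vec r f)\<^sup>2) = 1"
  by (simp add: flag_vec_def numeral_2_eq_2)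

definition blockwise :: "('s \<Rightarrow> 'z \<Rightarrow> 'z \<Rightarrow> complex) \<Rightarrow> 'z \<times> 's \<Rightarrow> 'z \<times> 's \<Rightarrow> complex" where
  "blockwise C a a' = (if snd a = snd a' then C (snd a) (fst a) (fst a') else 0)"

lemma adjoint_blockwise: "adjoint_op (blockwise C) = blockwise (\<lambda>s. adjoint_op (C s))"
  by (auto simp: blockwise_def adjoint_op_def fun_eq_iff)

lemma mapply_blockwise:
  assumes "finite Z" "finite S" "z \<in> Z" "s \<in> S"
  shows "mapply (Z \<times> S) (blockwise C) \<psi> (z, s) = mapply Z (C s) (\<lambda>z. \<psi> (z, s)) z"
proof -
  have "mapply (Z \<times> S) (blockwise C) \<psi> (z, s) = (\<Sum>z'\<in>Z. C s z z' * \<psi> (z', s))"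
    by (rule mapply_block[where jn=Pair and H=C])
      (use assms in \<open>auto simp: block_diag_def blockwise_def bij_betw_def inj_on_def\<close>)
  then show ?thesis by (simp add: mapply_def)
qed

lemma run_blockwise:
  assumes "finite Z" "finite S" "z \<in> Z" "s \<in> S"
  shows "run_ops (Z \<times> S) (map blockwise Cs) \<psi> (z, s) = run_ops Z (map (\<lambda>C. C s) Cs) (\<lambda>z. \<psi> (z, s)) z"
  using assms(3)
proof (induction Cs arbitrary: \<psi> z)
  case (Cons C Cs)
  have "run_ops (Z \<times> S) (map blockwise (C # Cs)) \<psi> (z, s)
    = run_ops Z (map (\<lambda>C. C s) Cs) (\<lambda>z. mapply (Z \<times> S) (blockwise C) \<psi> (z, s)) z"
    using Cons by simp
  also have "\<dots> = run_ops Z (map (\<lambda>C. C s) Cs) (mapply Z (C s) (\<lambda>z. \<psi> (z, s))) z"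
    by (rule run_ops_cong) (use mapply_blockwise[OF assms(1,2) _ assms(4)] Cons.prems in auto)
  finally show ?case by simp
qed simp

lemma unitary_blockwise:
  assumes "finite S" "\<And>s. s \<in> S \<Longrightarrow> unitary_on Z (C s)"
  shows "unitary_on (Z \<times> S) (blockwise C)"
  by (rule unitary_block[where jn=Pair and I=Z and Rs=S and H=C])
    (use assms in \<open>auto simp: block_diag_def blockwise_def bij_betw_def inj_on_def\<close>)

definition prior_core :: "(real \<Rightarrow> real \<Rightarrow> complex) \<Rightarrow> core \<Rightarrow> core \<Rightarrow> complex" where
  "prior_core V z z' = (if snd z = snd z' then V (fst z) (fst z') else 0)"

definition lik_perm :: "(real \<Rightarrow> real \<Rightarrow> control \<Rightarrow> nat) \<Rightarrow> spectators \<Rightarrow> core \<Rightarrow> core" where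
  "lik_perm l s z = (fst z, xor (fst (snd z)) (l (fst s) (fst z) (fst (snd s))), snd (snd z))"

definition flag_core :: "(real \<Rightarrow> nat \<Rightarrow> real) \<Rightarrow> core \<Rightarrow> core \<Rightarrow> complex" where
  "flag_core q z z' = (if fst z = fst z' \<and> fst (snd z) = fst (snd z')
     then prep_op {..<2} 0 (flag_vec (q (fst z) (fst (snd z)))) (snd (snd z)) (snd (snd z')) else 0)"

text \<open>The last branch is never used; it only makes the result a unit vector for every \<open>amp\<close>.\<close>

definition complete_vec :: "real set \<Rightarrow> real \<Rightarrow> (real \<Rightarrow> real) \<Rightarrow> real \<times> nat \<Rightarrow> real" where
  "complete_vec Y d0 amp i = (if (\<Sum>e\<in>Y. (amp e)\<^sup>2) \<le> 1
     then (if snd i = 1 then amp (fst i) else if i = (d0, 0) then sqrt (1 - (\<Sum>e\<in>Y. (amp e)\<^sup>2)) else 0)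
     else if i = (d0, 0) then 1 else 0)"

lemma complete_vec_unit:
  assumes "finite Y" "d0 \<in> Y"
  shows "(\<Sum>i\<in>Y \<times> {..<2}. (complete_vec Y d0 amp i)\<^sup>2) = 1"
proof -
  have s: "(\<Sum>i\<in>Y \<times> {..<2}. (complete_vec Y d0 amp i)\<^sup>2)
    = (\<Sum>e\<in>Y. (complete_vec Y d0 amp (e, 0))\<^sup>2) + (\<Sum>e\<in>Y. (complete_vec Y d0 amp (e, 1))\<^sup>2)"
  proof -
    have "(\<Sum>i\<in>Y \<times> {..<2}. (complete_vec Y d0 amp i)\<^sup>2) = (\<Sum>e\<in>Y. \<Sum>g\<in>{..<2}. (complete_vec Y d0 amp (e, g))\<^sup>2)"
      by (simp add: sum.cartesian_product)
    then show ?thesis by (simp add: numeral_2_eq_2 sum.distrib)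
  qed
  show ?thesis
  proof (cases "(\<Sum>e\<in>Y. (amp e)\<^sup>2) \<le> 1")
    case True
    have "(\<Sum>e\<in>Y. (complete_vec Y d0 amp (e, 0))\<^sup>2) = (\<Sum>e\<in>Y. if e = d0 then 1 - (\<Sum>e\<in>Y. (amp e)\<^sup>2) else 0)"
      using True by (intro sum.cong) (auto simp: complete_vec_def)
    then show ?thesis unfolding s using assms True by (simp add: complete_vec_def)
  next
    case False
    have "(\<Sum>e\<in>Y. (complete_vec Y d0 amp (e, 0))\<^sup>2) = (\<Sum>e\<in>Y. if e = d0 then 1 else 0)"
      using False by (intro sum.cong) (auto simp: complete_vec_def)
    then show ?thesis unfolding s using assms False by (simp add: complete_vec_def)
  qed
qed

text \<open>Conjugates a likelihood query: with \<open>d0\<close> in the outcome register the query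
  sees the outcome \<open>i\<close> and writes into entry \<open>i\<close> of the table. Transposing
  outcomes instead of overwriting \<open>d\<close> keeps the map an involution.\<close>

fun table_swap :: "real \<Rightarrow> real \<Rightarrow> core \<times> spectators \<Rightarrow> core \<times> spectators" where
  "table_swap d0 i ((x, y, f), (d, c, v, e, t, g)) = ((x, v i, f), (exchange d0 i d, c, v(i := y), e, t, g))"

fun outcome_swap :: "core \<times> spectators \<Rightarrow> core \<times> spectators" where
  "outcome_swap (z, (d, c, v, e, t, g)) = (z, (e, c, v, d, t, g))"

fun outcome_prep :: "real set \<Rightarrow> real \<Rightarrow> (real \<Rightarrow> (real \<Rightarrow> nat) \<Rightarrow> real \<Rightarrow> real) \<Rightarrow>
    core \<times> spectators \<Rightarrow> core \<times> spectators \<Rightarrow> complex" where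
  "outcome_prep Y d0 amp ((x, y, f), (d, c, v, e, t, g)) ((x', y', f'), (d', c', v', e', t', g')) =
     (if (x, y, f, d, c, v, t) = (x', y', f', d', c', v', t')
      then prep_op (Y \<times> {..<2}) (d0, 0) (complete_vec Y d0 (amp x v)) (e, g) (e', g') else 0)"

fun counter_prep :: "nat \<Rightarrow> core \<times> spectators \<Rightarrow> core \<times> spectators \<Rightarrow> complex" where
  "counter_prep n (z, (d, c, v, e, t, g)) (z', (d', c', v', e', t', g')) =
     (if (z, d, c, v, e, g) = (z', d', c', v', e', g')
      then prep_op {..<n} 0 (\<lambda>_. 1 / sqrt (real n)) t t' else 0)"

text \<open>In this locale \<open>n\<close> is the number of averaged Grover powers, that is the
  range of the counter, and not the dimension of the controls.\<close>

locale registers =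
  fixes X Y :: "real set" and K :: "control set" and b n :: nat and x0 d0 :: real
  assumes finX: "finite X" and finY: "finite Y" and finK: "finite K"
    and x0: "x0 \<in> X" and d0: "d0 \<in> Y" and n: "0 < n"
begin

definition Z :: "core set" where "Z = X \<times> {..<2 ^ (b + 1)} \<times> {..<2}"
definition tables :: "(real \<Rightarrow> nat) set" where "tables = PiE Y (\<lambda>_. {..<2 ^ (b + 1)})"
definition S :: "spectators set" where "S = Y \<times> K \<times> tables \<times> Y \<times> {..<n} \<times> {..<2}"
definition zero_table :: "real \<Rightarrow> nat" where "zero_table = (\<lambda>i\<in>Y. 0)"
definition work where "work = tables \<times> Y \<times> {..<n} \<times> {..<2::nat} \<times> {..<2::nat}"
definition W :: nat where "W = card work"
definition enc :: "(real \<Rightarrow> nat) \<times> real \<times> nat \<times> nat \<times> nat \<Rightarrow> nat" where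
  "enc = (SOME f. bij_betw f work {..<W})"

text \<open>The numbering \<open>enc\<close> of the contents of the auxiliary registers is
  arbitrary; it packs them, together with the flag of the core, into the single work number of a
  basis state.\<close>

definition J :: "core \<times> spectators \<Rightarrow> basis" where
  "J a = (case a of ((x, y, f), (d, c, v, e, t, g)) \<Rightarrow> (x, d, c, y, enc (v, e, t, g, f)))"

lemma finites [simp]: "finite Z" "finite tables" "finite S" "finite (Z \<times> S)"
proof -
  show "finite tables" using finY by (simp add: tables_def finite_PiE)
  then show "finite Z" "finite S" "finite (Z \<times> S)"
    using finX finY finK by (simp_all add: Z_def S_def)
qed

lemma finite_work: "finite work"
  using finY by (simp add: work_def)

lemma enc: "bij_betw enc work {..<W}"
proof -
  obtain h where "bij_betw h work {0..<card work}" using ex_bij_betw_finite_nat[OF finite_work] by blast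
  then have "bij_betw h work {..<W}" by (simp add: W_def atLeast0LessThan)
  then show ?thesis unfolding enc_def by (rule someI[of "\<lambda>f. bij_betw f work {..<W}"])
qed

lemma zero_table: "zero_table \<in> tables"
  by (auto simp: zero_table_def tables_def)

lemma J_bij: "bij_betw J (Z \<times> S) (basis_states X Y K b W)"
proof -
  have inj: "inj_on enc work" and im: "enc ` work = {..<W}" using enc by (auto simp: bij_betw_def)
  have "inj_on J (Z \<times> S)"
  proof (rule inj_onI)
    fix a a' assume m: "a \<in> Z \<times> S" "a' \<in> Z \<times> S" and eq: "J a = J a'"
    obtain x y f d c v e t g where a: "a = ((x, y, f), (d, c, v, e, t, g))" by (metis prod.exhaust)
    obtain x' y' f' d' c' v' e' t' g' where a': "a' = ((x', y', f'), (d', c', v', e', t', g'))" by (metis prod.exhaust)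
    have "(v, e, t, g, f) = (v', e', t', g', f')"
      by (rule inj_onD[OF inj]) (use m eq in \<open>auto simp: a a' J_def Z_def S_def work_def\<close>)
    then show "a = a'" using eq by (simp add: a a' J_def)
  qed
  moreover have "J ` (Z \<times> S) = basis_states X Y K b W"
  proof
    show "J ` (Z \<times> S) \<subseteq> basis_states X Y K b W"
      using im by (auto simp: J_def Z_def S_def work_def basis_states_def)
    show "basis_states X Y K b W \<subseteq> J ` (Z \<times> S)"
    proof
      fix r assume "r \<in> basis_states X Y K b W"
      then obtain x d c y w where r: "r = (x, d, c, y, w)" "x \<in> X" "d \<in> Y" "c \<in> K" "y < 2 ^ (b + 1)" "w < W"
        by (auto simp: basis_states_def)
      then obtain k where k: "k \<in> work" "w = enc k" using im by blast
      obtain v e t g f where kk: "k = (v, e, t, g, f)" by (metis prod.exhaust)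
      show "r \<in> J ` (Z \<times> S)"
        by (rule image_eqI[of _ _ "((x, y, f), (d, c, v, e, t, g))"])
          (use r k in \<open>auto simp: kk J_def Z_def S_def work_def\<close>)
    qed
  qed
  ultimately show ?thesis by (simp add: bij_betw_def)
qed

abbreviation Bs :: "basis set" where "Bs \<equiv> basis_states X Y K b W"

primrec embed :: "(core \<times> spectators) gate \<Rightarrow> basis gate" where
  "embed (Apply M) = Apply (relabel (Z \<times> S) J M)"
| "embed Prior = Prior"
| "embed Prior_Inverse = Prior_Inverse"
| "embed Likelihood = Likelihood"

definition circuit :: "(core \<times> spectators) gate list \<Rightarrow> basis gate list" where
  "circuit cs = map embed cs"

definition on_registers :: "(core \<times> spectators \<Rightarrow> bool) \<Rightarrow> basis \<Rightarrow> bool" where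
  "on_registers p a = p (inv_into (Z \<times> S) J a)"

lemma gate_cost_embed [simp]: "gate_cost (embed g) = gate_cost g"
  by (cases g) auto

lemma circuit_cost_circuit [simp]: "circuit_cost (circuit cs) = circuit_cost cs"
  by (simp add: circuit_cost_def circuit_def o_def)

lemma circuit_ok_circuit: "circuit_ok (Z \<times> S) cs \<Longrightarrow> circuit_ok Bs (circuit cs)"
proof (induction cs)
  case (Cons g cs)
  then show ?case by (cases g) (auto simp: circuit_def unitary_relabel[OF J_bij])
qed (simp add: circuit_def)

definition flagged :: "(real \<Rightarrow> nat \<Rightarrow> real) \<Rightarrow> (core \<times> spectators) gate list" where
  "flagged q = [Prior, Likelihood, Apply (blockwise (\<lambda>s. flag_core q))]"

text \<open>All circuits of a program start from one state, with a control \<open>cr\<close> fixed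
  beforehand. Each circuit begins by exchanging it with the state that holds its own outcome,
  control and flag.\<close>

definition root :: "control \<Rightarrow> core \<times> spectators" where
  "root c = ((x0, 0, 0), (d0, c, zero_table, d0, 0, 0))"

definition evidence_circuit :: "control \<Rightarrow> real \<Rightarrow> control \<Rightarrow> (real \<Rightarrow> nat \<Rightarrow> real) \<Rightarrow> (core \<times> spectators) gate list" where
  "evidence_circuit cr d c q =
     Apply (perm_op (exchange (root cr) ((x0, 0, 0), (d, c, zero_table, d0, 0, 0)))) # flagged q"

definition load_table :: "real list \<Rightarrow> (core \<times> spectators) gate list" where
  "load_table ys = concat (map (\<lambda>i. [Apply (perm_op (table_swap d0 i)), Likelihood, Apply (perm_op (table_swap d0 i))]) ys)"

text \<open>Only the two reflections are conditioned on \<open>i \<le> t\<close>; without them the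
  preparation and its inverse cancel. So no query has to be controlled, and the steps
  \<open>1, \<dots>, n - 1\<close> in a row apply the \<open>t\<close>-th power when the counter is
  \<open>t\<close>.\<close>

definition counted_grover :: "(real \<Rightarrow> nat \<Rightarrow> real) \<Rightarrow> nat \<Rightarrow> (core \<times> spectators) gate list" where
  "counted_grover q i =
     [Apply (blockwise (\<lambda>(d, c, v, e, t, g). diag_op (\<lambda>(x, y, f). if i \<le> t \<and> f = 1 then -1 else 1)))] @
     circuit_inverse (flagged q) @
     [Apply (blockwise (\<lambda>(d, c, v, e, t, g). diag_op (\<lambda>z. if i \<le> t \<and> z \<noteq> (x0, 0, 0) then -1 else 1)))] @
     flagged q"

text \<open>The flag starts at 1, in the good subspace of the Grover step. The table of likelihoods
  is loaded to prepare the second outcome register and then unloaded so that it does not stay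
  entangled with \<open>x\<close>. The swap and one more query bring the registers into the form of
  the posterior state of the chosen outcome, on which the Grover steps act. Undoing the counter
  afterwards produces the average.\<close>

definition variance_circuit :: "control \<Rightarrow> control \<Rightarrow> real list \<Rightarrow> (real \<Rightarrow> (real \<Rightarrow> nat) \<Rightarrow> real \<Rightarrow> real) \<Rightarrow>
    (real \<Rightarrow> nat \<Rightarrow> real) \<Rightarrow> (core \<times> spectators) gate list" where
  "variance_circuit cr c ys amp q =
     [Apply (perm_op (exchange (root cr) ((x0, 0, 1), (d0, c, zero_table, d0, 0, 0)))), Prior] @
     load_table ys @ [Apply (outcome_prep Y d0 amp)] @ load_table ys @
     [Apply (perm_op outcome_swap), Likelihood, Apply (counter_prep n)] @
     concat (map (counted_grover q) [1..<n]) @ [Apply (adjoint_op (counter_prep n))]"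

lemma finite_Bs: "finite Bs"
  using J_bij bij_betw_finite finites(4) by blast

lemma root_in: "c \<in> K \<Longrightarrow> root c \<in> Z \<times> S"
  using x0 d0 zero_table n by (auto simp: root_def Z_def S_def)

lemma init_in: "c \<in> K \<Longrightarrow> d \<in> Y \<Longrightarrow> f < 2 \<Longrightarrow> ((x0, 0, f), (d, c, zero_table, d0, 0, 0)) \<in> Z \<times> S"
  using x0 d0 zero_table n by (auto simp: Z_def S_def)

lemma cost_flagged [simp]: "circuit_cost (flagged q) = 2"
  by (simp add: flagged_def)

lemma cost_evidence_circuit: "circuit_cost (evidence_circuit cr d c q) = 2"
  by (simp add: evidence_circuit_def)

lemma cost_load_table: "circuit_cost (load_table ys) = length ys"
  by (induction ys) (auto simp: load_table_def)

lemma cost_counted_grover: "circuit_cost (counted_grover q i) = 4"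
  by (simp add: counted_grover_def)

lemma cost_concat_grover: "circuit_cost (concat (map (counted_grover q) is)) = 4 * length is"
  by (induction "is") (auto simp: cost_counted_grover)

lemma cost_variance_circuit: "circuit_cost (variance_circuit cr c ys amp q) = 2 + 2 * length ys + 4 * (n - 1)"
  by (simp add: variance_circuit_def cost_load_table cost_concat_grover)

lemma unitary_flag_core:
  assumes "\<And>x y. 0 \<le> q x y" "\<And>x y. q x y \<le> 1"
  shows "unitary_on Z (flag_core q)"
  by (rule unitary_block[where jn="\<lambda>f (x, y). (x, y, f)" and I="{..<2}" and Rs="X \<times> {..<2 ^ (b + 1)}"
        and H="\<lambda>(x, y). prep_op {..<2} 0 (flag_vec (q x y))"])
    (use finX assms in \<open>auto simp: Z_def block_diag_def flag_core_def bij_betw_def inj_on_def image_iff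
      intro!: prep_op(1) flag_vec_unit\<close>)

lemma mapply_flag_core:
  assumes "(x, y, f) \<in> Z"
  shows "mapply Z (flag_core q) \<psi> (x, y, f) = (\<Sum>f'<2. prep_op {..<2} 0 (flag_vec (q x y)) f f' * \<psi> (x, y, f'))"
proof -
  have "mapply Z (flag_core q) \<psi> ((\<lambda>f (x, y). (x, y, f)) f (x, y))
    = (\<Sum>f'<2. (\<lambda>(x, y). prep_op {..<2} 0 (flag_vec (q x y))) (x, y) f f' * \<psi> ((\<lambda>f (x, y). (x, y, f)) f' (x, y)))"
    by (rule mapply_block[where I="{..<2}" and Rs="X \<times> {..<2 ^ (b + 1)}"])
      (use finX assms in \<open>auto simp: Z_def block_diag_def flag_core_def bij_betw_def inj_on_def image_iff\<close>)
  then show ?thesis by simp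
qed

end

section \<open>The oracles on the registers\<close>

definition lik_op :: "(real \<Rightarrow> real \<Rightarrow> control \<Rightarrow> nat) \<Rightarrow> basis \<Rightarrow> basis \<Rightarrow> complex" where
  "lik_op l = perm_op (\<lambda>(x, d, c, y, w). (x, d, c, xor y (l d x c), w))"

lemma likelihood_op_lik_op: "likelihood_op b L = lik_op (\<lambda>d x c. likelihood_bits b (L d x c))"
  by (auto simp: likelihood_op_def lik_op_def perm_op_def fun_eq_iff)

lemma exchange_apply: "exchange a b a = b" "exchange a b b = a"
  by (auto simp: exchange_def)

lemma exchange_exchange: "exchange a b (exchange a b c) = c"
  by (auto simp: exchange_def)

text \<open>The oracle is an arbitrary table \<open>l\<close> of integers. The analysis treats
  \<open>l / 2 ^ b\<close> as the exact likelihood and compares it with the true one only at the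
  level of the utility.\<close>

locale bayes_registers = registers +
  fixes V :: "real \<Rightarrow> real \<Rightarrow> complex" and l :: "real \<Rightarrow> real \<Rightarrow> control \<Rightarrow> nat" and P :: "real \<Rightarrow> real"
  assumes V: "unitary_on X V" and VP: "\<And>x. x \<in> X \<Longrightarrow> V x x0 = complex_of_real (sqrt (P x))"
    and l_le: "\<And>d x c. d \<in> Y \<Longrightarrow> x \<in> X \<Longrightarrow> c \<in> K \<Longrightarrow> l d x c \<le> 2 ^ b"
    and P_nonneg: "\<And>x. x \<in> X \<Longrightarrow> 0 \<le> P x"
begin

lemma l_less: "d \<in> Y \<Longrightarrow> x \<in> X \<Longrightarrow> c \<in> K \<Longrightarrow> l d x c < 2 ^ (b + 1)"
  using l_le[of d x c] by (simp add: order_le_less_trans[of _ "2 ^ b"])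

lemma xor_l: "y < 2 ^ (b + 1) \<Longrightarrow> d \<in> Y \<Longrightarrow> x \<in> X \<Longrightarrow> c \<in> K \<Longrightarrow> xor y (l d x c) < 2 ^ (b + 1)"
  by (intro xor_less_two_power l_less)

lemma lik_perm_in: "z \<in> Z \<Longrightarrow> s \<in> S \<Longrightarrow> lik_perm l s z \<in> Z"
  unfolding Z_def S_def lik_perm_def using xor_l by (auto simp del: power_Suc power_add)

lemma lik_perm_lik_perm: "lik_perm l s (lik_perm l s z) = z"
  by (simp add: lik_perm_def xor.assoc)

lemma lik_op_involution:
  assumes "a \<in> Bs"
  shows "(\<lambda>(x, d, c, y, w). (x, d, c, xor y (l d x c), w)) a \<in> Bs"
    "(\<lambda>(x, d, c, y, w). (x, d, c, xor y (l d x c), w)) ((\<lambda>(x, d, c, y, w). (x, d, c, xor y (l d x c), w)) a) = a"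
  using assms xor_l unfolding basis_states_def by (auto simp: xor.assoc simp del: power_Suc power_add)

lemma model: "cr \<in> K \<Longrightarrow> query_model Bs V (lik_op l) (J (root cr))"
proof
  assume cr: "cr \<in> K"
  show "finite Bs" by (rule finite_Bs)
  show "J (root cr) \<in> Bs" using J_bij root_in[OF cr] by (auto simp: bij_betw_def)
  show "unitary_on Bs (on_latent V)"
    by (rule unitary_block[where jn=Pair and I=X and Rs="Y \<times> K \<times> {..<2 ^ (b + 1)} \<times> {..<W}" and H="\<lambda>_. V"])
      (use finY finK V in \<open>auto simp: block_diag_def on_latent_def bij_betw_def inj_on_def basis_states_def\<close>)
  show "unitary_on Bs (lik_op l)" unfolding lik_op_def
    by (rule unitary_perm[OF finite_Bs]) (use lik_op_involution in blast)+
  fix a a' assume m: "a \<in> Bs" "a' \<in> Bs"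
  show "adjoint_op (lik_op l) a a' = lik_op l a a'"
    unfolding adjoint_op_def lik_op_def perm_op_def
    using lik_op_involution(2)[OF m(1)] lik_op_involution(2)[OF m(2)] by auto
qed

primrec reg_op :: "(core \<times> spectators) gate \<Rightarrow> core \<times> spectators \<Rightarrow> core \<times> spectators \<Rightarrow> complex" where
  "reg_op (Apply M) = M"
| "reg_op Prior = blockwise (\<lambda>s. prior_core V)"
| "reg_op Prior_Inverse = blockwise (\<lambda>s. prior_core (adjoint_op V))"
| "reg_op Likelihood = blockwise (\<lambda>s. perm_op (lik_perm l s))"

lemma enc_eq: "k \<in> work \<Longrightarrow> k' \<in> work \<Longrightarrow> enc k = enc k' \<longleftrightarrow> k = k'"
  using enc by (auto simp: bij_betw_def inj_on_def)

lemma on_latent_J: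
  assumes "a \<in> Z \<times> S" "a' \<in> Z \<times> S"
  shows "on_latent U (J a) (J a') = blockwise (\<lambda>s. prior_core U) a a'"
proof -
  obtain x y f d c v e t g where a: "a = ((x, y, f), (d, c, v, e, t, g))" by (metis prod.exhaust)
  obtain x' y' f' d' c' v' e' t' g' where a': "a' = ((x', y', f'), (d', c', v', e', t', g'))" by (metis prod.exhaust)
  have "enc (v, e, t, g, f) = enc (v', e', t', g', f') \<longleftrightarrow> (v, e, t, g, f) = (v', e', t', g', f')"
    by (rule enc_eq) (use assms in \<open>auto simp: a a' Z_def S_def work_def\<close>)
  then show ?thesis by (auto simp: on_latent_def J_def blockwise_def prior_core_def a a')
qed

lemma lik_op_J:
  assumes "a \<in> Z \<times> S" "a' \<in> Z \<times> S"
  shows "lik_op l (J a) (J a') = blockwise (\<lambda>s. perm_op (lik_perm l s)) a a'"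
proof -
  obtain x y f d c v e t g where a: "a = ((x, y, f), (d, c, v, e, t, g))" by (metis prod.exhaust)
  obtain x' y' f' d' c' v' e' t' g' where a': "a' = ((x', y', f'), (d', c', v', e', t', g'))" by (metis prod.exhaust)
  have "enc (v, e, t, g, f) = enc (v', e', t', g', f') \<longleftrightarrow> (v, e, t, g, f) = (v', e', t', g', f')"
    by (rule enc_eq) (use assms in \<open>auto simp: a a' Z_def S_def work_def\<close>)
  then show ?thesis by (auto simp: lik_op_def perm_op_def J_def blockwise_def lik_perm_def a a')
qed

lemma gate_op_J:
  assumes "a \<in> Z \<times> S" "a' \<in> Z \<times> S"
  shows "gate_op V (lik_op l) (embed g) (J a) (J a') = reg_op g a a'"
  by (cases g) (simp_all add: relabel_apply[OF J_bij assms] on_latent_J[OF assms] lik_op_J[OF assms])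

definition run :: "(core \<times> spectators) gate list \<Rightarrow> (core \<times> spectators \<Rightarrow> complex) \<Rightarrow> core \<times> spectators \<Rightarrow> complex" where
  "run cs \<psi> = run_ops (Z \<times> S) (map reg_op cs) \<psi>"

lemma run_simps [simp]: "run [] \<psi> = \<psi>" "run (g # cs) \<psi> = run cs (mapply (Z \<times> S) (reg_op g) \<psi>)"
  "run (cs @ ds) \<psi> = run ds (run cs \<psi>)"
  by (simp_all add: run_def)

lemma run_cong: "(\<And>a. a \<in> Z \<times> S \<Longrightarrow> \<phi> a = \<psi> a) \<Longrightarrow> a \<in> Z \<times> S \<Longrightarrow> run cs \<phi> a = run cs \<psi> a"
  unfolding run_def by (rule run_ops_cong)

text \<open>\<open>J\<close> intertwines the gates on the two sets of states, so from here on
  circuits are analysed on the structured registers only.\<close>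

lemma run_circuit_J:
  "a \<in> Z \<times> S \<Longrightarrow> run_ops Bs (map (gate_op V (lik_op l)) (circuit cs)) \<psi> (J a) = run cs (\<psi> \<circ> J) a"
proof (induction cs arbitrary: \<psi> a)
  case (Cons g cs)
  have "run_ops Bs (map (gate_op V (lik_op l)) (circuit (g # cs))) \<psi> (J a)
     = run cs (mapply Bs (gate_op V (lik_op l) (embed g)) \<psi> \<circ> J) a"
    using Cons by (simp add: circuit_def o_def)
  also have "\<dots> = run cs (mapply (Z \<times> S) (reg_op g) (\<psi> \<circ> J)) a"
  proof (rule run_cong[OF _ Cons.prems])
    fix a assume "a \<in> Z \<times> S"
    then show "(mapply Bs (gate_op V (lik_op l) (embed g)) \<psi> \<circ> J) a = mapply (Z \<times> S) (reg_op g) (\<psi> \<circ> J) a"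
      using mapply_relabel[OF J_bij, of "gate_op V (lik_op l) (embed g)" "reg_op g" a \<psi>] gate_op_J by simp
  qed
  finally show ?case by (simp only: run_simps)
qed (simp add: circuit_def)

lemma success_prob_circuit:
  assumes cr: "cr \<in> K"
  shows "query_model.success_prob Bs V (lik_op l) (J (root cr)) (circuit cs) (on_registers p)
    = (\<Sum>a | a \<in> Z \<times> S \<and> p a. (cmod (run cs (unit_at (root cr)) a))\<^sup>2)"
proof -
  have root: "root cr \<in> Z \<times> S" by (rule root_in[OF cr])
  have inj: "inj_on J (Z \<times> S)" and im: "J ` (Z \<times> S) = Bs" using J_bij by (auto simp: bij_betw_def)
  have on: "on_registers p (J a) = p a" if "a \<in> Z \<times> S" for a
    using that by (simp add: on_registers_def inv_into_f_f[OF inj])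
  have im': "{a \<in> Bs. on_registers p a} = J ` {a \<in> Z \<times> S. p a}"
    unfolding im[symmetric] using on by auto
  have inj': "inj_on J {a \<in> Z \<times> S. p a}" using inj by (rule inj_on_subset) auto
  have unit: "(unit_at (J (root cr)) \<circ> J) a = unit_at (root cr) a" if "a \<in> Z \<times> S" for a
    using that root inj_on_eq_iff[OF inj] by (auto simp: unit_at_def)
  have "query_model.success_prob Bs V (lik_op l) (J (root cr)) (circuit cs) (on_registers p)
    = (\<Sum>a | a \<in> Z \<times> S \<and> p a. (cmod (run_ops Bs (map (gate_op V (lik_op l)) (circuit cs)) (unit_at (J (root cr))) (J a)))\<^sup>2)"
    unfolding query_model.success_prob_def[OF model[OF cr]] query_model.circuit_prob_def[OF model[OF cr]] im'
    by (simp add: sum.reindex[OF inj'])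
  also have "\<dots> = (\<Sum>a | a \<in> Z \<times> S \<and> p a. (cmod (run cs (unit_at (root cr)) a))\<^sup>2)"
    by (intro sum.cong refl) (auto simp: run_circuit_J intro!: arg_cong[where f=cmod] run_cong unit)
  finally show ?thesis .
qed

lemma prior_core_adjoint: "prior_core (adjoint_op V) = adjoint_op (prior_core V)"
  by (auto simp: prior_core_def adjoint_op_def fun_eq_iff)

lemma unitary_prior_core: "unitary_on Z (prior_core V)"
  by (rule unitary_block[where jn=Pair and I=X and Rs="{..<2 ^ (b + 1)} \<times> {..<2}" and H="\<lambda>_. V"])
    (use V in \<open>auto simp: block_diag_def prior_core_def bij_betw_def inj_on_def Z_def\<close>)

lemma unitary_lik_perm: "s \<in> S \<Longrightarrow> unitary_on Z (perm_op (lik_perm l s))"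
  by (rule unitary_perm) (auto simp: lik_perm_in lik_perm_lik_perm)

lemma mapply_likelihood:
  assumes "((x, y, f), (d, c, v, e, t, g)) \<in> Z \<times> S"
  shows "mapply (Z \<times> S) (reg_op Likelihood) \<psi> ((x, y, f), (d, c, v, e, t, g))
    = \<psi> ((x, xor y (l d x c), f), (d, c, v, e, t, g))"
proof -
  have m: "(x, y, f) \<in> Z" "(d, c, v, e, t, g) \<in> S" using assms by auto
  show ?thesis unfolding reg_op.simps mapply_blockwise[OF finites(1,3) m]
    by (subst mapply_perm) (use m in \<open>auto simp: lik_perm_in lik_perm_lik_perm\<close>, simp add: lik_perm_def)
qed

lemma mapply_prior:
  assumes "((x, y, f), s) \<in> Z \<times> S"
  shows "mapply (Z \<times> S) (reg_op Prior) \<psi> ((x, y, f), s) = (\<Sum>x'\<in>X. V x x' * \<psi> ((x', y, f), s))"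
proof -
  have m: "(x, y, f) \<in> Z" "s \<in> S" using assms by auto
  have "mapply Z (prior_core V) (\<lambda>z. \<psi> (z, s)) (x, y, f) = (\<Sum>x'\<in>X. V x x' * \<psi> ((x', y, f), s))"
    by (rule mapply_block[where jn=Pair and I=X and Rs="{..<2 ^ (b + 1)} \<times> {..<2}" and H="\<lambda>_. V"])
      (use m in \<open>auto simp: block_diag_def prior_core_def bij_betw_def inj_on_def Z_def\<close>)
  then show ?thesis unfolding reg_op.simps mapply_blockwise[OF finites(1,3) m] .
qed

definition core_ops :: "(real \<Rightarrow> nat \<Rightarrow> real) \<Rightarrow> spectators \<Rightarrow> (core \<Rightarrow> core \<Rightarrow> complex) list" where
  "core_ops q s = [prior_core V, perm_op (lik_perm l s), flag_core q]"

definition core_state :: "(real \<Rightarrow> nat \<Rightarrow> real) \<Rightarrow> spectators \<Rightarrow> core \<Rightarrow> complex" where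
  "core_state q s = run_ops Z (core_ops q s) (unit_at (x0, 0, 0))"

text \<open>The preparation starts from \<open>x0\<close>, so the only column of \<open>V\<close>
  that enters is the specified one.\<close>

lemma core_state:
  assumes q: "\<And>x y. 0 \<le> q x y" "\<And>x y. q x y \<le> 1" and m: "(x, y, f) \<in> Z" "(d, c, v, e, t, g) \<in> S"
  shows "core_state q (d, c, v, e, t, g) (x, y, f)
    = (if y = l d x c then complex_of_real (sqrt (P x) * flag_vec (q x y) f) else 0)"
proof -
  let ?s = "(d, c, v, e, t, g)"
  have 1: "mapply Z (prior_core V) (unit_at (x0, 0, 0)) (x, y, f) = (if y = 0 \<and> f = 0 then complex_of_real (sqrt (P x)) else 0)"
    if "(x, y, f) \<in> Z" for x y f
  proof -
    have "mapply Z (prior_core V) (unit_at (x0, 0, 0)) (x, y, f) = (\<Sum>x'\<in>X. V x x' * unit_at (x0, 0, 0) (x', y, f))"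
      by (rule mapply_block[where jn=Pair and I=X and Rs="{..<2 ^ (b + 1)} \<times> {..<2}" and H="\<lambda>_. V"])
        (use that in \<open>auto simp: block_diag_def prior_core_def bij_betw_def inj_on_def Z_def\<close>)
    also have "\<dots> = (\<Sum>x'\<in>X. if x' = x0 then (if y = 0 \<and> f = 0 then V x x0 else 0) else 0)"
      by (intro sum.cong) (auto simp: unit_at_def)
    also have "\<dots> = (if y = 0 \<and> f = 0 then complex_of_real (sqrt (P x)) else 0)"
      using finX x0 that by (auto simp: VP Z_def)
    finally show ?thesis .
  qed
  have 2: "mapply Z (perm_op (lik_perm l ?s)) (mapply Z (prior_core V) (unit_at (x0, 0, 0))) (x, y, f)
     = (if y = l d x c \<and> f = 0 then complex_of_real (sqrt (P x)) else 0)" if "(x, y, f) \<in> Z" for x y f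
  proof -
    have lp: "lik_perm l ?s (x, y, f) = (x, xor y (l d x c), f)" by (simp add: lik_perm_def)
    have "mapply Z (perm_op (lik_perm l ?s)) (mapply Z (prior_core V) (unit_at (x0, 0, 0))) (x, y, f)
      = mapply Z (prior_core V) (unit_at (x0, 0, 0)) (x, xor y (l d x c), f)"
      unfolding lp[symmetric] by (rule mapply_perm) (use that m in \<open>auto simp: lik_perm_in lik_perm_lik_perm\<close>)
    also have "\<dots> = (if xor y (l d x c) = 0 \<and> f = 0 then complex_of_real (sqrt (P x)) else 0)"
      by (rule 1) (use lik_perm_in[OF that m(2)] lp in simp)
    also have "xor y (l d x c) = 0 \<longleftrightarrow> y = l d x c"
      by (metis xor.assoc xor.left_neutral xor_self_eq xor.right_neutral)
    finally show ?thesis .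
  qed
  have "core_state q ?s (x, y, f) = mapply Z (flag_core q)
     (mapply Z (perm_op (lik_perm l ?s)) (mapply Z (prior_core V) (unit_at (x0, 0, 0)))) (x, y, f)"
    by (simp add: core_state_def core_ops_def)
  also have "\<dots> = (\<Sum>f'<2. prep_op {..<2} 0 (flag_vec (q x y)) f f' *
     (if y = l d x c \<and> f' = 0 then complex_of_real (sqrt (P x)) else 0))"
    unfolding mapply_flag_core[OF m(1)] using m(1) by (intro sum.cong refl arg_cong2[where f="(*)"] 2) (auto simp: Z_def)
  also have "\<dots> = prep_op {..<2} 0 (flag_vec (q x y)) f 0 * (if y = l d x c then complex_of_real (sqrt (P x)) else 0)"
    by (simp add: numeral_2_eq_2)
  also have "prep_op {..<2} 0 (flag_vec (q x y)) f 0 = complex_of_real (flag_vec (q x y) f)"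
    by (rule prep_op(2)) (use m in \<open>auto simp: flag_vec_unit q Z_def\<close>)
  finally show ?thesis by simp
qed

lemma unitary_core_ops:
  assumes q: "\<And>x y. 0 \<le> q x y" "\<And>x y. q x y \<le> 1" and s: "s \<in> S"
  shows "\<forall>U\<in>set (core_ops q s). unitary_on Z U"
  using unitary_prior_core unitary_lik_perm[OF s] unitary_flag_core[of q] q by (simp add: core_ops_def)

lemma core_state_unit:
  assumes q: "\<And>x y. 0 \<le> q x y" "\<And>x y. q x y \<le> 1" and s: "s \<in> S"
  shows "inner_on Z (core_state q s) (core_state q s) = 1"
proof -
  have "(x0, 0, 0) \<in> Z" using x0 by (simp add: Z_def)
  then show ?thesis
    unfolding core_state_def inner_on_run_ops[OF unitary_core_ops[OF assms] finites(1)]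
    by (subst inner_on_unit_at) (auto simp: unit_at_def)
qed

lemma run_flagged:
  assumes "z \<in> Z" "s \<in> S"
  shows "run (flagged q) \<psi> (z, s) = run_ops Z (core_ops q s) (\<lambda>z. \<psi> (z, s)) z"
proof -
  have "map reg_op (flagged q) = map blockwise [\<lambda>s. prior_core V, \<lambda>s. perm_op (lik_perm l s), \<lambda>s. flag_core q]"
    by (simp add: flagged_def)
  then show ?thesis unfolding run_def core_ops_def
    using run_blockwise[OF finites(1,3) assms, of "[\<lambda>s. prior_core V, \<lambda>s. perm_op (lik_perm l s), \<lambda>s. flag_core q]" \<psi>]
    by simp
qed

lemma run_flagged_inverse:
  assumes "z \<in> Z" "s \<in> S"
  shows "run (circuit_inverse (flagged q)) \<psi> (z, s) = run_ops Z (inv_ops (core_ops q s)) (\<lambda>z. \<psi> (z, s)) z"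
proof -
  let ?Cs = "[\<lambda>s. adjoint_op (flag_core q), \<lambda>s. perm_op (lik_perm l s), \<lambda>s. prior_core (adjoint_op V)]"
  have "map reg_op (circuit_inverse (flagged q)) = map blockwise ?Cs"
    by (simp add: flagged_def circuit_inverse_def adjoint_blockwise)
  then have "run (circuit_inverse (flagged q)) \<psi> (z, s) = run_ops Z (map (\<lambda>C. C s) ?Cs) (\<lambda>z. \<psi> (z, s)) z"
    unfolding run_def using run_blockwise[OF finites(1,3) assms, of ?Cs \<psi>] by simp
  also have "\<dots> = run_ops Z (inv_ops (core_ops q s)) (\<lambda>z. \<psi> (z, s)) z"
  proof -
    have "mapply Z (prior_core (adjoint_op V)) (mapply Z (perm_op (lik_perm l s)) \<phi>)
      = mapply Z (prior_core (adjoint_op V)) (mapply Z (adjoint_op (perm_op (lik_perm l s))) \<phi>)" for \<phi>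
      by (rule mapply_cong, rule mapply_adjoint_perm[symmetric])
        (use assms in \<open>auto simp: lik_perm_in lik_perm_lik_perm\<close>)
    then show ?thesis by (simp add: core_ops_def inv_ops_def prior_core_adjoint)
  qed
  finally show ?thesis .
qed

abbreviation raised :: "core \<Rightarrow> bool" where "raised \<equiv> (\<lambda>(x, y, f). f = 1)"

text \<open>The counter is a spectator, so the circuit acts separately for each value of it: below
  \<open>i\<close> both diagonal gates are the identity and the preparation cancels with its
  inverse.\<close>

lemma run_counted_grover:
  assumes q: "\<And>x y. 0 \<le> q x y" "\<And>x y. q x y \<le> 1" and z: "z \<in> Z" and s: "(d, c, v, e, t, g) \<in> S"
  shows "run (counted_grover q i) \<psi> (z, (d, c, v, e, t, g)) = (if i \<le> t
    then grover_step Z raised (core_state q (d, c, v, e, t, g)) (\<lambda>z. \<psi> (z, (d, c, v, e, t, g))) z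
    else \<psi> (z, (d, c, v, e, t, g)))"
proof -
  let ?s = "(d, c, v, e, t, g)"
  let ?D1 = "diag_op (\<lambda>(x::real, y::nat, f). if i \<le> t \<and> f = (1::nat) then -1 else 1)"
  let ?D2 = "diag_op (\<lambda>z. if i \<le> t \<and> z \<noteq> (x0, 0, 0) then -1 else 1)"
  let ?M1 = "blockwise (\<lambda>(d, c, v, e, t, g). diag_op (\<lambda>(x, y, f). if i \<le> t \<and> f = 1 then -1 else 1))"
  let ?M2 = "blockwise (\<lambda>(d, c, v, e, t, g). diag_op (\<lambda>z. if i \<le> t \<and> z \<noteq> (x0, 0, 0) then -1 else 1))"
  define \<phi> where "\<phi> = (\<lambda>z. \<psi> (z, ?s))"
  note U = unitary_core_ops[of q, OF q s]
  have d1: "mapply (Z \<times> S) ?M1 \<xi> (z, ?s) = mapply Z ?D1 (\<lambda>z. \<xi> (z, ?s)) z"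
    and d2: "mapply (Z \<times> S) ?M2 \<xi> (z, ?s) = mapply Z ?D2 (\<lambda>z. \<xi> (z, ?s)) z" if "z \<in> Z" for z \<xi>
    using mapply_blockwise[OF finites(1,3) that s] by simp_all
  have "run (counted_grover q i) \<psi> (z, ?s)
    = run (flagged q) (mapply (Z \<times> S) ?M2 (run (circuit_inverse (flagged q)) (mapply (Z \<times> S) ?M1 \<psi>))) (z, ?s)"
    by (simp add: counted_grover_def)
  also have "\<dots> = run_ops Z (core_ops q ?s) (mapply Z ?D2 (run_ops Z (inv_ops (core_ops q ?s)) (mapply Z ?D1 \<phi>))) z"
    unfolding run_flagged[OF z s]
  proof (rule run_ops_cong[OF _ z])
    fix z assume z: "z \<in> Z"
    show "mapply (Z \<times> S) ?M2 (run (circuit_inverse (flagged q)) (mapply (Z \<times> S) ?M1 \<psi>)) (z, ?s)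
      = mapply Z ?D2 (run_ops Z (inv_ops (core_ops q ?s)) (mapply Z ?D1 \<phi>)) z"
      unfolding d2[OF z]
    proof (rule fun_cong[OF mapply_cong])
      fix z assume z: "z \<in> Z"
      show "run (circuit_inverse (flagged q)) (mapply (Z \<times> S) ?M1 \<psi>) (z, ?s)
        = run_ops Z (inv_ops (core_ops q ?s)) (mapply Z ?D1 \<phi>) z"
        unfolding run_flagged_inverse[OF z s] unfolding \<phi>_def by (rule run_ops_cong[OF d1 z])
    qed
  qed
  finally have e: "run (counted_grover q i) \<psi> (z, ?s)
    = run_ops Z (core_ops q ?s) (mapply Z ?D2 (run_ops Z (inv_ops (core_ops q ?s)) (mapply Z ?D1 \<phi>))) z" .
  show ?thesis
  proof (cases "i \<le> t")
    case True
    have D1: "?D1 = diag_op (\<lambda>a. if raised a then -1 else 1)"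
      using True by (auto simp: fun_eq_iff diag_op_def)
    have D2: "?D2 = diag_op (\<lambda>a. if a = (x0, 0, 0) then 1 else -1)"
      using True by (auto simp: fun_eq_iff diag_op_def)
    have "run (counted_grover q i) \<psi> (z, ?s) = run_ops Z (grover_ops raised (x0, 0, 0) (core_ops q ?s)) \<phi> z"
      unfolding e D1 D2 by (simp add: grover_ops_def)
    also have "\<dots> = grover_step Z raised (core_state q ?s) \<phi> z"
      unfolding core_state_def by (rule run_grover_ops[OF U finites(1) _ z]) (use x0 in \<open>simp add: Z_def\<close>)
    finally show ?thesis using True by (simp add: \<phi>_def)
  next
    case False
    have D1: "mapply Z ?D1 \<xi> a = \<xi> a" and D2: "mapply Z ?D2 \<xi> a = \<xi> a" if "a \<in> Z" for a \<xi>
      using False mapply_diag[OF finites(1) that] by (auto split: prod.split)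
    have "run (counted_grover q i) \<psi> (z, ?s) = run_ops Z (core_ops q ?s) (run_ops Z (inv_ops (core_ops q ?s)) \<phi>) z"
      unfolding e
    proof (rule run_ops_cong[OF _ z])
      fix a assume a: "a \<in> Z"
      show "mapply Z ?D2 (run_ops Z (inv_ops (core_ops q ?s)) (mapply Z ?D1 \<phi>)) a = run_ops Z (inv_ops (core_ops q ?s)) \<phi> a"
        unfolding D2[OF a] by (rule run_ops_cong[OF D1 a])
    qed
    also have "\<dots> = \<phi> z" by (rule run_ops_inv_right[OF U finites(1) z])
    finally show ?thesis using False by (simp add: \<phi>_def)
  qed
qed

text \<open>Of the steps \<open>1, \<dots>, m\<close> exactly those not above the counter are
  active.\<close>

lemma run_concat_grover:
  assumes q: "\<And>x y. 0 \<le> q x y" "\<And>x y. q x y \<le> 1" and z: "z \<in> Z" and s: "(d, c, v, e, t, g) \<in> S"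
  shows "run (concat (map (counted_grover q) [1..<Suc m])) \<psi> (z, (d, c, v, e, t, g))
    = (grover_step Z raised (core_state q (d, c, v, e, t, g)) ^^ min m t) (\<lambda>z. \<psi> (z, (d, c, v, e, t, g))) z"
  using z
proof (induction m arbitrary: z)
  case (Suc m)
  let ?s = "(d, c, v, e, t, g)"
  let ?G = "grover_step Z raised (core_state q ?s)"
  have "run (concat (map (counted_grover q) [1..<Suc (Suc m)])) \<psi> (z, ?s)
     = run (counted_grover q (Suc m)) (run (concat (map (counted_grover q) [1..<Suc m])) \<psi>) (z, ?s)"
    by simp
  also have "\<dots> = (if Suc m \<le> t then ?G (\<lambda>z. run (concat (map (counted_grover q) [1..<Suc m])) \<psi> (z, ?s)) z
    else run (concat (map (counted_grover q) [1..<Suc m])) \<psi> (z, ?s))"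
    by (rule run_counted_grover[OF q Suc.prems s])
  also have "\<dots> = (?G ^^ min (Suc m) t) (\<lambda>z. \<psi> (z, ?s)) z"
  proof (cases "Suc m \<le> t")
    case True
    have "?G (\<lambda>z. run (concat (map (counted_grover q) [1..<Suc m])) \<psi> (z, ?s)) z
      = ?G ((?G ^^ min m t) (\<lambda>z. \<psi> (z, ?s))) z"
      by (rule grover_step_cong[OF Suc.IH Suc.prems])
    then show ?thesis using True by (simp add: min_absorb1)
  next
    case False
    then have "min (Suc m) t = min m t" by simp
    then show ?thesis using False Suc.IH[OF Suc.prems] by simp
  qed
  finally show ?case .
qed simp

end

section \<open>Unitarity of the gates\<close>

context registers
begin

lemma exchange_in: "u \<in> A \<Longrightarrow> w \<in> A \<Longrightarrow> a \<in> A \<Longrightarrow> exchange u w a \<in> A"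
  by (simp add: exchange_def)

lemma table_swap_in: "i \<in> Y \<Longrightarrow> a \<in> Z \<times> S \<Longrightarrow> table_swap d0 i a \<in> Z \<times> S"
  using d0 by (cases "(d0, i, a)" rule: table_swap.cases)
    (auto simp: Z_def S_def tables_def exchange_def PiE_iff extensional_def)

lemma table_swap_involution: "table_swap d0 i (table_swap d0 i a) = a"
  by (cases "(d0, i, a)" rule: table_swap.cases) (simp add: exchange_exchange)

lemma outcome_swap_in: "a \<in> Z \<times> S \<Longrightarrow> outcome_swap a \<in> Z \<times> S"
  by (cases a rule: outcome_swap.cases) (auto simp: S_def)

lemma outcome_swap_involution: "outcome_swap (outcome_swap a) = a"
  by (cases a rule: outcome_swap.cases) simp

lemma mapply_outcome_prep:
  assumes "((x, y, f), (d, c, v, e, t, g)) \<in> Z \<times> S"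
  shows "mapply (Z \<times> S) (outcome_prep Y d0 amp) \<psi> ((x, y, f), (d, c, v, e, t, g))
    = (\<Sum>i\<in>Y \<times> {..<2}. prep_op (Y \<times> {..<2}) (d0, 0) (complete_vec Y d0 (amp x v)) (e, g) i *
         \<psi> ((x, y, f), (d, c, v, fst i, t, snd i)))"
    and "unitary_on (Z \<times> S) (outcome_prep Y d0 amp)"
proof -
  let ?R = "Z \<times> Y \<times> K \<times> tables \<times> {..<n}"
  let ?jn = "\<lambda>i r. case r of (z, d, c, v, t) \<Rightarrow> (z, (d, c, v, fst i, t, snd i))"
  let ?H = "\<lambda>(z, d, c, v, t). prep_op (Y \<times> {..<2}) (d0, 0) (complete_vec Y d0 (amp (fst z) v))"
  have bij: "bij_betw (\<lambda>(i, r). ?jn i r) ((Y \<times> {..<2}) \<times> ?R) (Z \<times> S)"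
    by (rule bij_betw_byWitness[where f'="\<lambda>(z, (d, c, v, e, t, g)). ((e, g), (z, d, c, v, t))"]) (auto simp: S_def)
  have blk: "block_diag (Y \<times> {..<2}) ?R ?jn ?H (outcome_prep Y d0 amp)"
    unfolding block_diag_def by (auto split: if_splits)
  have "mapply (Z \<times> S) (outcome_prep Y d0 amp) \<psi> (?jn (e, g) ((x, y, f), d, c, v, t))
    = (\<Sum>i\<in>Y \<times> {..<2}. ?H ((x, y, f), d, c, v, t) (e, g) i * \<psi> (?jn i ((x, y, f), d, c, v, t)))"
    by (rule mapply_block[OF bij _ blk]) (use assms finY finK in \<open>auto simp: S_def\<close>)
  then show "mapply (Z \<times> S) (outcome_prep Y d0 amp) \<psi> ((x, y, f), (d, c, v, e, t, g))
    = (\<Sum>i\<in>Y \<times> {..<2}. prep_op (Y \<times> {..<2}) (d0, 0) (complete_vec Y d0 (amp x v)) (e, g) i *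
         \<psi> ((x, y, f), (d, c, v, fst i, t, snd i)))" by simp
  show "unitary_on (Z \<times> S) (outcome_prep Y d0 amp)"
    by (rule unitary_block[OF bij _ blk])
      (use finY finK d0 in \<open>auto intro!: prep_op(1) complete_vec_unit\<close>)
qed

lemma counter_vec_unit: "(\<Sum>t\<in>{..<n}. (1 / sqrt (real n))\<^sup>2) = 1"
  using n by (simp add: power_divide)

lemma mapply_counter_prep:
  assumes "(z, (d, c, v, e, t, g)) \<in> Z \<times> S"
  shows "mapply (Z \<times> S) (counter_prep n) \<psi> (z, (d, c, v, e, t, g))
    = (\<Sum>t'<n. prep_op {..<n} 0 (\<lambda>_. 1 / sqrt (real n)) t t' * \<psi> (z, (d, c, v, e, t', g)))"
    and "mapply (Z \<times> S) (adjoint_op (counter_prep n)) \<psi> (z, (d, c, v, e, t, g))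
    = (\<Sum>t'<n. cnj (prep_op {..<n} 0 (\<lambda>_. 1 / sqrt (real n)) t' t) * \<psi> (z, (d, c, v, e, t', g)))"
    and "unitary_on (Z \<times> S) (counter_prep n)"
proof -
  let ?R = "Z \<times> Y \<times> K \<times> tables \<times> Y \<times> {..<2::nat}"
  let ?jn = "\<lambda>t r. case r of (z, d, c, v, e, g) \<Rightarrow> (z, (d, c, v, e, t, g))"
  let ?H = "\<lambda>_. prep_op {..<n} 0 (\<lambda>_. 1 / sqrt (real n))"
  have bij: "bij_betw (\<lambda>(i, r). ?jn i r) ({..<n} \<times> ?R) (Z \<times> S)"
    by (rule bij_betw_byWitness[where f'="\<lambda>(z, (d, c, v, e, t, g)). (t, (z, d, c, v, e, g))"]) (auto simp: S_def)
  have blk: "block_diag {..<n} ?R ?jn ?H (counter_prep n)"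
    unfolding block_diag_def by auto
  have blk': "block_diag {..<n} ?R ?jn (\<lambda>r t t'. cnj (?H r t' t)) (adjoint_op (counter_prep n))"
    unfolding block_diag_def adjoint_op_def by auto
  have "mapply (Z \<times> S) (counter_prep n) \<psi> (?jn t (z, d, c, v, e, g))
    = (\<Sum>t'<n. ?H () t t' * \<psi> (?jn t' (z, d, c, v, e, g)))"
    by (rule mapply_block[OF bij _ blk]) (use assms finY finK in \<open>auto simp: S_def\<close>)
  then show "mapply (Z \<times> S) (counter_prep n) \<psi> (z, (d, c, v, e, t, g))
    = (\<Sum>t'<n. prep_op {..<n} 0 (\<lambda>_. 1 / sqrt (real n)) t t' * \<psi> (z, (d, c, v, e, t', g)))" by simp
  have "mapply (Z \<times> S) (adjoint_op (counter_prep n)) \<psi> (?jn t (z, d, c, v, e, g))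
    = (\<Sum>t'<n. cnj (?H () t' t) * \<psi> (?jn t' (z, d, c, v, e, g)))"
    by (rule mapply_block[OF bij _ blk']) (use assms finY finK in \<open>auto simp: S_def\<close>)
  then show "mapply (Z \<times> S) (adjoint_op (counter_prep n)) \<psi> (z, (d, c, v, e, t, g))
    = (\<Sum>t'<n. cnj (prep_op {..<n} 0 (\<lambda>_. 1 / sqrt (real n)) t' t) * \<psi> (z, (d, c, v, e, t', g)))" by simp
  show "unitary_on (Z \<times> S) (counter_prep n)"
    by (rule unitary_block[OF bij _ blk])
      (use finY finK n in \<open>auto intro!: prep_op(1) counter_vec_unit\<close>)
qed

lemma unitary_exchange_regs:
  "a \<in> Z \<times> S \<Longrightarrow> a' \<in> Z \<times> S \<Longrightarrow> unitary_on (Z \<times> S) (perm_op (exchange a a'))"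
  by (rule unitary_exchange[OF finites(4)])

lemma unitary_table_swap: "i \<in> Y \<Longrightarrow> unitary_on (Z \<times> S) (perm_op (table_swap d0 i))"
  by (rule unitary_perm[OF finites(4)]) (rule table_swap_in table_swap_involution; assumption)+

lemma unitary_outcome_swap: "unitary_on (Z \<times> S) (perm_op outcome_swap)"
  by (rule unitary_perm[OF finites(4)]) (rule outcome_swap_in outcome_swap_involution; assumption)+

lemma flagged_ok:
  assumes "\<And>x y. 0 \<le> q x y" "\<And>x y. q x y \<le> 1"
  shows "circuit_ok (Z \<times> S) (flagged q)"
  using unitary_blockwise[OF finites(3), of Z "\<lambda>s. flag_core q"] unitary_flag_core[of q, OF assms]
  by (simp add: flagged_def)

lemma evidence_circuit_ok:
  assumes "\<And>x y. 0 \<le> q x y" "\<And>x y. q x y \<le> 1" "cr \<in> K" "c \<in> K" "d \<in> Y"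
  shows "circuit_ok (Z \<times> S) (evidence_circuit cr d c q)"
  unfolding evidence_circuit_def
  using flagged_ok[of q] assms unitary_exchange_regs[OF root_in init_in, of cr c d 0] by simp

lemma load_table_ok: "set ys \<subseteq> Y \<Longrightarrow> circuit_ok (Z \<times> S) (load_table ys)"
  by (induction ys) (simp_all add: load_table_def unitary_table_swap)

lemma counted_grover_ok:
  assumes "\<And>x y. 0 \<le> q x y" "\<And>x y. q x y \<le> 1"
  shows "circuit_ok (Z \<times> S) (counted_grover q i)"
  unfolding counted_grover_def
  using flagged_ok[of q, OF assms] circuit_ok_inverse[OF flagged_ok[of q, OF assms]]
  by (auto intro!: unitary_blockwise unitary_diag split: prod.split)

lemma variance_circuit_ok:
  assumes "\<And>x y. 0 \<le> q x y" "\<And>x y. q x y \<le> 1" "cr \<in> K" "c \<in> K" "set ys \<subseteq> Y"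
  shows "circuit_ok (Z \<times> S) (variance_circuit cr c ys amp q)"
  unfolding variance_circuit_def
  using assms load_table_ok[OF assms(5)] counted_grover_ok[of q]
    mapply_outcome_prep(2)[OF init_in, of c d0 0] mapply_counter_prep(3)[OF init_in, of c d0 0] d0
    unitary_exchange_regs[OF root_in init_in, of cr c d0 1]
  by (auto simp: circuit_ok_concat unitary_outcome_swap intro!: unitary_adjoint)

end

section \<open>The state along the evidence and the variance circuit\<close>

context bayes_registers
begin

lemma mapply_exchange:
  assumes "a \<in> Z \<times> S" "u \<in> Z \<times> S" "w \<in> Z \<times> S"
  shows "mapply (Z \<times> S) (reg_op (Apply (perm_op (exchange u w)))) (unit_at u) a = unit_at w a"
proof -
  have "mapply (Z \<times> S) (perm_op (exchange u w)) (unit_at u) a = unit_at u (exchange u w a)"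
    by (rule mapply_perm[OF finites(4) assms(1)]) (rule exchange_in[OF assms(2,3)] exchange_exchange; assumption)+
  then show ?thesis by (auto simp: unit_at_def exchange_def)
qed

text \<open>The circuit never leaves the block of spectators that the first exchange selects. There
  \<open>x\<close> has weight \<open>P x\<close>, and given \<open>x\<close> the flag is raised with
  probability \<open>q\<close> of the likelihood read.\<close>

lemma evidence_success:
  assumes q: "\<And>x y. 0 \<le> q x y" "\<And>x y. q x y \<le> 1" and cr: "cr \<in> K" and c: "c \<in> K" and d: "d \<in> Y"
  shows "query_model.success_prob Bs V (lik_op l) (J (root cr)) (circuit (evidence_circuit cr d c q)) (on_registers (\<lambda>(z, s). raised z))
    = (\<Sum>x\<in>X. P x * q x (l d x c))"
proof -
  let ?s0 = "(d, c, zero_table, d0, 0, 0)"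
  have s0: "?s0 \<in> S" using init_in[OF c d, of 0] by simp
  have st: "run (evidence_circuit cr d c q) (unit_at (root cr)) (z, s) = (if s = ?s0 then core_state q ?s0 z else 0)"
    if "z \<in> Z" "s \<in> S" for z s
  proof -
    have "run (evidence_circuit cr d c q) (unit_at (root cr)) (z, s)
      = run (flagged q) (unit_at ((x0, 0, 0), ?s0)) (z, s)"
      unfolding evidence_circuit_def run_simps
      by (rule run_cong) (use mapply_exchange root_in[OF cr] init_in[OF c d, of 0] that in auto)
    also have "\<dots> = run_ops Z (core_ops q s) (\<lambda>z. unit_at ((x0, 0, 0), ?s0) (z, s)) z"
      by (rule run_flagged[OF that])
    also have "\<dots> = (if s = ?s0 then core_state q ?s0 z else 0)"
    proof (cases "s = ?s0")
      case True
      have e: "(\<lambda>z. unit_at ((x0, 0, 0), ?s0) (z, ?s0)) = unit_at (x0, 0, 0)" by (auto simp: unit_at_def)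
      show ?thesis unfolding True e core_state_def by simp
    next
      case False
      then have e: "(\<lambda>z. unit_at ((x0, 0, 0), ?s0) (z, s)) = (\<lambda>z. 0)" by (auto simp: unit_at_def)
      show ?thesis unfolding e using False by (simp add: run_ops_zero)
    qed
    finally show ?thesis .
  qed
  have "query_model.success_prob Bs V (lik_op l) (J (root cr)) (circuit (evidence_circuit cr d c q)) (on_registers (\<lambda>(z, s). raised z))
    = (\<Sum>a | a \<in> Z \<times> S \<and> (\<lambda>(z, s). raised z) a. (cmod (run (evidence_circuit cr d c q) (unit_at (root cr)) a))\<^sup>2)"
    by (rule success_prob_circuit[OF cr])
  also have "\<dots> = (\<Sum>a\<in>{z \<in> Z. raised z} \<times> S. (cmod (run (evidence_circuit cr d c q) (unit_at (root cr)) a))\<^sup>2)"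
    by (intro sum.cong) auto
  also have "\<dots> = (\<Sum>z | z \<in> Z \<and> raised z. \<Sum>s\<in>S. (cmod (run (evidence_circuit cr d c q) (unit_at (root cr)) (z, s)))\<^sup>2)"
    by (simp add: sum.cartesian_product case_prod_beta)
  also have "\<dots> = (\<Sum>z | z \<in> Z \<and> raised z. \<Sum>s\<in>S. if s = ?s0 then (cmod (core_state q ?s0 z))\<^sup>2 else 0)"
    by (intro sum.cong refl) (auto simp: st)
  also have "\<dots> = (\<Sum>z | z \<in> Z \<and> raised z. (cmod (core_state q ?s0 z))\<^sup>2)"
    using s0 by simp
  also have "\<dots> = (\<Sum>z | z \<in> Z \<and> raised z. if fst (snd z) = l d (fst z) c then P (fst z) * q (fst z) (fst (snd z)) else 0)"
  proof (intro sum.cong refl)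
    fix z assume z: "z \<in> {z. z \<in> Z \<and> raised z}"
    obtain x y f where zz: "z = (x, y, f)" by (metis prod.exhaust)
    then have f: "f = 1" "x \<in> X" using z by (auto simp: Z_def)
    have "core_state q ?s0 z = (if y = l d x c then complex_of_real (sqrt (P x) * flag_vec (q x y) f) else 0)"
      unfolding zz by (rule core_state[OF q _ s0]) (use z zz in blast)
    then show "(cmod (core_state q ?s0 z))\<^sup>2 = (if fst (snd z) = l d (fst z) c then P (fst z) * q (fst z) (fst (snd z)) else 0)"
      using f q(1)[of x y] q(1)[of x "l d x c"] P_nonneg[of x] by (auto simp: zz norm_mult power_mult_distrib flag_vec_def)
  qed
  also have "\<dots> = (\<Sum>a\<in>(\<lambda>x. (x, l d x c, 1::nat)) ` X. P (fst a) * q (fst a) (fst (snd a)))"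
    by (rule sum.mono_neutral_cong_right) (use finX l_less[OF d _ c] in \<open>auto simp: Z_def image_iff simp del: power_Suc power_add\<close>)
  also have "\<dots> = (\<Sum>x\<in>X. P x * q x (l d x c))"
    by (subst sum.reindex) (auto simp: inj_on_def)
  finally show ?thesis .
qed

lemma run_load_step:
  assumes i: "i \<in> Y" and a: "((x, y, f), (d, c, v, e, t, g)) \<in> Z \<times> S"
  shows "run [Apply (perm_op (table_swap d0 i)), Likelihood, Apply (perm_op (table_swap d0 i))] \<psi> ((x, y, f), (d, c, v, e, t, g))
    = \<psi> ((x, y, f), (d, c, v(i := xor (v i) (l (exchange d0 i d) x c)), e, t, g))"
proof -
  let ?a = "((x, y, f), (d, c, v, e, t, g))"
  have sw: "mapply (Z \<times> S) (perm_op (table_swap d0 i)) \<xi> a = \<xi> (table_swap d0 i a)" if "a \<in> Z \<times> S" for a \<xi>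
    by (rule mapply_perm) (use that i in \<open>auto simp: table_swap_in table_swap_involution simp del: mem_Sigma_iff\<close>)
  have a1: "((x, v i, f), (exchange d0 i d, c, v(i := y), e, t, g)) \<in> Z \<times> S"
    using table_swap_in[OF i a] by simp
  have a2: "((x, xor (v i) (l (exchange d0 i d) x c), f), (exchange d0 i d, c, v(i := y), e, t, g)) \<in> Z \<times> S"
    using lik_perm_in[of "(x, v i, f)" "(exchange d0 i d, c, v(i := y), e, t, g)"] a1 by (simp add: lik_perm_def)
  show ?thesis
    unfolding run_simps reg_op.simps(1) sw[OF a] table_swap.simps mapply_likelihood[OF a1] sw[OF a2]
    by (simp add: exchange_exchange)
qed

text \<open>On the states that carry amplitude the outcome register holds \<open>d0\<close> during
  loading, so entry \<open>i\<close> receives the likelihood of \<open>i\<close>. The general form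
  describes the map on all basis states.\<close>

definition xor_table :: "real list \<Rightarrow> real \<Rightarrow> real \<Rightarrow> control \<Rightarrow> (real \<Rightarrow> nat) \<Rightarrow> real \<Rightarrow> nat" where
  "xor_table ys d x c v = (\<lambda>i. if i \<in> set ys then xor (v i) (l (exchange d0 i d) x c) else v i)"

text \<open>The entries are filled one after the other; with distinct entries each is changed
  exactly once.\<close>

lemma run_load_table:
  assumes "distinct ys" "set ys \<subseteq> Y" "((x, y, f), (d, c, v, e, t, g)) \<in> Z \<times> S"
  shows "run (load_table ys) \<psi> ((x, y, f), (d, c, v, e, t, g)) = \<psi> ((x, y, f), (d, c, xor_table ys d x c v, e, t, g))"
  using assms
proof (induction ys arbitrary: \<psi>)
  case Nil
  then show ?case by (simp add: load_table_def xor_table_def)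
next
  case (Cons i ys)
  let ?g = "[Apply (perm_op (table_swap d0 i)), Likelihood, Apply (perm_op (table_swap d0 i))]"
  let ?v = "xor_table ys d x c v"
  have m: "x \<in> X" "c \<in> K" "d \<in> Y" "v \<in> tables" using Cons.prems by (auto simp: Z_def S_def)
  have v: "?v \<in> tables"
  proof -
    have "xor (v j) (l (exchange d0 j d) x c) < 2 ^ (b + 1)" if "j \<in> set ys" for j
      by (rule xor_l) (use m that Cons.prems d0 in \<open>auto simp: tables_def intro!: exchange_in\<close>)
    then show ?thesis using m Cons.prems by (auto simp: tables_def xor_table_def PiE_iff extensional_def)
  qed
  have "run (load_table (i # ys)) \<psi> ((x, y, f), (d, c, v, e, t, g))
     = run (load_table ys) (run ?g \<psi>) ((x, y, f), (d, c, v, e, t, g))"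
    by (simp add: load_table_def)
  also have "\<dots> = run ?g \<psi> ((x, y, f), (d, c, ?v, e, t, g))"
    by (rule Cons.IH) (use Cons.prems in auto)
  also have "\<dots> = \<psi> ((x, y, f), (d, c, ?v(i := xor (?v i) (l (exchange d0 i d) x c)), e, t, g))"
    by (rule run_load_step) (use Cons.prems v in \<open>auto simp: S_def\<close>)
  also have "?v(i := xor (?v i) (l (exchange d0 i d) x c)) = xor_table (i # ys) d x c v"
    using Cons.prems(1) by (auto simp: xor_table_def fun_eq_iff)
  finally show ?case .
qed

end

context bayes_registers
begin

definition lik_table :: "control \<Rightarrow> real \<Rightarrow> real \<Rightarrow> nat" where
  "lik_table c x = (\<lambda>i\<in>Y. l i x c)"

text \<open>The state that enters the Grover steps, without the uniform amplitude of the counter. In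
  the branch \<open>g = 1\<close> it carries the deviation amplitudes, in the branch
  \<open>g = 0\<close> the remaining norm.\<close>

definition mid_state :: "control \<Rightarrow> (real \<Rightarrow> (real \<Rightarrow> nat) \<Rightarrow> real \<Rightarrow> real) \<Rightarrow> spectators \<Rightarrow> core \<Rightarrow> complex" where
  "mid_state c amp = (\<lambda>(d, c', v, e, t, g) (x, y, f).
     if f = 1 \<and> e = d0 \<and> c' = c \<and> v = zero_table \<and> y = l d x c'
     then complex_of_real (sqrt (P x) * complete_vec Y d0 (amp x (lik_table c x)) (d, g)) else 0)"

lemma xor_eq_zero_iff: "xor m k = (0::nat) \<longleftrightarrow> m = k"
  by (metis xor.assoc xor.left_neutral xor_self_eq xor.right_neutral)

lemma xor_table_eq_zero:
  assumes "set ys = Y" "v \<in> tables"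
  shows "xor_table ys d0 x c v = zero_table \<longleftrightarrow> v = lik_table c x"
proof -
  have ext: "v i = undefined" if "i \<notin> Y" for i using assms that by (auto simp: tables_def)
  have "xor_table ys d0 x c v = zero_table \<longleftrightarrow> (\<forall>i\<in>Y. xor (v i) (l i x c) = 0)"
    using assms(1) ext by (auto simp: xor_table_def zero_table_def fun_eq_iff exchange_apply restrict_def)
  also have "\<dots> \<longleftrightarrow> v = lik_table c x"
    using ext by (auto simp: xor_eq_zero_iff lik_table_def fun_eq_iff restrict_def)
  finally show ?thesis .
qed

lemma xor_table_zero: "set ys = Y \<Longrightarrow> xor_table ys d0 x c zero_table = lik_table c x"
  by (auto simp: xor_table_def zero_table_def lik_table_def fun_eq_iff exchange_apply)

lemma xor_table_eq_lik_table:
  assumes "set ys = Y" "v \<in> tables"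
  shows "xor_table ys d0 x c v = lik_table c x \<longleftrightarrow> v = zero_table"
proof -
  have ext: "v i = undefined" if "i \<notin> Y" for i using assms that by (auto simp: tables_def)
  have "xor m k = k \<longleftrightarrow> m = 0" for m k :: nat
    by (metis xor.assoc xor.left_neutral xor_self_eq xor.right_neutral)
  then have "xor_table ys d0 x c v = lik_table c x \<longleftrightarrow> (\<forall>i\<in>Y. v i = 0)"
    using assms(1) ext by (auto simp: xor_table_def lik_table_def fun_eq_iff exchange_apply restrict_def)
  also have "\<dots> \<longleftrightarrow> v = zero_table"
    using ext by (auto simp: zero_table_def fun_eq_iff restrict_def)
  finally show ?thesis .
qed

lemma xor_table_in:
  assumes "set ys \<subseteq> Y" "d \<in> Y" "x \<in> X" "c \<in> K" "v \<in> tables"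
  shows "xor_table ys d x c v \<in> tables"
proof -
  have "xor (v j) (l (exchange d0 j d) x c) < 2 ^ (b + 1)" if "j \<in> set ys" for j
    by (rule xor_l) (use assms that d0 in \<open>auto simp: tables_def intro!: exchange_in\<close>)
  then show ?thesis using assms by (auto simp: tables_def xor_table_def PiE_iff extensional_def)
qed

text \<open>One intermediate state per gate or table load. The second load clears the table because
  \<open>x\<close> and the outcome register are as they were during the first. Only then is the
  chosen outcome swapped into the register on which likelihood queries depend, so that the last
  query writes its likelihood.\<close>

lemma run_preparation:
  assumes ys: "distinct ys" "set ys = Y" and cr: "cr \<in> K" and c: "c \<in> K"
    and a: "((x, y, f), (d, c', v, e, t, g)) \<in> Z \<times> S"
  shows "run ([Apply (perm_op (exchange (root cr) ((x0, 0, 1), (d0, c, zero_table, d0, 0, 0)))), Prior] @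
     load_table ys @ [Apply (outcome_prep Y d0 amp)] @ load_table ys @
     [Apply (perm_op outcome_swap), Likelihood, Apply (counter_prep n)]) (unit_at (root cr)) ((x, y, f), (d, c', v, e, t, g))
   = complex_of_real (1 / sqrt (real n)) * mid_state c amp (d, c', v, e, t, g) (x, y, f)"
proof -
  let ?init = "((x0, 0, 1), (d0, c, zero_table, d0, 0, 0)) :: core \<times> spectators"
  have init: "?init \<in> Z \<times> S" using init_in[OF c d0, of 1] by simp
  define \<psi>0 where "\<psi>0 = mapply (Z \<times> S) (reg_op (Apply (perm_op (exchange (root cr) ?init)))) (unit_at (root cr))"
  define \<psi>1 where "\<psi>1 = mapply (Z \<times> S) (reg_op Prior) \<psi>0"
  define \<psi>2 where "\<psi>2 = run (load_table ys) \<psi>1"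
  define \<psi>3 where "\<psi>3 = mapply (Z \<times> S) (outcome_prep Y d0 amp) \<psi>2"
  define \<psi>4 where "\<psi>4 = run (load_table ys) \<psi>3"
  define \<psi>5 where "\<psi>5 = mapply (Z \<times> S) (perm_op outcome_swap) \<psi>4"
  define \<psi>6 where "\<psi>6 = mapply (Z \<times> S) (reg_op Likelihood) \<psi>5"
  define \<psi>7 where "\<psi>7 = mapply (Z \<times> S) (counter_prep n) \<psi>6"
  have s0: "\<psi>0 a = unit_at ?init a" if "a \<in> Z \<times> S" for a
    unfolding \<psi>0_def by (rule mapply_exchange[OF that root_in[OF cr] init])
  have s1: "\<psi>1 ((x, y, f), (d, c', v, e, t, g)) = (if y = 0 \<and> f = 1 \<and> d = d0 \<and> c' = c \<and> v = zero_table \<and> e = d0 \<and> t = 0 \<and> g = 0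
      then complex_of_real (sqrt (P x)) else 0)"
    if m: "((x, y, f), (d, c', v, e, t, g)) \<in> Z \<times> S" for x y f d c' v e t g
  proof -
    have "\<psi>1 ((x, y, f), (d, c', v, e, t, g)) = (\<Sum>x'\<in>X. V x x' * \<psi>0 ((x', y, f), (d, c', v, e, t, g)))"
      unfolding \<psi>1_def by (rule mapply_prior[OF m])
    also have "\<dots> = (\<Sum>x'\<in>X. V x x' * unit_at ?init ((x', y, f), (d, c', v, e, t, g)))"
      by (intro sum.cong refl arg_cong2[where f="(*)"] s0) (use m in \<open>auto simp: Z_def\<close>)
    also have "\<dots> = (\<Sum>x'\<in>X. if x' = x0 then (if y = 0 \<and> f = 1 \<and> d = d0 \<and> c' = c \<and> v = zero_table \<and> e = d0 \<and> t = 0 \<and> g = 0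
      then V x x0 else 0) else 0)"
      by (intro sum.cong refl) (auto simp: unit_at_def)
    also have "\<dots> = (if y = 0 \<and> f = 1 \<and> d = d0 \<and> c' = c \<and> v = zero_table \<and> e = d0 \<and> t = 0 \<and> g = 0
      then complex_of_real (sqrt (P x)) else 0)"
      using finX x0 m VP by (auto simp: Z_def)
    finally show ?thesis .
  qed
  have s2: "\<psi>2 ((x, y, f), (d, c', v, e, t, g)) = (if y = 0 \<and> f = 1 \<and> d = d0 \<and> c' = c \<and> v = lik_table c x \<and> e = d0 \<and> t = 0 \<and> g = 0
      then complex_of_real (sqrt (P x)) else 0)"
    if m: "((x, y, f), (d, c', v, e, t, g)) \<in> Z \<times> S" for x y f d c' v e t g
  proof -
    have m': "((x, y, f), (d, c', xor_table ys d x c' v, e, t, g)) \<in> Z \<times> S"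
      using m xor_table_in[of ys d x c' v] ys by (auto simp: Z_def S_def)
    have v: "v \<in> tables" using m by (simp add: S_def)
    have "\<psi>2 ((x, y, f), (d, c', v, e, t, g)) = \<psi>1 ((x, y, f), (d, c', xor_table ys d x c' v, e, t, g))"
      unfolding \<psi>2_def by (rule run_load_table[OF ys(1) _ m]) (use ys in simp)
    also have "\<dots> = (if y = 0 \<and> f = 1 \<and> d = d0 \<and> c' = c \<and> v = lik_table c x \<and> e = d0 \<and> t = 0 \<and> g = 0
      then complex_of_real (sqrt (P x)) else 0)"
      unfolding s1[OF m'] using xor_table_eq_zero[OF ys(2) v, of x c] by (cases "d = d0 \<and> c' = c") auto
    finally show ?thesis .
  qed
  have s3: "\<psi>3 ((x, y, f), (d, c', v, e, t, g)) = (if y = 0 \<and> f = 1 \<and> d = d0 \<and> c' = c \<and> v = lik_table c x \<and> t = 0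
      then complex_of_real (sqrt (P x) * complete_vec Y d0 (amp x v) (e, g)) else 0)"
    if m: "((x, y, f), (d, c', v, e, t, g)) \<in> Z \<times> S" for x y f d c' v e t g
  proof -
    let ?H = "prep_op (Y \<times> {..<2}) (d0, 0) (complete_vec Y d0 (amp x v))"
    have "\<psi>3 ((x, y, f), (d, c', v, e, t, g)) = (\<Sum>i\<in>Y \<times> {..<2}. ?H (e, g) i * \<psi>2 ((x, y, f), (d, c', v, fst i, t, snd i)))"
      unfolding \<psi>3_def by (rule mapply_outcome_prep(1)[OF m])
    also have "\<dots> = (\<Sum>i\<in>Y \<times> {..<2}. if i = (d0, 0::nat) then ?H (e, g) (d0, 0) * (if y = 0 \<and> f = 1 \<and> d = d0 \<and> c' = c \<and> v = lik_table c x \<and> t = 0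
      then complex_of_real (sqrt (P x)) else 0) else 0)"
    proof (intro sum.cong refl)
      fix i :: "real \<times> nat" assume i: "i \<in> Y \<times> {..<2}"
      have m': "((x, y, f), (d, c', v, fst i, t, snd i)) \<in> Z \<times> S" using m i by (auto simp: S_def)
      show "?H (e, g) i * \<psi>2 ((x, y, f), (d, c', v, fst i, t, snd i)) = (if i = (d0, 0::nat) then ?H (e, g) (d0, 0) * (if y = 0 \<and> f = 1 \<and> d = d0 \<and> c' = c \<and> v = lik_table c x \<and> t = 0
      then complex_of_real (sqrt (P x)) else 0) else 0)"
        unfolding s2[OF m'] by (cases i) auto
    qed
    also have "\<dots> = ?H (e, g) (d0, 0) * (if y = 0 \<and> f = 1 \<and> d = d0 \<and> c' = c \<and> v = lik_table c x \<and> t = 0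
      then complex_of_real (sqrt (P x)) else 0)"
      using finY d0 by simp
    also have "?H (e, g) (d0, 0) = complex_of_real (complete_vec Y d0 (amp x v) (e, g))"
      by (rule prep_op(2)) (use finY d0 m complete_vec_unit in \<open>auto simp: S_def\<close>)
    finally show ?thesis by simp
  qed
  have s4: "\<psi>4 ((x, y, f), (d, c', v, e, t, g)) = (if y = 0 \<and> f = 1 \<and> d = d0 \<and> c' = c \<and> v = zero_table \<and> t = 0
      then complex_of_real (sqrt (P x) * complete_vec Y d0 (amp x (lik_table c x)) (e, g)) else 0)"
    if m: "((x, y, f), (d, c', v, e, t, g)) \<in> Z \<times> S" for x y f d c' v e t g
  proof -
    have m': "((x, y, f), (d, c', xor_table ys d x c' v, e, t, g)) \<in> Z \<times> S"
      using m xor_table_in[of ys d x c' v] ys by (auto simp: Z_def S_def)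
    have v: "v \<in> tables" using m by (simp add: S_def)
    have "\<psi>4 ((x, y, f), (d, c', v, e, t, g)) = \<psi>3 ((x, y, f), (d, c', xor_table ys d x c' v, e, t, g))"
      unfolding \<psi>4_def by (rule run_load_table[OF ys(1) _ m]) (use ys in simp)
    also have "\<dots> = (if y = 0 \<and> f = 1 \<and> d = d0 \<and> c' = c \<and> v = zero_table \<and> t = 0
      then complex_of_real (sqrt (P x) * complete_vec Y d0 (amp x (lik_table c x)) (e, g)) else 0)"
      unfolding s3[OF m'] using xor_table_eq_lik_table[OF ys(2) v, of x c] xor_table_zero[OF ys(2), of x c]
      by (cases "d = d0 \<and> c' = c \<and> v = zero_table") auto
    finally show ?thesis .
  qed
  have s5: "\<psi>5 ((x, y, f), (d, c', v, e, t, g)) = (if y = 0 \<and> f = 1 \<and> e = d0 \<and> c' = c \<and> v = zero_table \<and> t = 0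
      then complex_of_real (sqrt (P x) * complete_vec Y d0 (amp x (lik_table c x)) (d, g)) else 0)"
    if m: "((x, y, f), (d, c', v, e, t, g)) \<in> Z \<times> S" for x y f d c' v e t g
  proof -
    have m': "((x, y, f), (e, c', v, d, t, g)) \<in> Z \<times> S" using m by (auto simp: S_def)
    have "\<psi>5 ((x, y, f), (d, c', v, e, t, g)) = \<psi>4 (outcome_swap ((x, y, f), (d, c', v, e, t, g)))"
      unfolding \<psi>5_def by (rule mapply_perm[OF finites(4) m]) (rule outcome_swap_in outcome_swap_involution; assumption)+
    then show ?thesis using s4[OF m'] by simp
  qed
  have s6: "\<psi>6 ((x, y, f), (d, c', v, e, t, g)) = (if t = 0 then mid_state c amp (d, c', v, e, t, g) (x, y, f) else 0)"
    if m: "((x, y, f), (d, c', v, e, t, g)) \<in> Z \<times> S" for x y f d c' v e t g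
  proof -
    have m': "((x, xor y (l d x c'), f), (d, c', v, e, t, g)) \<in> Z \<times> S"
      using lik_perm_in[of "(x, y, f)" "(d, c', v, e, t, g)"] m by (simp add: lik_perm_def)
    have "\<psi>6 ((x, y, f), (d, c', v, e, t, g)) = \<psi>5 ((x, xor y (l d x c'), f), (d, c', v, e, t, g))"
      unfolding \<psi>6_def by (rule mapply_likelihood[OF m])
    then show ?thesis unfolding s5[OF m'] by (auto simp: mid_state_def xor_eq_zero_iff)
  qed
  have s7: "\<psi>7 ((x, y, f), (d, c', v, e, t, g)) = complex_of_real (1 / sqrt (real n)) * mid_state c amp (d, c', v, e, t, g) (x, y, f)"
  proof -
    have "\<psi>7 ((x, y, f), (d, c', v, e, t, g))
      = (\<Sum>t'<n. prep_op {..<n} 0 (\<lambda>_. 1 / sqrt (real n)) t t' * \<psi>6 ((x, y, f), (d, c', v, e, t', g)))"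
      unfolding \<psi>7_def by (rule mapply_counter_prep(1)[OF a])
    also have "\<dots> = (\<Sum>t'<n. if t' = 0 then prep_op {..<n} 0 (\<lambda>_. 1 / sqrt (real n)) t 0 * mid_state c amp (d, c', v, e, 0, g) (x, y, f) else 0)"
    proof (intro sum.cong refl)
      fix t' assume "t' \<in> {..<n}"
      then have m': "((x, y, f), (d, c', v, e, t', g)) \<in> Z \<times> S" using a by (auto simp: S_def)
      show "prep_op {..<n} 0 (\<lambda>_. 1 / sqrt (real n)) t t' * \<psi>6 ((x, y, f), (d, c', v, e, t', g))
        = (if t' = 0 then prep_op {..<n} 0 (\<lambda>_. 1 / sqrt (real n)) t 0 * mid_state c amp (d, c', v, e, 0, g) (x, y, f) else 0)"
        unfolding s6[OF m'] by simp
    qed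
    also have "\<dots> = prep_op {..<n} 0 (\<lambda>_. 1 / sqrt (real n)) t 0 * mid_state c amp (d, c', v, e, 0, g) (x, y, f)"
      using n by simp
    also have "prep_op {..<n} 0 (\<lambda>_. 1 / sqrt (real n)) t 0 = complex_of_real (1 / sqrt (real n))"
      by (rule prep_op(2)) (use n a counter_vec_unit in \<open>auto simp: S_def\<close>)
    finally show ?thesis by (simp add: mid_state_def)
  qed
  show ?thesis
    using s7 unfolding \<psi>7_def \<psi>6_def \<psi>5_def \<psi>4_def \<psi>3_def \<psi>2_def \<psi>1_def \<psi>0_def
    by (simp only: run_simps reg_op.simps)
qed

text \<open>A linear combination of unitaries with equal weights: preparing the counter uniformly
  and selecting the value 0 after undoing the preparation contributes \<open>1 / sqrt n\<close>
  twice.\<close>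

definition averaged_state :: "control \<Rightarrow> (real \<Rightarrow> (real \<Rightarrow> nat) \<Rightarrow> real \<Rightarrow> real) \<Rightarrow> (real \<Rightarrow> nat \<Rightarrow> real) \<Rightarrow> spectators \<Rightarrow> core \<Rightarrow> complex" where
  "averaged_state c amp q s z =
     (\<Sum>t<n. (grover_step Z raised (core_state q s) ^^ t) (mid_state c amp s) z) / of_nat n"

lemma core_state_counter: "core_state q (d, c, v, e, t, g) = core_state q (d, c, v, e, t', g)"
proof -
  have "lik_perm l (d, c, v, e, t, g) = lik_perm l (d, c, v, e, t', g)" by (simp add: lik_perm_def fun_eq_iff)
  then show ?thesis by (simp add: core_state_def core_ops_def)
qed

lemma mid_state_counter: "mid_state c amp (d, c', v, e, t, g) = mid_state c amp (d, c', v, e, t', g)"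
  by (simp add: mid_state_def)

lemma run_variance_circuit:
  assumes q: "\<And>x y. 0 \<le> q x y" "\<And>x y. q x y \<le> 1"
    and ys: "distinct ys" "set ys = Y" and cr: "cr \<in> K" and c: "c \<in> K"
    and z: "z \<in> Z" and s: "(d, c', v, e, 0, g) \<in> S"
  shows "run (variance_circuit cr c ys amp q) (unit_at (root cr)) (z, (d, c', v, e, 0, g))
    = averaged_state c amp q (d, c', v, e, 0, g) z"
proof -
  let ?prep = "[Apply (perm_op (exchange (root cr) ((x0, 0, 1), (d0, c, zero_table, d0, 0, 0)))), Prior] @
     load_table ys @ [Apply (outcome_prep Y d0 amp)] @ load_table ys @
     [Apply (perm_op outcome_swap), Likelihood, Apply (counter_prep n)]"
  let ?s = "(d, c', v, e, 0, g)"
  let ?G = "grover_step Z raised (core_state q ?s)"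
  define \<psi> where "\<psi> = run ?prep (unit_at (root cr))"
  define \<xi> where "\<xi> = run (concat (map (counted_grover q) [1..<n])) \<psi>"
  have \<xi>: "\<xi> (z, (d, c', v, e, t, g)) = complex_of_real (1 / sqrt (real n)) * (?G ^^ t) (mid_state c amp ?s) z" if "t < n" for t
  proof -
    have st: "(d, c', v, e, t, g) \<in> S" using s that by (auto simp: S_def)
    define m where "m = n - 1"
    have m: "n = Suc m" using n by (simp add: m_def)
    have "\<xi> (z, (d, c', v, e, t, g)) = (grover_step Z raised (core_state q (d, c', v, e, t, g)) ^^ min m t) (\<lambda>z. \<psi> (z, (d, c', v, e, t, g))) z"
      using run_concat_grover[where q=q and m=m, OF q z st, of \<psi>] unfolding m[symmetric] \<xi>_def .
    also have "\<dots> = (?G ^^ t) (\<lambda>z. \<psi> (z, (d, c', v, e, t, g))) z"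
      using that m core_state_counter[of q d c' v e t g 0] by simp
    also have "\<dots> = (?G ^^ t) (\<lambda>z. complex_of_real (1 / sqrt (real n)) * mid_state c amp ?s z) z"
    proof (rule grover_pow_cong[OF _ z])
      fix w assume w: "w \<in> Z"
      obtain x y f where ww: "w = (x, y, f)" by (metis prod.exhaust)
      show "\<psi> (w, (d, c', v, e, t, g)) = complex_of_real (1 / sqrt (real n)) * mid_state c amp ?s w"
        unfolding \<psi>_def ww mid_state_counter[of c amp d c' v e 0 g t]
        by (rule run_preparation[OF ys cr c]) (use w st in \<open>simp add: ww\<close>)
    qed
    also have "\<dots> = complex_of_real (1 / sqrt (real n)) * (?G ^^ t) (mid_state c amp ?s) z"
      unfolding grover_pow_scale ..
    finally show ?thesis .
  qed
  have "run (variance_circuit cr c ys amp q) (unit_at (root cr)) (z, ?s) = mapply (Z \<times> S) (adjoint_op (counter_prep n)) \<xi> (z, ?s)"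
    unfolding variance_circuit_def \<xi>_def \<psi>_def by simp
  also have "\<dots> = (\<Sum>t<n. cnj (prep_op {..<n} 0 (\<lambda>_. 1 / sqrt (real n)) t 0) * \<xi> (z, (d, c', v, e, t, g)))"
    by (rule mapply_counter_prep(2)) (use z s in simp)
  also have "\<dots> = (\<Sum>t<n. (?G ^^ t) (mid_state c amp ?s) z / of_nat n)"
  proof (intro sum.cong refl)
    fix t assume t: "t \<in> {..<n}"
    have "prep_op {..<n} 0 (\<lambda>_. 1 / sqrt (real n)) t 0 = complex_of_real (1 / sqrt (real n))"
      by (rule prep_op(2)) (use n t counter_vec_unit in auto)
    then have "cnj (prep_op {..<n} 0 (\<lambda>_. 1 / sqrt (real n)) t 0) * \<xi> (z, (d, c', v, e, t, g))
      = complex_of_real (1 / sqrt (real n)) * complex_of_real (1 / sqrt (real n)) * (?G ^^ t) (mid_state c amp ?s) z"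
      using \<xi>[of t] t by (simp only: complex_cnj_complex_of_real mult.assoc lessThan_iff)
    also have "complex_of_real (1 / sqrt (real n)) * complex_of_real (1 / sqrt (real n)) = complex_of_real (1 / real n)"
      unfolding of_real_mult[symmetric] using n by (intro arg_cong[where f=complex_of_real]) (simp add: field_simps)
    finally show "cnj (prep_op {..<n} 0 (\<lambda>_. 1 / sqrt (real n)) t 0) * \<xi> (z, (d, c', v, e, t, g)) = (?G ^^ t) (mid_state c amp ?s) z / of_nat n"
      by simp
  qed
  finally show ?thesis by (simp add: averaged_state_def sum_divide_distrib)
qed

lemma averaged_state_zero:
  assumes "e \<noteq> d0 \<or> c' \<noteq> c \<or> v \<noteq> zero_table"
  shows "averaged_state c amp q (d, c', v, e, t, g) z = 0"
proof -
  have "mid_state c amp (d, c', v, e, t, g) = (\<lambda>z. 0)" using assms by (auto simp: mid_state_def fun_eq_iff)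
  then show ?thesis by (simp add: averaged_state_def grover_pow_zero)
qed

text \<open>Success means that the counter has returned to 0 and that \<open>g\<close> marks the
  deviation branch. The outcome register is a spectator of the Grover steps, so the outcomes
  contribute orthogonal vectors whose squared norms add up.\<close>

lemma variance_success:
  assumes q: "\<And>x y. 0 \<le> q x y" "\<And>x y. q x y \<le> 1"
    and ys: "distinct ys" "set ys = Y" and cr: "cr \<in> K" and c: "c \<in> K"
  shows "query_model.success_prob Bs V (lik_op l) (J (root cr)) (circuit (variance_circuit cr c ys amp q))
      (on_registers (\<lambda>(z, (d, c, v, e, t, g)). t = 0 \<and> g = 1))
    = (\<Sum>d\<in>Y. norm2_on Z (averaged_state c amp q (d, c, zero_table, d0, 0, 1)))"
proof -
  let ?p = "\<lambda>(z::core, (d::real, c::control, v::real \<Rightarrow> nat, e::real, t::nat, g::nat)). t = 0 \<and> g = 1"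
  let ?ps = "\<lambda>(d::real, c::control, v::real \<Rightarrow> nat, e::real, t::nat, g::nat). t = 0 \<and> g = 1"
  let ?r = "run (variance_circuit cr c ys amp q) (unit_at (root cr))"
  have "query_model.success_prob Bs V (lik_op l) (J (root cr)) (circuit (variance_circuit cr c ys amp q)) (on_registers ?p)
    = (\<Sum>a | a \<in> Z \<times> S \<and> ?p a. (cmod (?r a))\<^sup>2)"
    by (rule success_prob_circuit[OF cr])
  also have "\<dots> = (\<Sum>a\<in>Z \<times> {s \<in> S. ?ps s}. (cmod (?r a))\<^sup>2)"
    by (intro sum.cong) auto
  also have "\<dots> = (\<Sum>z\<in>Z. \<Sum>s | s \<in> S \<and> ?ps s. (cmod (?r (z, s)))\<^sup>2)"
    by (simp add: sum.cartesian_product case_prod_beta)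
  also have "\<dots> = (\<Sum>z\<in>Z. \<Sum>s | s \<in> S \<and> ?ps s. (cmod (averaged_state c amp q s z))\<^sup>2)"
  proof (intro sum.cong refl)
    fix z s assume m: "z \<in> Z" "s \<in> {s. s \<in> S \<and> ?ps s}"
    obtain d c' v e t g where s: "s = (d, c', v, e, t, g)" by (metis prod.exhaust)
    show "(cmod (?r (z, s)))\<^sup>2 = (cmod (averaged_state c amp q s z))\<^sup>2"
      using run_variance_circuit[where q=q, OF q ys cr c m(1), of d c' v e g amp] m(2) by (auto simp: s)
  qed
  also have "\<dots> = (\<Sum>z\<in>Z. \<Sum>s\<in>(\<lambda>d. (d, c, zero_table, d0, 0, 1)) ` Y. (cmod (averaged_state c amp q s z))\<^sup>2)"
  proof (rule sum.cong[OF refl], rule sum.mono_neutral_right)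
    fix z
    show "finite {s. s \<in> S \<and> ?ps s}" by simp
    show "(\<lambda>d. (d, c, zero_table, d0, 0, 1)) ` Y \<subseteq> {s. s \<in> S \<and> ?ps s}"
      using c zero_table d0 n by (auto simp: S_def)
    show "\<forall>s\<in>{s. s \<in> S \<and> ?ps s} - (\<lambda>d. (d, c, zero_table, d0, 0, 1)) ` Y. (cmod (averaged_state c amp q s z))\<^sup>2 = 0"
    proof
      fix s assume s: "s \<in> {s. s \<in> S \<and> ?ps s} - (\<lambda>d. (d, c, zero_table, d0, 0, 1)) ` Y"
      obtain d c' v e t g where ss: "s = (d, c', v, e, t, g)" by (metis prod.exhaust)
      have "e \<noteq> d0 \<or> c' \<noteq> c \<or> v \<noteq> zero_table" using s by (auto simp: ss S_def image_iff)
      then show "(cmod (averaged_state c amp q s z))\<^sup>2 = 0" by (simp add: ss averaged_state_zero)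
    qed
  qed
  also have "\<dots> = (\<Sum>z\<in>Z. \<Sum>d\<in>Y. (cmod (averaged_state c amp q (d, c, zero_table, d0, 0, 1) z))\<^sup>2)"
    by (intro sum.cong refl) (subst sum.reindex, auto simp: inj_on_def)
  also have "\<dots> = (\<Sum>d\<in>Y. norm2_on Z (averaged_state c amp q (d, c, zero_table, d0, 0, 1)))"
    unfolding norm2_on_def by (rule sum.swap)
  finally show ?thesis .
qed

end

section \<open>Weighted variances\<close>

definition wmean :: "real set \<Rightarrow> (real \<Rightarrow> real) \<Rightarrow> real" where
  "wmean X w = (\<Sum>x\<in>X. w x * x) / (\<Sum>x\<in>X. w x)"

definition spread :: "real set \<Rightarrow> (real \<Rightarrow> real) \<Rightarrow> real" where
  "spread X w = (\<Sum>x\<in>X. w x * (x - wmean X w)\<^sup>2)"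

text \<open>The product form also holds for total weight 0, where the quotient is 0 by convention;
  outcomes without evidence thus need no separate treatment.\<close>

lemma wmean_mult:
  assumes "finite X" "\<And>x. x \<in> X \<Longrightarrow> 0 \<le> w x"
  shows "wmean X w * (\<Sum>x\<in>X. w x) = (\<Sum>x\<in>X. w x * x)"
proof (cases "(\<Sum>x\<in>X. w x) = 0")
  case True
  then have "\<forall>x\<in>X. w x = 0" using assms by (simp add: sum_nonneg_eq_0_iff)
  then show ?thesis by simp
qed (simp add: wmean_def)

text \<open>The parallel axis theorem: the mixed term vanishes at the mean.\<close>

lemma sum_weighted_square:
  assumes "finite X" "\<And>x. x \<in> X \<Longrightarrow> 0 \<le> w x"
  shows "(\<Sum>x\<in>X. w x * (x - m)\<^sup>2) = spread X w + (\<Sum>x\<in>X. w x) * (wmean X w - m)\<^sup>2"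
proof -
  have "(\<Sum>x\<in>X. w x * (x - m)\<^sup>2) = (\<Sum>x\<in>X. w x * (x - wmean X w)\<^sup>2 + 2 * (wmean X w - m) * (w x * x)
      - 2 * (wmean X w - m) * wmean X w * w x + w x * (wmean X w - m)\<^sup>2)"
    by (intro sum.cong refl) (simp add: power2_eq_square algebra_simps)
  also have "\<dots> = spread X w + 2 * (wmean X w - m) * (\<Sum>x\<in>X. w x * x)
      - 2 * (wmean X w - m) * (wmean X w * (\<Sum>x\<in>X. w x)) + (\<Sum>x\<in>X. w x) * (wmean X w - m)\<^sup>2"
    by (simp add: sum.distrib sum_subtractf spread_def sum_distrib_left sum_distrib_right mult_ac)
  also have "\<dots> = spread X w + (\<Sum>x\<in>X. w x) * (wmean X w - m)\<^sup>2"
    by (simp add: wmean_mult[of X w, OF assms])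
  finally show ?thesis .
qed

lemma spread_le:
  assumes "finite X" "\<And>x. x \<in> X \<Longrightarrow> 0 \<le> w x"
  shows "spread X w \<le> (\<Sum>x\<in>X. w x * (x - m)\<^sup>2)"
  using sum_weighted_square[of X w m, OF assms] sum_nonneg[of X w] assms(2) by simp

lemma wmean_unit:
  assumes "finite X" "\<And>x. x \<in> X \<Longrightarrow> 0 \<le> w x" "\<And>x. x \<in> X \<Longrightarrow> w x \<noteq> 0 \<Longrightarrow> x \<in> {0..1}"
  shows "wmean X w \<in> {0..1}"
proof -
  have wx: "0 \<le> w x * x \<and> w x * x \<le> w x" if "x \<in> X" for x
    using assms(2,3)[OF that] by (cases "w x = 0") (auto simp: mult_left_le)
  have "0 \<le> (\<Sum>x\<in>X. w x * x)" "(\<Sum>x\<in>X. w x * x) \<le> (\<Sum>x\<in>X. w x)"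
    using wx by (auto intro: sum_nonneg sum_mono)
  then show ?thesis using sum_nonneg[of X w] assms(2) by (auto simp: wmean_def divide_le_eq_1)
qed

lemma spread_nonneg: "(\<And>x. x \<in> X \<Longrightarrow> 0 \<le> w x) \<Longrightarrow> 0 \<le> spread X w"
  unfolding spread_def by (intro sum_nonneg mult_nonneg_nonneg) auto

text \<open>The mean of \<open>w'\<close> is tried as a centre for \<open>w\<close>: the mean of
  \<open>w\<close> can only do better, and all points that carry weight are within distance 1 of the
  trial centre.\<close>

lemma spread_perturb_le:
  assumes "finite X" "\<And>x. x \<in> X \<Longrightarrow> 0 \<le> w x" "\<And>x. x \<in> X \<Longrightarrow> 0 \<le> w' x"
    and "\<And>x. x \<in> X \<Longrightarrow> w x \<noteq> 0 \<or> w' x \<noteq> 0 \<Longrightarrow> x \<in> {0..1}"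
  shows "spread X w \<le> spread X w' + (\<Sum>x\<in>X. \<bar>w x - w' x\<bar>)"
proof -
  let ?m = "wmean X w'"
  have m: "?m \<in> {0..1}" by (rule wmean_unit) (use assms in auto)
  have "spread X w \<le> (\<Sum>x\<in>X. w x * (x - ?m)\<^sup>2)" by (rule spread_le) (use assms in auto)
  also have "\<dots> \<le> (\<Sum>x\<in>X. w' x * (x - ?m)\<^sup>2 + \<bar>w x - w' x\<bar>)"
  proof (rule sum_mono)
    fix x assume x: "x \<in> X"
    show "w x * (x - ?m)\<^sup>2 \<le> w' x * (x - ?m)\<^sup>2 + \<bar>w x - w' x\<bar>"
    proof (cases "w x = 0 \<and> w' x = 0")
      case False
      then have "x \<in> {0..1}" using assms(4) x by auto
      then have "\<bar>x - ?m\<bar> \<le> 1" using m by auto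
      then have 1: "(x - ?m)\<^sup>2 \<le> 1" by (simp add: abs_square_le_1)
      have "(w x - w' x) * (x - ?m)\<^sup>2 \<le> \<bar>w x - w' x\<bar> * (x - ?m)\<^sup>2" by (intro mult_right_mono) auto
      also have "\<dots> \<le> \<bar>w x - w' x\<bar> * 1" using 1 by (intro mult_left_mono) auto
      finally show ?thesis by (simp add: algebra_simps)
    qed simp
  qed
  also have "\<dots> = spread X w' + (\<Sum>x\<in>X. \<bar>w x - w' x\<bar>)" by (simp add: sum.distrib spread_def)
  finally show ?thesis .
qed

text \<open>The posterior mean is the mean for the joint weights \<open>P x * L d x c\<close>, since
  normalising by the evidence cancels. The utility thus becomes a sum over outcomes in which nothing
  is normalised.\<close>

lemma utility_spread:
  assumes "finite X" "finite Y"
  shows "utility X Y P L c = - (\<Sum>d\<in>Y. spread X (\<lambda>x. P x * L d x c))"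
proof -
  have m: "(\<Sum>x'\<in>X. posterior X P L c d x' * x') = wmean X (\<lambda>x. P x * L d x c)" for d
    by (simp add: posterior_def evidence_def wmean_def sum_divide_distrib mult.commute)
  have "(\<Sum>x\<in>X. P x * (\<Sum>d\<in>Y. L d x c * (x - (\<Sum>x'\<in>X. posterior X P L c d x' * x'))\<^sup>2))
    = (\<Sum>x\<in>X. \<Sum>d\<in>Y. P x * L d x c * (x - wmean X (\<lambda>x. P x * L d x c))\<^sup>2)"
    by (simp add: m sum_distrib_left mult.assoc)
  also have "\<dots> = (\<Sum>d\<in>Y. spread X (\<lambda>x. P x * L d x c))"
    unfolding spread_def by (rule sum.swap)
  finally show ?thesis by (simp add: utility_def)
qed

section \<open>The success probability of the variance circuit\<close>

definition lik_fraction :: "nat \<Rightarrow> real \<Rightarrow> nat \<Rightarrow> real" where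
  "lik_fraction b x y = min 1 (real y / 2 ^ b)"

text \<open>The factor 1/2 keeps the success probability at or below 1/4, within the range of angles
  up to \<open>pi / 6\<close> on which amplitudes are estimated.\<close>

definition deviation_amp :: "nat \<Rightarrow> (real \<Rightarrow> real) \<Rightarrow> real \<Rightarrow> (real \<Rightarrow> nat) \<Rightarrow> real \<Rightarrow> real" where
  "deviation_amp b \<mu> x v e = sqrt (real (v e) / 2 ^ b) * ((x - \<mu> e) / 2)"

lemma lik_fraction: "0 \<le> lik_fraction b x y" "lik_fraction b x y \<le> 1"
  by (auto simp: lik_fraction_def)

locale unit_bayes_registers = bayes_registers +
  assumes P_sum: "(\<Sum>x\<in>X. P x) = 1" and P_unit: "\<And>x. x \<in> X \<Longrightarrow> P x \<noteq> 0 \<Longrightarrow> x \<in> {0..1}"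
    and l_sum: "\<And>x c. x \<in> X \<Longrightarrow> c \<in> K \<Longrightarrow> (\<Sum>d\<in>Y. l d x c) \<le> 2 ^ b"
begin

definition wt :: "control \<Rightarrow> real \<Rightarrow> real \<Rightarrow> real" where
  "wt c d x = P x * (real (l d x c) / 2 ^ b)"

lemma wt_nonneg: "x \<in> X \<Longrightarrow> 0 \<le> wt c d x"
  using P_nonneg by (simp add: wt_def)

lemma wt_unit: "x \<in> X \<Longrightarrow> wt c d x \<noteq> 0 \<Longrightarrow> x \<in> {0..1}"
  using P_unit by (auto simp: wt_def)

text \<open>Truncation rounds down, so the truncated likelihoods form a subprobability.\<close>

lemma wt_sum_le: "c \<in> K \<Longrightarrow> (\<Sum>d\<in>Y. \<Sum>x\<in>X. wt c d x) \<le> 1"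
proof -
  assume c: "c \<in> K"
  have "(\<Sum>d\<in>Y. \<Sum>x\<in>X. wt c d x) = (\<Sum>x\<in>X. P x * (real (\<Sum>d\<in>Y. l d x c) / 2 ^ b))"
    unfolding wt_def by (subst sum.swap) (simp add: sum_distrib_left sum_divide_distrib)
  also have "\<dots> \<le> (\<Sum>x\<in>X. P x * 1)"
  proof (intro sum_mono mult_left_mono)
    fix x assume x: "x \<in> X"
    have "real (\<Sum>d\<in>Y. l d x c) \<le> real (2 ^ b)" using l_sum[OF x c] by (simp only: of_nat_le_iff)
    then show "real (\<Sum>d\<in>Y. l d x c) / 2 ^ b \<le> 1" by simp
    show "0 \<le> P x" using P_nonneg x .
  qed
  finally show ?thesis using P_sum by simp
qed

text \<open>The relevant core states lie on the graph \<open>y = l d x c\<close> with raised flag,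
  so the latent value determines them.\<close>

lemma sum_core:
  fixes h :: "real \<Rightarrow> 'q :: comm_monoid_add"
  assumes "c \<in> K" "d \<in> Y"
  shows "(\<Sum>z\<in>Z. case z of (x, y, f) \<Rightarrow> if y = l d x c \<and> f = 1 then h x else 0) = (\<Sum>x\<in>X. h x)"
proof -
  have "(\<Sum>z\<in>Z. case z of (x, y, f) \<Rightarrow> if y = l d x c \<and> f = 1 then h x else 0)
    = (\<Sum>a\<in>(\<lambda>x. (x, l d x c, 1::nat)) ` X. h (fst a))"
    by (rule sum.mono_neutral_cong_right) (use finX l_less[OF assms(2) _ assms(1)] in \<open>auto simp: Z_def image_iff simp del: power_Suc power_add\<close>)
  also have "\<dots> = (\<Sum>x\<in>X. h x)" by (subst sum.reindex) (auto simp: inj_on_def)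
  finally show ?thesis .
qed

context
  fixes c :: control and \<mu> :: "real \<Rightarrow> real"
  assumes c: "c \<in> K" and \<mu>: "\<And>d. d \<in> Y \<Longrightarrow> \<mu> d \<in> {0..1}"
begin

abbreviation "spec d \<equiv> (d, c, zero_table, d0, 0, 1) :: spectators"
abbreviation "lstate d \<equiv> core_state (lik_fraction b) (spec d)"

lemma spec_in: "d \<in> Y \<Longrightarrow> spec d \<in> S"
  using c d0 zero_table n by (simp add: S_def)

lemma lik_fraction_l: "d \<in> Y \<Longrightarrow> x \<in> X \<Longrightarrow> lik_fraction b x (l d x c) = real (l d x c) / 2 ^ b"
proof -
  assume "d \<in> Y" "x \<in> X"
  then have "real (l d x c) \<le> real (2 ^ b)" using l_le[of d x c] c by (simp only: of_nat_le_iff)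
  then show ?thesis by (simp add: lik_fraction_def)
qed

lemma sqrt_wt: "sqrt (wt c d x) = sqrt (P x) * sqrt (real (l d x c) / 2 ^ b)"
  unfolding wt_def by (rule real_sqrt_mult)

lemma lstate_raised:
  assumes "d \<in> Y" "(x, y, f) \<in> Z" "f = 1"
  shows "lstate d (x, y, f) = (if y = l d x c then complex_of_real (sqrt (wt c d x)) else 0)"
proof -
  have "x \<in> X" using assms by (simp add: Z_def)
  then show ?thesis
    using core_state[of "lik_fraction b" x y f d c zero_table d0 0 1, OF lik_fraction assms(2) spec_in[OF assms(1)]]
      lik_fraction_l[OF assms(1)] assms(3) by (simp add: flag_vec_def sqrt_wt)
qed

lemma mid_state_value:
  assumes "d \<in> Y" "(x, y, f) \<in> Z"
  shows "mid_state c (deviation_amp b \<mu>) (spec d) (x, y, f)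
    = (if y = l d x c \<and> f = 1 then complex_of_real (sqrt (wt c d x) * ((x - \<mu> d) / 2)) else 0)"
\<comment> \<open>Off the support of the prior \<open>x\<close> may lie outside the unit interval
  and the amplitudes may be too large to be completed; both sides are 0 there.\<close>
proof (cases "P x = 0")
  case True
  then show ?thesis by (simp add: mid_state_def wt_def)
next
  case False
  have x: "x \<in> X" "x \<in> {0..1}" using assms False P_unit by (auto simp: Z_def)
  have v: "lik_table c x i = l i x c" if "i \<in> Y" for i using that by (simp add: lik_table_def)
  have "(\<Sum>e\<in>Y. (deviation_amp b \<mu> x (lik_table c x) e)\<^sup>2) \<le> (\<Sum>e\<in>Y. real (l e x c) / 2 ^ b)"
  proof (rule sum_mono)
    fix e assume e: "e \<in> Y"
    have "\<bar>(x - \<mu> e) / 2\<bar> \<le> 1" using x \<mu>[OF e] by auto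
    then have "((x - \<mu> e) / 2)\<^sup>2 \<le> 1" by (simp only: abs_square_le_1)
    then have "real (l e x c) / 2 ^ b * ((x - \<mu> e) / 2)\<^sup>2 \<le> real (l e x c) / 2 ^ b * 1"
      by (intro mult_left_mono) auto
    moreover have "(deviation_amp b \<mu> x (lik_table c x) e)\<^sup>2 = real (l e x c) / 2 ^ b * ((x - \<mu> e) / 2)\<^sup>2"
      unfolding deviation_amp_def v[OF e] power_mult_distrib by simp
    ultimately show "(deviation_amp b \<mu> x (lik_table c x) e)\<^sup>2 \<le> real (l e x c) / 2 ^ b" by simp
  qed
  also have "\<dots> = real (\<Sum>e\<in>Y. l e x c) / 2 ^ b" by (simp add: sum_divide_distrib)
  also have "\<dots> \<le> 1"
  proof -
    have "real (\<Sum>e\<in>Y. l e x c) \<le> real (2 ^ b)" using l_sum[OF x(1) c] by (simp only: of_nat_le_iff)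
    then show ?thesis by simp
  qed
  finally have "complete_vec Y d0 (deviation_amp b \<mu> x (lik_table c x)) (d, 1) = deviation_amp b \<mu> x (lik_table c x) d"
    by (simp add: complete_vec_def)
  then have e: "sqrt (P x) * complete_vec Y d0 (deviation_amp b \<mu> x (lik_table c x)) (d, 1) = sqrt (wt c d x) * ((x - \<mu> d) / 2)"
    by (simp only: deviation_amp_def v[OF assms(1)] sqrt_wt mult.assoc)
  show ?thesis unfolding mid_state_def prod.case e by simp
qed

definition good_part :: "real \<Rightarrow> core \<Rightarrow> complex" where
  "good_part d = (\<lambda>a. if raised a then lstate d a else 0)"

definition perp_part :: "real \<Rightarrow> core \<Rightarrow> complex" where
  "perp_part d = (\<lambda>(x, y, f). if y = l d x c \<and> f = 1 then complex_of_real (sqrt (wt c d x) * ((x - wmean X (wt c d)) / 2)) else 0)"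

text \<open>\<open>x - \<mu>\<close> is the sum of \<open>x - m\<close> and \<open>m - \<mu>\<close>
  with the mean \<open>m\<close>. The first part is orthogonal to the posterior state and kept by
  the Grover average, the second is a multiple of the good part and nearly annihilated.\<close>

lemma mid_state_decomp:
  assumes "d \<in> Y" "z \<in> Z"
  shows "mid_state c (deviation_amp b \<mu>) (spec d) z
    = perp_part d z + complex_of_real ((wmean X (wt c d) - \<mu> d) / 2) * good_part d z"
proof -
  obtain x y f where z: "z = (x, y, f)" by (metis prod.exhaust)
  show ?thesis
  proof (cases "f = 1")
    case True
    have zz: "(x, y, 1) \<in> Z" using assms True by (simp add: z)
    have g: "good_part d (x, y, f) = (if y = l d x c then complex_of_real (sqrt (wt c d x)) else 0)"
      using lstate_raised[OF assms(1) zz refl] True by (simp add: good_part_def)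
    have "sqrt (wt c d x) * ((x - \<mu> d) / 2) = sqrt (wt c d x) * ((x - wmean X (wt c d)) / 2)
      + (wmean X (wt c d) - \<mu> d) / 2 * sqrt (wt c d x)"
      by (simp add: field_simps)
    then have e: "complex_of_real (sqrt (wt c d x) * ((x - \<mu> d) / 2)) = complex_of_real (sqrt (wt c d x) * ((x - wmean X (wt c d)) / 2))
      + complex_of_real ((wmean X (wt c d) - \<mu> d) / 2) * complex_of_real (sqrt (wt c d x))"
      by (simp only: of_real_add of_real_mult)
    show ?thesis unfolding z mid_state_value[OF assms(1) assms(2)[unfolded z]] g e perp_part_def prod.case
      using True by simp
  next
    case False
    then show ?thesis using mid_state_value[OF assms(1) assms(2)[unfolded z]]
      by (simp add: z good_part_def perp_part_def)
  qed
qed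

lemma norm2_perp_part:
  assumes "d \<in> Y"
  shows "norm2_on Z (perp_part d) = spread X (wt c d) / 4"
proof -
  have "norm2_on Z (perp_part d) = (\<Sum>z\<in>Z. case z of (x, y, f) \<Rightarrow> if y = l d x c \<and> f = 1
      then wt c d x * (x - wmean X (wt c d))\<^sup>2 / 4 else 0)"
    unfolding norm2_on_def
  proof (intro sum.cong refl)
    fix z assume z: "z \<in> Z"
    obtain x y f where zz: "z = (x, y, f)" by (metis prod.exhaust)
    have "0 \<le> wt c d x" using z by (intro wt_nonneg) (simp add: zz Z_def)
    then show "(cmod (perp_part d z))\<^sup>2 = (case z of (x, y, f) \<Rightarrow> if y = l d x c \<and> f = 1
      then wt c d x * (x - wmean X (wt c d))\<^sup>2 / 4 else 0)"
      by (auto simp: zz perp_part_def norm_mult norm_divide power_mult_distrib power_divide simp flip: of_real_diff)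
  qed
  also have "\<dots> = (\<Sum>x\<in>X. wt c d x * (x - wmean X (wt c d))\<^sup>2 / 4)" by (rule sum_core[OF c assms])
  finally show ?thesis by (simp add: spread_def sum_divide_distrib)
qed

lemma norm2_mid_state:
  assumes "d \<in> Y"
  shows "norm2_on Z (mid_state c (deviation_amp b \<mu>) (spec d)) = (\<Sum>x\<in>X. wt c d x * (x - \<mu> d)\<^sup>2) / 4"
proof -
  have "norm2_on Z (mid_state c (deviation_amp b \<mu>) (spec d)) = (\<Sum>z\<in>Z. case z of (x, y, f) \<Rightarrow> if y = l d x c \<and> f = 1
      then wt c d x * (x - \<mu> d)\<^sup>2 / 4 else 0)"
    unfolding norm2_on_def
  proof (intro sum.cong refl)
    fix z assume z: "z \<in> Z"
    obtain x y f where zz: "z = (x, y, f)" by (metis prod.exhaust)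
    have "0 \<le> wt c d x" using z by (intro wt_nonneg) (simp add: zz Z_def)
    then show "(cmod (mid_state c (deviation_amp b \<mu>) (spec d) z))\<^sup>2 = (case z of (x, y, f) \<Rightarrow> if y = l d x c \<and> f = 1
      then wt c d x * (x - \<mu> d)\<^sup>2 / 4 else 0)"
      using mid_state_value[OF assms z[unfolded zz]]
      by (auto simp: zz norm_mult norm_divide power_mult_distrib power_divide simp flip: of_real_diff)
  qed
  also have "\<dots> = (\<Sum>x\<in>X. wt c d x * (x - \<mu> d)\<^sup>2 / 4)" by (rule sum_core[OF c assms])
  finally show ?thesis by (simp add: sum_divide_distrib)
qed

text \<open>The inner product is half of the weighted sum of deviations from the mean.\<close>

lemma perp_part_orthogonal:
  assumes "d \<in> Y"
  shows "inner_on Z (lstate d) (perp_part d) = 0"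
proof -
  have "inner_on Z (lstate d) (perp_part d) = (\<Sum>z\<in>Z. case z of (x, y, f) \<Rightarrow> if y = l d x c \<and> f = 1
      then complex_of_real (wt c d x * ((x - wmean X (wt c d)) / 2)) else 0)"
    unfolding inner_on_def
  proof (intro sum.cong refl)
    fix z assume z: "z \<in> Z"
    obtain x y f where zz: "z = (x, y, f)" by (metis prod.exhaust)
    have w: "0 \<le> wt c d x" using z by (intro wt_nonneg) (simp add: zz Z_def)
    show "cnj (lstate d z) * perp_part d z = (case z of (x, y, f) \<Rightarrow> if y = l d x c \<and> f = 1
      then complex_of_real (wt c d x * ((x - wmean X (wt c d)) / 2)) else 0)"
    proof (cases "y = l d x c \<and> f = 1")
      case True
      have "cnj (lstate d z) * perp_part d z = complex_of_real (sqrt (wt c d x) * (sqrt (wt c d x) * ((x - wmean X (wt c d)) / 2)))"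
        using lstate_raised[OF assms z[unfolded zz]] True by (simp add: zz perp_part_def)
      also have "sqrt (wt c d x) * (sqrt (wt c d x) * ((x - wmean X (wt c d)) / 2)) = wt c d x * ((x - wmean X (wt c d)) / 2)"
        using w by (simp add: mult.assoc[symmetric])
      finally show ?thesis using True by (simp add: zz)
    next
      case False
      then show ?thesis by (auto simp: zz perp_part_def)
    qed
  qed
  also have "\<dots> = (\<Sum>x\<in>X. complex_of_real (wt c d x * ((x - wmean X (wt c d)) / 2)))" by (rule sum_core[OF c assms])
  also have "\<dots> = complex_of_real (((\<Sum>x\<in>X. wt c d x * x) - wmean X (wt c d) * (\<Sum>x\<in>X. wt c d x)) / 2)"
    unfolding of_real_sum[symmetric]
    unfolding sum_distrib_left sum_subtractf[symmetric] sum_divide_distrib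
    by (intro arg_cong[where f=complex_of_real] sum.cong refl) (simp add: field_simps)
  also have "\<dots> = 0" by (subst wmean_mult) (use finX wt_nonneg in auto)
  finally show ?thesis .
qed

lemma averaged_state_bounds:
  assumes d: "d \<in> Y"
  shows "spread X (wt c d) / 4 \<le> norm2_on Z (averaged_state c (deviation_amp b \<mu>) (lik_fraction b) (spec d))"
    and "norm2_on Z (averaged_state c (deviation_amp b \<mu>) (lik_fraction b) (spec d)) \<le> spread X (wt c d) / 4 + 1 / (4 * (real n)\<^sup>2)"
    and "norm2_on Z (averaged_state c (deviation_amp b \<mu>) (lik_fraction b) (spec d)) \<le> (\<Sum>x\<in>X. wt c d x * (x - \<mu> d)\<^sup>2) / 4"
proof -
  let ?G = "grover_step Z raised (lstate d)"
  let ?k = "(wmean X (wt c d) - \<mu> d) / 2"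
  let ?mid = "mid_state c (deviation_amp b \<mu>) (spec d)"
  let ?avg = "averaged_state c (deviation_amp b \<mu>) (lik_fraction b) (spec d)"
  have unit: "inner_on Z (lstate d) (lstate d) = 1"
    by (rule core_state_unit[OF lik_fraction spec_in[OF d]])
  have "norm2_on Z ?avg = norm2_on Z (\<lambda>a. (\<Sum>t<n. (?G ^^ t) (\<lambda>a. perp_part d a + complex_of_real ?k * good_part d a) a) / of_nat n)"
    unfolding averaged_state_def
    by (intro norm2_on_cong arg_cong2[where f="(/)"] sum.cong refl grover_pow_cong mid_state_decomp d)
  moreover have "perp_part d a = 0" if "a \<in> Z" "\<not> raised a" for a
    using that by (auto simp: perp_part_def split: if_splits)
  note avg = grover_average_norm[OF finites(1) unit n this perp_part_orthogonal[OF d] good_part_def, of ?k]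
  ultimately have lo: "norm2_on Z (perp_part d) \<le> norm2_on Z ?avg"
    and hi: "norm2_on Z ?avg \<le> norm2_on Z (perp_part d) + ?k\<^sup>2 / (real n)\<^sup>2" using avg by simp_all
  show "spread X (wt c d) / 4 \<le> norm2_on Z ?avg" using lo norm2_perp_part[OF d] by simp
  have m: "wmean X (wt c d) \<in> {0..1}" by (rule wmean_unit) (use finX wt_nonneg wt_unit in auto)
  then have "\<bar>wmean X (wt c d) - \<mu> d\<bar> \<le> 1" using \<mu>[OF d] by auto
  then have "(wmean X (wt c d) - \<mu> d)\<^sup>2 \<le> 1" by (simp only: abs_square_le_1)
  then have "?k\<^sup>2 / (real n)\<^sup>2 \<le> 1 / (4 * (real n)\<^sup>2)" using n by (simp add: power_divide divide_right_mono)
  then show "norm2_on Z ?avg \<le> spread X (wt c d) / 4 + 1 / (4 * (real n)\<^sup>2)"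
    using hi norm2_perp_part[OF d] by simp
  \<comment> \<open>An average of isometric images is no longer than the vector itself, by the
    Cauchy-Schwarz inequality. This bound does not depend on \<open>n\<close> and is the useful one
    for \<open>n = 1\<close>.\<close>
  have "norm2_on Z ?avg \<le> (\<Sum>z\<in>Z. (\<Sum>t<n. (cmod ((?G ^^ t) ?mid z))\<^sup>2) / real n)"
    unfolding norm2_on_def
  proof (intro sum_mono)
    fix z
    have "(cmod (\<Sum>t<n. (?G ^^ t) ?mid z))\<^sup>2 \<le> (\<Sum>t<n. cmod ((?G ^^ t) ?mid z))\<^sup>2"
      by (intro power_mono norm_sum) auto
    also have "\<dots> \<le> (\<Sum>t<n. (cmod ((?G ^^ t) ?mid z))\<^sup>2) * real n"
      using sum_squared_le_sum_of_squares[of "\<lambda>t. cmod ((?G ^^ t) ?mid z)" "{..<n}"] by simp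
    finally show "(cmod (?avg z))\<^sup>2 \<le> (\<Sum>t<n. (cmod ((?G ^^ t) ?mid z))\<^sup>2) / real n"
      using n by (simp add: averaged_state_def norm_divide power_divide field_simps power2_eq_square)
  qed
  also have "\<dots> = (\<Sum>t<n. norm2_on Z ((?G ^^ t) ?mid)) / real n"
    unfolding norm2_on_def sum_divide_distrib[symmetric] by (subst sum.swap) simp
  also have "\<dots> = norm2_on Z ?mid"
  proof -
    have "norm2_on Z ((?G ^^ t) ?mid) = norm2_on Z ?mid" for t
      using norm2_on_inner[of Z "(?G ^^ t) ?mid"] norm2_on_inner[of Z ?mid] inner_on_grover_pow[OF unit, of t raised ?mid ?mid]
      by (metis of_real_eq_iff)
    then show ?thesis using n by simp
  qed
  finally show "norm2_on Z ?avg \<le> (\<Sum>x\<in>X. wt c d x * (x - \<mu> d)\<^sup>2) / 4" using norm2_mid_state[OF d] by simp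
qed

end

definition total_spread :: "control \<Rightarrow> real" where
  "total_spread c = (\<Sum>d\<in>Y. spread X (wt c d))"

abbreviation "variance_prob cr c ys \<mu> \<equiv> query_model.success_prob Bs V (lik_op l) (J (root cr))
  (circuit (variance_circuit cr c ys (deviation_amp b \<mu>) (lik_fraction b)))
  (on_registers (\<lambda>(z, (d, c, v, e, t, g)). t = 0 \<and> g = 1))"

text \<open>The two upper bounds serve the two regimes: the bias is controlled by many Grover powers
  or, through the parallel axis theorem, by good centres \<open>\<mu>\<close>. The last bound places
  the angle below \<open>pi / 6\<close>.\<close>

lemma variance_prob_bounds:
  assumes c: "c \<in> K" and \<mu>: "\<And>d. d \<in> Y \<Longrightarrow> \<mu> d \<in> {0..1}" and ys: "distinct ys" "set ys = Y" and cr: "cr \<in> K"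
  shows "total_spread c \<le> 4 * variance_prob cr c ys \<mu>"
    and "4 * variance_prob cr c ys \<mu> \<le> total_spread c + real (card Y) / (real n)\<^sup>2"
    and "4 * variance_prob cr c ys \<mu> \<le> total_spread c + (\<Sum>d\<in>Y. (\<Sum>x\<in>X. wt c d x) * (wmean X (wt c d) - \<mu> d)\<^sup>2)"
    and "variance_prob cr c ys \<mu> \<le> 1 / 4"
proof -
  have e: "variance_prob cr c ys \<mu> = (\<Sum>d\<in>Y. norm2_on Z (averaged_state c (deviation_amp b \<mu>) (lik_fraction b) (d, c, zero_table, d0, 0, 1)))"
    by (rule variance_success[OF lik_fraction ys cr c])
  note B = averaged_state_bounds[OF c \<mu>]
  have "total_spread c / 4 \<le> variance_prob cr c ys \<mu>"
    unfolding e total_spread_def sum_divide_distrib by (intro sum_mono B)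
  then show "total_spread c \<le> 4 * variance_prob cr c ys \<mu>" by simp
  have "variance_prob cr c ys \<mu> \<le> (\<Sum>d\<in>Y. spread X (wt c d) / 4 + 1 / (4 * (real n)\<^sup>2))"
    unfolding e by (intro sum_mono B)
  also have "\<dots> = (total_spread c + real (card Y) / (real n)\<^sup>2) / 4"
    by (simp add: total_spread_def sum.distrib sum_divide_distrib add_divide_distrib)
  finally show "4 * variance_prob cr c ys \<mu> \<le> total_spread c + real (card Y) / (real n)\<^sup>2" by simp
  have p: "variance_prob cr c ys \<mu> \<le> (\<Sum>d\<in>Y. (\<Sum>x\<in>X. wt c d x * (x - \<mu> d)\<^sup>2) / 4)"
    unfolding e by (intro sum_mono B)
  have "(\<Sum>d\<in>Y. (\<Sum>x\<in>X. wt c d x * (x - \<mu> d)\<^sup>2) / 4)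
    = (total_spread c + (\<Sum>d\<in>Y. (\<Sum>x\<in>X. wt c d x) * (wmean X (wt c d) - \<mu> d)\<^sup>2)) / 4"
  proof -
    have "(\<Sum>x\<in>X. wt c d x * (x - \<mu> d)\<^sup>2) = spread X (wt c d) + (\<Sum>x\<in>X. wt c d x) * (wmean X (wt c d) - \<mu> d)\<^sup>2" for d
      by (rule sum_weighted_square[OF finX]) (rule wt_nonneg)
    then show ?thesis by (simp only: total_spread_def add_divide_distrib sum.distrib sum_divide_distrib)
  qed
  then show "4 * variance_prob cr c ys \<mu> \<le> total_spread c + (\<Sum>d\<in>Y. (\<Sum>x\<in>X. wt c d x) * (wmean X (wt c d) - \<mu> d)\<^sup>2)"
    using p by simp
  have "(\<Sum>d\<in>Y. (\<Sum>x\<in>X. wt c d x * (x - \<mu> d)\<^sup>2) / 4) \<le> (\<Sum>d\<in>Y. (\<Sum>x\<in>X. wt c d x) / 4)"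
  proof (intro sum_mono divide_right_mono)
    fix d x assume d: "d \<in> Y" and x: "x \<in> X"
    show "wt c d x * (x - \<mu> d)\<^sup>2 \<le> wt c d x"
    proof (cases "wt c d x = 0")
      case False
      then have "\<bar>x - \<mu> d\<bar> \<le> 1" using wt_unit[OF x False] \<mu>[OF d] by auto
      then have "(x - \<mu> d)\<^sup>2 \<le> 1" by (simp only: abs_square_le_1)
      then show ?thesis using wt_nonneg[OF x, of c d] by (simp add: mult_left_le)
    qed simp
  qed simp
  also have "\<dots> = (\<Sum>d\<in>Y. \<Sum>x\<in>X. wt c d x) / 4" by (simp add: sum_divide_distrib)
  also have "\<dots> \<le> 1 / 4" using wt_sum_le[OF c] by simp
  finally show "variance_prob cr c ys \<mu> \<le> 1 / 4" using p by simp
qed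

end

section \<open>Estimating the utility\<close>

definition unit_clamp :: "real \<Rightarrow> real" where
  "unit_clamp x = max 0 (min 1 x)"

lemma unit_clamp: "unit_clamp x \<in> {0..1}" "x \<in> {0..1} \<Longrightarrow> unit_clamp x = x"
  by (auto simp: unit_clamp_def)

lemma unit_clamp_dist: "m \<in> {0..1} \<Longrightarrow> \<bar>unit_clamp x - m\<bar> \<le> \<bar>x - m\<bar>"
  by (auto simp: unit_clamp_def)

text \<open>The search begins with \<open>[0, pi / 6]\<close>, that is with probabilities up to 1/4;
  the factors 1/4 in the weights and 1/2 in the deviation are there for it.\<close>

definition estimate_prob ::
  "basis set \<Rightarrow> basis \<Rightarrow> basis gate list \<Rightarrow> (basis \<Rightarrow> bool) \<Rightarrow> nat \<Rightarrow> nat \<Rightarrow> (real \<Rightarrow> program) \<Rightarrow> program" where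
  "estimate_prob B a0 cs good r J k = estimate_angle B a0 cs good r J 0 (pi / 6) (\<lambda>t. k ((sin t)\<^sup>2))"

lemma abs_sin_diff_le: "\<bar>sin x - sin y\<bar> \<le> \<bar>x - y\<bar>" for x y :: real
proof -
  have "\<bar>sin x - sin y\<bar> = 2 * \<bar>sin ((x - y) / 2)\<bar> * \<bar>cos ((x + y) / 2)\<bar>"
    by (simp add: sin_diff_sin abs_mult)
  also have "\<dots> \<le> 2 * \<bar>(x - y) / 2\<bar> * 1"
    by (intro mult_mono mult_left_mono abs_sin_x_le_abs_x) auto
  finally show ?thesis by simp
qed

context query_model
begin

lemma angle_of_prob:
  assumes "0 \<le> p" "p \<le> 1 / 4"
  shows "\<exists>\<theta>. \<theta> \<in> {0..pi / 6} \<and> sin \<theta> = sqrt p"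
proof -
  have "sqrt p \<le> sqrt ((1 / 2)\<^sup>2)" using assms by (intro real_sqrt_le_mono) (simp add: power2_eq_square)
  then have s: "0 \<le> sqrt p" "sqrt p \<le> 1 / 2" using assms by auto
  then have "- 1 \<le> sqrt p" by linarith
  note s = s this
  have "arcsin (sqrt p) \<le> arcsin (1 / 2)" using s by (intro arcsin_le_arcsin) auto
  also have "arcsin (1 / 2) = pi / 6" using arcsin_sin[of "pi / 6"] sin_30 by simp
  finally show ?thesis using s assms by (intro exI[of _ "arcsin (sqrt p)"]) (auto intro!: arcsin_nonneg sin_arcsin)
qed

text \<open>The difference of the squared sines factors into a difference of at most
  \<open>\<kappa>\<close> and a sum. Bounding the sum through \<open>sqrt p\<close> gives the error
  that improves for small probabilities, as the means require; bounding it by 2 gives the uniform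
  error for the variance.\<close>

lemma succeeds_estimate_prob:
  assumes ok: "circuit_ok B cs" and p: "success_prob cs good \<le> 1 / 4" and J: "(3 / 4) ^ J \<le> \<kappa>"
  shows "succeeds (estimate_prob B a0 cs good r J)
    {x. \<bar>x - success_prob cs good\<bar> \<le> \<kappa> * (2 * sqrt (success_prob cs good) + \<kappa>) \<and> \<bar>x - success_prob cs good\<bar> \<le> 2 * \<kappa>}
    (real J * exp (- (real r * sep_gap\<^sup>2 / 4)))"
proof -
  let ?p = "success_prob cs good"
  let ?G = "{x. \<bar>x - ?p\<bar> \<le> \<kappa> * (2 * sqrt ?p + \<kappa>) \<and> \<bar>x - ?p\<bar> \<le> 2 * \<kappa>}"
  have p0: "0 \<le> ?p" by (rule success_prob_bounds[OF ok])
  obtain \<theta> where \<theta>: "\<theta> \<in> {0..pi / 6}" "sin \<theta> = sqrt ?p" using angle_of_prob[OF p0 p] by blast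
  have ps: "?p = (sin \<theta>)\<^sup>2" using \<theta>(2) p0 by simp
  have \<kappa>: "0 \<le> \<kappa>" using J by (meson dual_order.trans zero_le_power zero_le_divide_iff zero_le_numeral)
  have s: "succeeds (estimate_angle B a0 cs good r J 0 (pi / 6)) {x. \<bar>x - \<theta>\<bar> \<le> (3 / 4) ^ J * (pi / 6 - 0)}
    (real J * exp (- (real r * sep_gap\<^sup>2 / 4)))"
    by (rule succeeds_estimate_angle[OF ok ps]) (use \<theta> in auto)
  have "succeeds (\<lambda>k. estimate_angle B a0 cs good r J 0 (pi / 6) (\<lambda>t. (\<lambda>k. k ((sin t)\<^sup>2)) k)) ?G
    (real J * exp (- (real r * sep_gap\<^sup>2 / 4)) + 0)"
  proof (rule succeeds_bind[OF s])
    fix t assume "t \<in> {x. \<bar>x - \<theta>\<bar> \<le> (3 / 4) ^ J * (pi / 6 - 0)}"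
    then have "\<bar>t - \<theta>\<bar> \<le> (3 / 4) ^ J * (pi / 6)" by simp
    also have "\<dots> \<le> (3 / 4) ^ J * 1" using pi_less_4 by (intro mult_left_mono) auto
    finally have t: "\<bar>t - \<theta>\<bar> \<le> \<kappa>" using J by simp
    have d: "\<bar>sin t - sin \<theta>\<bar> \<le> \<kappa>" using abs_sin_diff_le[of t \<theta>] t by simp
    have e: "(sin t)\<^sup>2 - ?p = (sin t - sin \<theta>) * (sin t + sin \<theta>)" unfolding ps by (simp add: power2_eq_square algebra_simps)
    have "\<bar>sin t + sin \<theta>\<bar> \<le> 2 * sqrt ?p + \<kappa>" using d \<theta>(2) real_sqrt_ge_zero[OF p0] by linarith
    moreover have "\<bar>sin t + sin \<theta>\<bar> \<le> 2" using abs_sin_le_one[of t] abs_sin_le_one[of \<theta>] by linarith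
    ultimately have "(sin t)\<^sup>2 \<in> ?G"
      using mult_mono[OF d, of "\<bar>sin t + sin \<theta>\<bar>" "2 * sqrt ?p + \<kappa>"] mult_mono[OF d, of "\<bar>sin t + sin \<theta>\<bar>" 2] \<kappa>
      by (simp add: e abs_mult mult.commute)
    then show "succeeds (\<lambda>k. k ((sin t)\<^sup>2)) ?G 0" by (rule succeeds_return)
  qed simp
  moreover have "estimate_prob B a0 cs good r J = (\<lambda>k. estimate_angle B a0 cs good r J 0 (pi / 6) (\<lambda>t. k ((sin t)\<^sup>2)))"
    by (rule ext) (simp add: estimate_prob_def)
  ultimately show ?thesis by simp
qed

lemma costs_estimate_prob:
  assumes ok: "circuit_ok B cs"
  shows "costs (estimate_prob B a0 cs good r J) (real J * (real r * real (circuit_cost cs) * (3 * (4 / 3) ^ J)))"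
proof -
  have "costs (estimate_angle B a0 cs good r J 0 (pi / 6)) (real J * (real r * real (circuit_cost cs) * (pi / 2 / (pi / 6 - 0) * (4 / 3) ^ J)))"
    by (rule costs_estimate_angle[OF ok]) auto
  then have "costs (estimate_angle B a0 cs good r J 0 (pi / 6)) (real J * (real r * real (circuit_cost cs) * (3 * (4 / 3) ^ J)))"
    by simp
  then show ?thesis unfolding costs_def estimate_prob_def by simp
qed

end

context registers
begin

definition probe :: "control \<Rightarrow> nat \<Rightarrow> nat \<Rightarrow> (real \<Rightarrow> nat \<Rightarrow> real) \<Rightarrow> control \<Rightarrow> real \<Rightarrow> (real \<Rightarrow> program) \<Rightarrow> program" where
  "probe cr r J' q c d = estimate_prob Bs (J (root cr)) (circuit (evidence_circuit cr d c q))
     (on_registers (\<lambda>(z, s). (\<lambda>(x, y, f). f = 1) z)) r J'"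

text \<open>Clamping \<open>x\<close> makes this a probability for every latent value, also outside
  the support of the prior, and changes nothing on the support.\<close>

definition mean_weight :: "real \<Rightarrow> nat \<Rightarrow> real" where
  "mean_weight x y = lik_fraction b x y * unit_clamp x / 4"

definition mass_weight :: "real \<Rightarrow> nat \<Rightarrow> real" where
  "mass_weight x y = lik_fraction b x y / 4"

text \<open>The ratio of the two probabilities estimates the posterior mean; the common factor 1/4
  cancels. Clamping also covers a useless ratio, such as one with \<open>p2\<close> equal to
  0.\<close>

primrec mean_table :: "control \<Rightarrow> nat \<Rightarrow> nat \<Rightarrow> control \<Rightarrow> real list \<Rightarrow> (real \<Rightarrow> real) \<Rightarrow> ((real \<Rightarrow> real) \<Rightarrow> program) \<Rightarrow> program" where
  "mean_table cr r J' c [] m k = k m"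
| "mean_table cr r J' c (d # ds) m k = probe cr r J' mean_weight c d (\<lambda>p1. probe cr r J' mass_weight c d (\<lambda>p2.
     mean_table cr r J' c ds (m(d := unit_clamp (p1 / p2))) k))"

definition estimate_deviation :: "control \<Rightarrow> nat \<Rightarrow> nat \<Rightarrow> control \<Rightarrow> real list \<Rightarrow> (real \<Rightarrow> real) \<Rightarrow> (real \<Rightarrow> program) \<Rightarrow> program" where
  "estimate_deviation cr r J' c ys \<mu> k = estimate_prob Bs (J (root cr))
     (circuit (variance_circuit cr c ys (deviation_amp b \<mu>) (lik_fraction b)))
     (on_registers (\<lambda>(z, (d, c, v, e, t, g)). t = 0 \<and> g = 1)) r J' (\<lambda>p. k (- 4 * p))"

text \<open>\<open>ts\<close> lists the outcomes whose means are estimated: all of them in one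
  regime, none in the other, where every centre is 0.\<close>

definition estimate_utility :: "control \<Rightarrow> nat \<Rightarrow> nat \<Rightarrow> nat \<Rightarrow> control \<Rightarrow> real list \<Rightarrow> real list \<Rightarrow> (real \<Rightarrow> program) \<Rightarrow> program" where
  "estimate_utility cr r Jt Jf c ys ts k = mean_table cr r Jt c ts (\<lambda>_. 0) (\<lambda>\<mu>. estimate_deviation cr r Jf c ys \<mu> k)"

lemma weights_unit:
  "0 \<le> mean_weight x y" "mean_weight x y \<le> 1" "0 \<le> mass_weight x y" "mass_weight x y \<le> 1"
proof -
  have "lik_fraction b x y * unit_clamp x \<le> 1 * 1"
    using lik_fraction[of b x y] unit_clamp(1)[of x] by (intro mult_mono) auto
  then show "mean_weight x y \<le> 1" by (simp add: mean_weight_def)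
  show "0 \<le> mean_weight x y" "0 \<le> mass_weight x y" "mass_weight x y \<le> 1"
    using lik_fraction[of b x y] unit_clamp(1)[of x] by (auto simp: mean_weight_def mass_weight_def)
qed

lemma J_root_in: "cr \<in> K \<Longrightarrow> J (root cr) \<in> Bs"
  using J_bij root_in by (auto simp: bij_betw_def)

lemma well_formed_estimate_prob:
  assumes "cr \<in> K" "circuit_ok Bs cs" "\<And>p. well_formed Bs (k p)"
  shows "well_formed Bs (estimate_prob Bs (J (root cr)) cs good r J' k)"
  unfolding estimate_prob_def
  by (rule well_formed_estimate_angle[OF finite_Bs J_root_in assms(2)]) (use assms in auto)

lemma well_formed_mean_table:
  assumes "cr \<in> K" "c \<in> K" "set ts \<subseteq> Y" "\<And>\<mu>. well_formed Bs (k \<mu>)"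
  shows "well_formed Bs (mean_table cr r J' c ts m k)"
  using assms(3)
proof (induction ts arbitrary: m)
  case (Cons d ts)
  then show ?case
    by (auto simp: probe_def weights_unit assms intro!: well_formed_estimate_prob circuit_ok_circuit evidence_circuit_ok)
qed (use assms in simp)

lemma well_formed_estimate_utility:
  assumes "cr \<in> K" "c \<in> K" "set ys \<subseteq> Y" "set ts \<subseteq> Y" "\<And>u. well_formed Bs (k u)"
  shows "well_formed Bs (estimate_utility cr r Jt Jf c ys ts k)"
  unfolding estimate_utility_def estimate_deviation_def
  by (intro well_formed_mean_table well_formed_estimate_prob circuit_ok_circuit variance_circuit_ok lik_fraction assms)

end

locale rooted_registers = unit_bayes_registers +
  fixes cr :: control
  assumes cr: "cr \<in> K"

sublocale rooted_registers \<subseteq> qm: query_model Bs V "lik_op l" "J (root cr)"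
  by (rule model[OF cr])

section \<open>Accuracy and cost of the estimated utility\<close>

context rooted_registers
begin

definition shot_error :: "nat \<Rightarrow> real" where
  "shot_error r = exp (- (real r * sep_gap\<^sup>2 / 4))"

lemma shot_error_nonneg: "0 \<le> shot_error r"
  by (simp add: shot_error_def)

definition mass :: "control \<Rightarrow> real \<Rightarrow> real" where
  "mass c d = (\<Sum>x\<in>X. wt c d x)"

lemma mass_nonneg: "0 \<le> mass c d"
  unfolding mass_def by (intro sum_nonneg wt_nonneg)

lemma mass_le: "c \<in> K \<Longrightarrow> d \<in> Y \<Longrightarrow> mass c d \<le> 1"
  using member_le_sum[of d Y "mass c"] finY mass_nonneg wt_sum_le[of c] by (force simp: mass_def)

lemma lik_fraction_value: "c \<in> K \<Longrightarrow> d \<in> Y \<Longrightarrow> x \<in> X \<Longrightarrow> lik_fraction b x (l d x c) = real (l d x c) / 2 ^ b"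
  by (rule lik_fraction_l[where \<mu>="\<lambda>_. 0"]) auto

lemma evidence_mass:
  assumes "c \<in> K" "d \<in> Y"
  shows "qm.success_prob (circuit (evidence_circuit cr d c mass_weight)) (on_registers (\<lambda>(z, s). raised z)) = mass c d / 4"
proof -
  have "qm.success_prob (circuit (evidence_circuit cr d c mass_weight)) (on_registers (\<lambda>(z, s). raised z))
    = (\<Sum>x\<in>X. P x * mass_weight x (l d x c))"
    by (rule evidence_success[OF weights_unit(3,4) cr assms])
  also have "\<dots> = (\<Sum>x\<in>X. wt c d x / 4)"
    by (intro sum.cong refl) (simp add: mass_weight_def wt_def lik_fraction_value[OF assms])
  finally show ?thesis by (simp add: mass_def sum_divide_distrib)
qed

lemma evidence_mean:
  assumes "c \<in> K" "d \<in> Y"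
  shows "qm.success_prob (circuit (evidence_circuit cr d c mean_weight)) (on_registers (\<lambda>(z, s). raised z))
    = wmean X (wt c d) * mass c d / 4"
proof -
  have "qm.success_prob (circuit (evidence_circuit cr d c mean_weight)) (on_registers (\<lambda>(z, s). raised z))
    = (\<Sum>x\<in>X. P x * mean_weight x (l d x c))"
    by (rule evidence_success[OF weights_unit(1,2) cr assms])
  also have "\<dots> = (\<Sum>x\<in>X. wt c d x * x / 4)"
  proof (intro sum.cong refl)
    fix x assume x: "x \<in> X"
    show "P x * mean_weight x (l d x c) = wt c d x * x / 4"
    proof (cases "P x = 0")
      case False
      then have "unit_clamp x = x" using P_unit[OF x] by (simp add: unit_clamp(2))
      then show ?thesis by (simp add: mean_weight_def wt_def lik_fraction_value[OF assms x])
    qed (simp add: wt_def)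
  qed
  also have "\<dots> = wmean X (wt c d) * mass c d / 4"
    using wmean_mult[of X "wt c d", OF finX wt_nonneg] by (simp add: mass_def flip: sum_divide_distrib)
  finally show ?thesis .
qed

lemma wmean_wt: "wmean X (wt c d) \<in> {0..1}"
  by (rule wmean_unit) (use finX wt_nonneg wt_unit in auto)

text \<open>Probabilities of order \<open>E\<close> are known up to about
  \<open>\<kappa> * sqrt E\<close>, so the mean is known up to about
  \<open>\<kappa> / sqrt E\<close>. Its square weighted by \<open>E\<close> is of order
  \<open>\<kappa>\<^sup>2\<close> whatever \<open>E\<close> is, which is why outcomes of tiny
  evidence cause no trouble.\<close>

lemma ratio_error:
  assumes E: "0 \<le> E" and m: "m \<in> {0..1}" and \<kappa>: "0 \<le> \<kappa>"
    and p1: "\<bar>p1 - m * E / 4\<bar> \<le> \<kappa> * (2 * sqrt (m * E / 4) + \<kappa>)"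
    and p2: "\<bar>p2 - E / 4\<bar> \<le> \<kappa> * (2 * sqrt (E / 4) + \<kappa>)"
  shows "E * (m - unit_clamp (p1 / p2))\<^sup>2 \<le> 289 * \<kappa>\<^sup>2"
\<comment> \<open>With so little evidence any centre in the unit interval is good enough. Otherwise
  \<open>16 * \<kappa> < sqrt E\<close>, and \<open>p2\<close> is at least half of its true value
  \<open>E / 4\<close>.\<close>
proof (cases "E \<le> 256 * \<kappa>\<^sup>2")
  case True
  have "\<bar>m - unit_clamp (p1 / p2)\<bar> \<le> 1" using m unit_clamp(1)[of "p1 / p2"] by auto
  then have "(m - unit_clamp (p1 / p2))\<^sup>2 \<le> 1" by (simp only: abs_square_le_1)
  then have "E * (m - unit_clamp (p1 / p2))\<^sup>2 \<le> E * 1" using E by (intro mult_left_mono)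
  then show ?thesis using True zero_le_power2[of \<kappa>] by linarith
next
  case False
  define s where "s = sqrt E"
  have Es: "E = s\<^sup>2" using E by (simp add: s_def)
  have s0: "0 \<le> s" using E by (simp add: s_def)
  have ks: "16 * \<kappa> < s"
  proof (rule power2_less_imp_less[OF _ s0])
    show "(16 * \<kappa>)\<^sup>2 < s\<^sup>2" using False Es by (simp add: power_mult_distrib)
  qed
  have s: "0 < s" using ks \<kappa> by simp
  have sq: "sqrt (E / 4) = s / 2" by (simp add: s_def real_sqrt_divide)
  have "sqrt (m * E / 4) \<le> sqrt (E / 4)" using m E by (intro real_sqrt_le_mono divide_right_mono) (auto simp: mult_left_le_one_le)
  then have "\<kappa> * (2 * sqrt (m * E / 4) + \<kappa>) \<le> \<kappa> * (s + \<kappa>)" using sq \<kappa> by (intro mult_left_mono) auto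
  then have d1: "\<bar>p1 - m * E / 4\<bar> \<le> \<kappa> * (s + \<kappa>)" using p1 by simp
  have d2: "\<bar>p2 - E / 4\<bar> \<le> \<kappa> * (s + \<kappa>)" using p2 sq by simp
  have "\<kappa> * (s + \<kappa>) \<le> \<kappa> * (17 / 16 * s)" using ks \<kappa> by (intro mult_left_mono) auto
  then have \<tau>: "\<kappa> * (s + \<kappa>) \<le> 17 / 16 * \<kappa> * s" by simp
  have "17 / 16 * \<kappa> * s \<le> s / 8 * s" using ks s by (intro mult_right_mono) auto
  then have "\<kappa> * (s + \<kappa>) \<le> E / 8" using \<tau> Es by (simp add: power2_eq_square)
  then have p2l: "E / 8 \<le> p2" using d2 by (auto simp: abs_le_iff)
  have E0: "0 < E" using s Es by simp
  have "\<bar>p1 / p2 - m\<bar> = \<bar>p1 - m * p2\<bar> / p2" using p2l E0 by (simp add: field_simps abs_if split: if_splits)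
  also have "\<dots> \<le> (2 * (17 / 16 * \<kappa> * s)) / p2"
  proof (rule divide_right_mono)
    have "\<bar>p1 - m * p2\<bar> = \<bar>(p1 - m * E / 4) + m * (E / 4 - p2)\<bar>" by (simp add: algebra_simps)
    also have "\<dots> \<le> \<bar>p1 - m * E / 4\<bar> + \<bar>m * (E / 4 - p2)\<bar>" by (rule abs_triangle_ineq)
    also have "\<bar>m * (E / 4 - p2)\<bar> \<le> 1 * \<bar>p2 - E / 4\<bar>"
      unfolding abs_mult using m by (intro mult_mono) (auto simp: abs_minus_commute)
    finally show "\<bar>p1 - m * p2\<bar> \<le> 2 * (17 / 16 * \<kappa> * s)" using d1 d2 \<tau> by simp
  qed (use p2l E0 in simp)
  also have "\<dots> \<le> (2 * (17 / 16 * \<kappa> * s)) / (E / 8)"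
    using p2l E0 \<kappa> s by (intro divide_left_mono) auto
  \<comment> \<open>The product 2 * (17/16) * 8; its square is the constant 289.\<close>
  also have "\<dots> = 17 * \<kappa> / s" using s by (simp add: Es power2_eq_square)
  finally have "\<bar>m - unit_clamp (p1 / p2)\<bar> \<le> 17 * \<kappa> / s"
    using unit_clamp_dist[OF m, of "p1 / p2"] by (simp add: abs_minus_commute)
  then have "(m - unit_clamp (p1 / p2))\<^sup>2 \<le> (17 * \<kappa> / s)\<^sup>2" by (metis abs_ge_zero power2_abs power_mono)
  then have "E * (m - unit_clamp (p1 / p2))\<^sup>2 \<le> E * (17 * \<kappa> / s)\<^sup>2" using E by (intro mult_left_mono)
  also have "\<dots> = 289 * \<kappa>\<^sup>2" using s by (simp add: Es power_divide power_mult_distrib)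
  finally show ?thesis .
qed

lemma succeeds_mean_table:
  assumes c: "c \<in> K" and ts: "distinct ts" "set ts \<subseteq> Y" and J': "(3 / 4) ^ J' \<le> \<kappa>"
    and m: "\<And>d. m d \<in> {0..1}"
  shows "qm.succeeds (mean_table cr r J' c ts m)
    {\<mu>. (\<forall>d. \<mu> d \<in> {0..1}) \<and> (\<forall>d. d \<notin> set ts \<longrightarrow> \<mu> d = m d) \<and> (\<forall>d\<in>set ts. mass c d * (wmean X (wt c d) - \<mu> d)\<^sup>2 \<le> 289 * \<kappa>\<^sup>2)}
    (2 * real (length ts) * real J' * shot_error r)"
  using ts m
proof (induction ts arbitrary: m)
  case Nil
  have "mean_table cr r J' c [] m = (\<lambda>k. k m)" by (rule ext) simp
  moreover have "2 * real (length ([] :: real list)) * real J' * shot_error r = 0" by simp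
  ultimately show ?case using qm.succeeds_return[of m] Nil by (simp only:) auto
next
  case (Cons d ts)
  have d: "d \<in> Y" using Cons.prems by simp
  have \<kappa>: "0 \<le> \<kappa>" using J' by (meson dual_order.trans zero_le_power zero_le_divide_iff zero_le_numeral)
  let ?C1 = "circuit (evidence_circuit cr d c mean_weight)"
  let ?C2 = "circuit (evidence_circuit cr d c mass_weight)"
  let ?good = "on_registers (\<lambda>(z, s). raised z)"
  let ?G = "\<lambda>p. {x. \<bar>x - p\<bar> \<le> \<kappa> * (2 * sqrt p + \<kappa>) \<and> \<bar>x - p\<bar> \<le> 2 * \<kappa>}"
  let ?\<delta> = "real J' * shot_error r"
  let ?M = "\<lambda>m. {\<mu>. (\<forall>d. \<mu> d \<in> {0..1}) \<and> (\<forall>d. d \<notin> set ts \<longrightarrow> \<mu> d = m d) \<and> (\<forall>d\<in>set ts. mass c d * (wmean X (wt c d) - \<mu> d)\<^sup>2 \<le> 289 * \<kappa>\<^sup>2)}"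
  let ?M' = "{\<mu>. (\<forall>d. \<mu> d \<in> {0..1}) \<and> (\<forall>d'. d' \<notin> set (d # ts) \<longrightarrow> \<mu> d' = m d') \<and> (\<forall>d\<in>set (d # ts). mass c d * (wmean X (wt c d) - \<mu> d)\<^sup>2 \<le> 289 * \<kappa>\<^sup>2)}"
  have ok1: "circuit_ok Bs ?C1" by (intro circuit_ok_circuit evidence_circuit_ok weights_unit cr c d)
  have ok2: "circuit_ok Bs ?C2" by (intro circuit_ok_circuit evidence_circuit_ok weights_unit cr c d)
  have mm: "wmean X (wt c d) * mass c d \<le> 1 * 1"
    using wmean_wt[of c d] mass_le[OF c d] mass_nonneg[of c d] by (intro mult_mono) auto
  have s1: "qm.succeeds (probe cr r J' mean_weight c d) (?G (wmean X (wt c d) * mass c d / 4)) ?\<delta>"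
    using qm.succeeds_estimate_prob[OF ok1 _ J', of ?good r] mm
    unfolding evidence_mean[OF c d] probe_def shot_error_def by simp
  have s2: "qm.succeeds (probe cr r J' mass_weight c d) (?G (mass c d / 4)) ?\<delta>"
    using qm.succeeds_estimate_prob[OF ok2 _ J', of ?good r] mass_le[OF c d]
    unfolding evidence_mass[OF c d] probe_def shot_error_def by simp
  let ?N = "2 * real (length ts) * real J' * shot_error r"
  have "qm.succeeds (\<lambda>k. probe cr r J' mean_weight c d (\<lambda>p1. (\<lambda>k. probe cr r J' mass_weight c d (\<lambda>p2.
     mean_table cr r J' c ts (m(d := unit_clamp (p1 / p2))) k)) k)) ?M' (?\<delta> + (?\<delta> + ?N))"
  proof (rule qm.succeeds_bind[OF s1])
    fix p1 assume p1: "p1 \<in> ?G (wmean X (wt c d) * mass c d / 4)"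
    show "qm.succeeds (\<lambda>k. probe cr r J' mass_weight c d (\<lambda>p2.
     mean_table cr r J' c ts (m(d := unit_clamp (p1 / p2))) k)) ?M' (?\<delta> + ?N)"
    proof (rule qm.succeeds_bind[OF s2])
      fix p2 assume p2: "p2 \<in> ?G (mass c d / 4)"
      have r: "mass c d * (wmean X (wt c d) - unit_clamp (p1 / p2))\<^sup>2 \<le> 289 * \<kappa>\<^sup>2"
        by (rule ratio_error[OF mass_nonneg wmean_wt \<kappa>]) (use p1 p2 in auto)
      let ?m = "m(d := unit_clamp (p1 / p2))"
      have "qm.succeeds (mean_table cr r J' c ts ?m) (?M ?m) ?N"
        by (rule Cons.IH) (use Cons.prems unit_clamp(1) in auto)
      moreover have "?M ?m \<subseteq> ?M'" using r Cons.prems(1) by auto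
      ultimately show "qm.succeeds (mean_table cr r J' c ts ?m) ?M' ?N" by (rule qm.succeeds_mono) simp
    qed (simp add: shot_error_nonneg)
  qed (simp add: shot_error_nonneg)
  moreover have "mean_table cr r J' c (d # ts) m = (\<lambda>k. probe cr r J' mean_weight c d (\<lambda>p1. (\<lambda>k. probe cr r J' mass_weight c d (\<lambda>p2.
     mean_table cr r J' c ts (m(d := unit_clamp (p1 / p2))) k)) k))"
    by (rule ext) simp
  moreover have "?\<delta> + (?\<delta> + ?N) = 2 * real (length (d # ts)) * real J' * shot_error r" by (simp add: algebra_simps)
  ultimately show ?case by (simp only:)
qed

lemma costs_mean_table:
  assumes c: "c \<in> K" and ts: "set ts \<subseteq> Y"
  shows "qm.costs (mean_table cr r J' c ts m) (real (length ts) * (2 * (real J' * (real r * 2 * (3 * (4 / 3) ^ J')))))"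
  using ts
proof (induction ts arbitrary: m)
  case Nil
  have "mean_table cr r J' c [] m = (\<lambda>k. k m)" by (rule ext) simp
  then show ?case using qm.costs_return by simp
next
  case (Cons d ts)
  let ?A = "real J' * (real r * 2 * (3 * (4 / 3) ^ J'))"
  have p: "qm.costs (probe cr r J' q c d) ?A" if q: "\<And>x y. 0 \<le> q x y" "\<And>x y. q x y \<le> 1" for q
    using qm.costs_estimate_prob[OF circuit_ok_circuit[OF evidence_circuit_ok[of q, OF q cr c]], of d "on_registers (\<lambda>(z, s). raised z)" r J']
      Cons.prems by (simp add: probe_def cost_evidence_circuit)
  have "qm.costs (\<lambda>k. probe cr r J' mean_weight c d (\<lambda>p1. (\<lambda>k. probe cr r J' mass_weight c d (\<lambda>p2.
     mean_table cr r J' c ts (m(d := unit_clamp (p1 / p2))) k)) k)) (?A + (?A + real (length ts) * (2 * ?A)))"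
    by (rule qm.costs_bind[OF p], (rule weights_unit)+, rule qm.costs_bind[OF p], (rule weights_unit)+, rule Cons.IH)
      (use Cons.prems in simp)
  moreover have "mean_table cr r J' c (d # ts) m = (\<lambda>k. probe cr r J' mean_weight c d (\<lambda>p1. (\<lambda>k. probe cr r J' mass_weight c d (\<lambda>p2.
     mean_table cr r J' c ts (m(d := unit_clamp (p1 / p2))) k)) k))"
    by (rule ext) simp
  moreover have "?A + (?A + real (length ts) * (2 * ?A)) = real (length (d # ts)) * (2 * ?A)" by (simp add: algebra_simps)
  ultimately show ?case by (simp only:)
qed

text \<open>An error \<open>2 * \<kappa>\<close> of the probability becomes
  \<open>8 * \<kappa>\<close> after the scaling by 4. The bias \<open>\<beta>\<close> is one-sided:
  the circuit can only overestimate the variance.\<close>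

lemma succeeds_estimate_deviation:
  assumes c: "c \<in> K" and ys: "distinct ys" "set ys = Y" and \<mu>: "\<And>d. \<mu> d \<in> {0..1}" and J': "(3 / 4) ^ J' \<le> \<kappa>"
    and bias: "real (card Y) / (real n)\<^sup>2 \<le> \<beta> \<or> (\<Sum>d\<in>Y. mass c d * (wmean X (wt c d) - \<mu> d)\<^sup>2) \<le> \<beta>"
  shows "qm.succeeds (estimate_deviation cr r J' c ys \<mu>) {u. \<bar>u + total_spread c\<bar> \<le> 8 * \<kappa> + \<beta>} (real J' * shot_error r)"
proof -
  let ?C = "circuit (variance_circuit cr c ys (deviation_amp b \<mu>) (lik_fraction b))"
  let ?good = "on_registers (\<lambda>(z, (d, c, v, e, t, g)). t = 0 \<and> g = 1)"
  let ?p = "qm.success_prob ?C ?good"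
  let ?G = "{x. \<bar>x - ?p\<bar> \<le> \<kappa> * (2 * sqrt ?p + \<kappa>) \<and> \<bar>x - ?p\<bar> \<le> 2 * \<kappa>}"
  have ok: "circuit_ok Bs ?C" by (intro circuit_ok_circuit variance_circuit_ok lik_fraction cr c) (use ys in simp)
  note b = variance_prob_bounds[where \<mu>=\<mu>, OF c \<mu> ys cr]
  have "4 * ?p \<le> total_spread c + \<beta>" using bias b(2,3) unfolding mass_def by linarith
  have s: "qm.succeeds (estimate_prob Bs (J (root cr)) ?C ?good r J') ?G (real J' * shot_error r)"
    unfolding shot_error_def by (rule qm.succeeds_estimate_prob[OF ok b(4) J'])
  have "qm.succeeds (\<lambda>k. estimate_prob Bs (J (root cr)) ?C ?good r J' (\<lambda>p. (\<lambda>k. k (- 4 * p)) k))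
    {u. \<bar>u + total_spread c\<bar> \<le> 8 * \<kappa> + \<beta>} (real J' * shot_error r + 0)"
  proof (rule qm.succeeds_bind[OF s])
    fix p assume "p \<in> ?G"
    then have "\<bar>p - ?p\<bar> \<le> 2 * \<kappa>" by simp
    then have "- 4 * p \<in> {u. \<bar>u + total_spread c\<bar> \<le> 8 * \<kappa> + \<beta>}"
      using \<open>4 * ?p \<le> total_spread c + \<beta>\<close> b(1) by (auto simp: abs_le_iff)
    then show "qm.succeeds (\<lambda>k. k (- 4 * p)) {u. \<bar>u + total_spread c\<bar> \<le> 8 * \<kappa> + \<beta>} 0" by (rule qm.succeeds_return)
  qed simp
  moreover have "estimate_deviation cr r J' c ys \<mu> = (\<lambda>k. estimate_prob Bs (J (root cr)) ?C ?good r J' (\<lambda>p. k (- 4 * p)))"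
    by (rule ext) (simp add: estimate_deviation_def)
  ultimately show ?thesis by simp
qed

lemma costs_estimate_deviation:
  assumes c: "c \<in> K" and ys: "set ys = Y"
  shows "qm.costs (estimate_deviation cr r J' c ys \<mu>)
    (real J' * (real r * real (2 + 2 * length ys + 4 * (n - 1)) * (3 * (4 / 3) ^ J')))"
proof -
  have ok: "circuit_ok Bs (circuit (variance_circuit cr c ys (deviation_amp b \<mu>) (lik_fraction b)))"
    by (intro circuit_ok_circuit variance_circuit_ok lik_fraction cr c) (use ys in simp)
  show ?thesis
    using qm.costs_estimate_prob[OF ok, of "on_registers (\<lambda>(z, (d, c, v, e, t, g)). t = 0 \<and> g = 1)" r J']
    unfolding circuit_cost_circuit cost_variance_circuit qm.costs_def estimate_deviation_def by simp
qed

lemma succeeds_estimate_utility: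
  assumes c: "c \<in> K" and ys: "distinct ys" "set ys = Y" and ts: "distinct ts" "set ts \<subseteq> Y"
    and J: "(3 / 4) ^ Jt \<le> \<kappa>t" "(3 / 4) ^ Jf \<le> \<kappa>f"
    and bias: "real (card Y) / (real n)\<^sup>2 \<le> \<beta> \<or> set ts = Y \<and> real (card Y) * (289 * \<kappa>t\<^sup>2) \<le> \<beta>"
  shows "qm.succeeds (estimate_utility cr r Jt Jf c ys ts) {u. \<bar>u + total_spread c\<bar> \<le> 8 * \<kappa>f + \<beta>}
    (2 * real (length ts) * real Jt * shot_error r + real Jf * shot_error r)"
proof -
  have "qm.succeeds (\<lambda>k. mean_table cr r Jt c ts (\<lambda>_. 0) (\<lambda>\<mu>. estimate_deviation cr r Jf c ys \<mu> k))
    {u. \<bar>u + total_spread c\<bar> \<le> 8 * \<kappa>f + \<beta>} (2 * real (length ts) * real Jt * shot_error r + real Jf * shot_error r)"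
  proof (rule qm.succeeds_bind[OF succeeds_mean_table[OF c ts J(1)]])
    fix \<mu> assume m: "\<mu> \<in> {\<mu>. (\<forall>d. \<mu> d \<in> {0..1}) \<and> (\<forall>d. d \<notin> set ts \<longrightarrow> \<mu> d = 0) \<and> (\<forall>d\<in>set ts. mass c d * (wmean X (wt c d) - \<mu> d)\<^sup>2 \<le> 289 * \<kappa>t\<^sup>2)}"
    show "qm.succeeds (estimate_deviation cr r Jf c ys \<mu>) {u. \<bar>u + total_spread c\<bar> \<le> 8 * \<kappa>f + \<beta>} (real Jf * shot_error r)"
    proof (rule succeeds_estimate_deviation[OF c ys _ J(2)])
      show "real (card Y) / (real n)\<^sup>2 \<le> \<beta> \<or> (\<Sum>d\<in>Y. mass c d * (wmean X (wt c d) - \<mu> d)\<^sup>2) \<le> \<beta>"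
      proof (rule disj_forward[OF bias])
        assume h: "set ts = Y \<and> real (card Y) * (289 * \<kappa>t\<^sup>2) \<le> \<beta>"
        have "(\<Sum>d\<in>Y. mass c d * (wmean X (wt c d) - \<mu> d)\<^sup>2) \<le> (\<Sum>d\<in>Y. 289 * \<kappa>t\<^sup>2)"
          using m h by (intro sum_mono) auto
        then show "(\<Sum>d\<in>Y. mass c d * (wmean X (wt c d) - \<mu> d)\<^sup>2) \<le> \<beta>" using h by simp
      qed
    qed (use m in auto)
  qed (auto simp: shot_error_nonneg)
  moreover have "estimate_utility cr r Jt Jf c ys ts = (\<lambda>k. mean_table cr r Jt c ts (\<lambda>_. 0) (\<lambda>\<mu>. estimate_deviation cr r Jf c ys \<mu> k))"
    by (rule ext) (simp add: estimate_utility_def)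
  ultimately show ?thesis by simp
qed

lemma costs_estimate_utility:
  assumes c: "c \<in> K" and ys: "set ys = Y" and ts: "set ts \<subseteq> Y"
  shows "qm.costs (estimate_utility cr r Jt Jf c ys ts)
    (real (length ts) * (2 * (real Jt * (real r * 2 * (3 * (4 / 3) ^ Jt)))) +
     real Jf * (real r * real (2 + 2 * length ys + 4 * (n - 1)) * (3 * (4 / 3) ^ Jf)))"
proof -
  have "estimate_utility cr r Jt Jf c ys ts = (\<lambda>k. mean_table cr r Jt c ts (\<lambda>_. 0) (\<lambda>\<mu>. estimate_deviation cr r Jf c ys \<mu> k))"
    by (rule ext) (simp add: estimate_utility_def)
  then show ?thesis
    using qm.costs_bind[OF costs_mean_table[OF c ts] costs_estimate_deviation[OF c ys]] by simp
qed

end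

section \<open>Numerical differentiation\<close>

lemma controls_upd: "c \<in> controls n \<Longrightarrow> j < n \<Longrightarrow> c(j := t) \<in> controls n"
  by (auto simp: controls_def)

text \<open>The even terms of the Taylor expansions to the right and to the left of
  \<open>c j\<close> cancel, which leaves the mean of two third derivatives.\<close>

lemma central_difference:
  assumes j: "j < n" and c: "c \<in> controls n" and g: "thrice_partially_differentiable n g"
    and T: "\<And>c. c \<in> controls n \<Longrightarrow> \<bar>(partial_deriv j ^^ 3) g c\<bar> \<le> T" and h: "0 < h"
  shows "\<bar>(g (c(j := c j + h)) - g (c(j := c j - h))) / (2 * h) - partial_deriv j g c\<bar> \<le> T * h\<^sup>2 / 6"
proof -
  \<comment> \<open>The iterated partial derivatives on the line through \<open>c\<close> in
    direction \<open>j\<close>; on it they are ordinary derivatives of each other.\<close>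
  define D where "D m t = (partial_deriv j ^^ m) g (c(j := t))" for m t
  have der: "(D m has_real_derivative D (Suc m) t) (at t)" if "m < 3" for m t
  proof -
    have "c(j := t) \<in> controls n" by (rule controls_upd[OF c j])
    then have "(\<lambda>s. (partial_deriv j ^^ m) g ((c(j := t))(j := s))) field_differentiable at ((c(j := t)) j)"
      using g j that unfolding thrice_partially_differentiable_def by blast
    then have "D m field_differentiable at t" unfolding D_def by simp
    then have "(D m has_real_derivative deriv (D m) t) (at t)" by (rule DERIV_deriv_iff_field_differentiable[THEN iffD2])
    moreover have "D m = (\<lambda>t. (partial_deriv j ^^ m) g (c(j := t)))" by (rule ext) (simp add: D_def)
    then have "deriv (D m) t = D (Suc m) t" by (simp add: D_def partial_deriv_def)
    ultimately show ?thesis by simp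
  qed
  have bd: "\<bar>D 3 t\<bar> \<le> T" for t unfolding D_def by (rule T) (rule controls_upd[OF c j])
  have "\<exists>t. c j < t \<and> t < c j + h \<and> D 0 (c j + h) = (\<Sum>m<3. D m (c j) / fact m * (c j + h - c j) ^ m) + D 3 t / fact 3 * (c j + h - c j) ^ 3"
    by (rule Taylor_up[where a="c j"]) (use h der in auto)
  then obtain t1 where t1: "D 0 (c j + h) = (\<Sum>m<3. D m (c j) / fact m * h ^ m) + D 3 t1 / fact 3 * h ^ 3" by auto
  have "\<exists>t. c j - h < t \<and> t < c j \<and> D 0 (c j - h) = (\<Sum>m<3. D m (c j) / fact m * (c j - h - c j) ^ m) + D 3 t / fact 3 * (c j - h - c j) ^ 3"
    by (rule Taylor_down[where b="c j"]) (use h der in auto)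
  then obtain t2 where t2: "D 0 (c j - h) = (\<Sum>m<3. D m (c j) / fact m * (- h) ^ m) + D 3 t2 / fact 3 * (- h) ^ 3" by auto
  have 1: "D 0 (c j + h) - D 0 (c j - h) = 2 * h * D 1 (c j) + (D 3 t1 + D 3 t2) * h ^ 3 / 6"
    unfolding t1 t2 by (simp add: numeral_3_eq_3 fact_numeral algebra_simps power3_eq_cube power2_eq_square)
  have "(D 0 (c j + h) - D 0 (c j - h)) / (2 * h) - D 1 (c j) = (D 3 t1 + D 3 t2) * h\<^sup>2 / 12"
    unfolding 1 using h by (simp add: field_simps power2_eq_square power3_eq_cube)
  moreover have "\<bar>(D 3 t1 + D 3 t2) * h\<^sup>2 / 12\<bar> \<le> (2 * T) * h\<^sup>2 / 12"
  proof -
    have "\<bar>D 3 t1 + D 3 t2\<bar> \<le> 2 * T" using bd[of t1] bd[of t2] by linarith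
    then show ?thesis using mult_right_mono[of "\<bar>D 3 t1 + D 3 t2\<bar>" "2 * T" "h\<^sup>2"] by (simp add: abs_mult mult_ac)
  qed
  ultimately have "\<bar>(D 0 (c j + h) - D 0 (c j - h)) / (2 * h) - D 1 (c j)\<bar> \<le> (2 * T) * h\<^sup>2 / 12"
    by (simp only:)
  then show ?thesis by (simp add: D_def)
qed

lemma third_partials_bound:
  assumes "j < n" "c \<in> controls n" "bdd_above (third_partials n g)"
  shows "\<bar>(partial_deriv j ^^ 3) g c\<bar> \<le> Sup (third_partials n g)" "0 \<le> Sup (third_partials n g)"
proof -
  have m: "\<bar>(partial_deriv j ^^ 3) g c\<bar> \<in> third_partials n g" using assms unfolding third_partials_def by blast
  show 1: "\<bar>(partial_deriv j ^^ 3) g c\<bar> \<le> Sup (third_partials n g)" by (rule cSup_upper[OF m assms(3)])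
  show "0 \<le> Sup (third_partials n g)" using 1 abs_ge_zero order_trans by blast
qed

lemma utility_bounds:
  assumes M: "bayes_model n X Y P L" and U: "\<forall>x\<in>X. P x \<noteq> 0 \<longrightarrow> x \<in> {0..1}" and c: "c \<in> controls n"
  shows "- 1 \<le> utility X Y P L c" "utility X Y P L c \<le> 0"
proof -
  have fin: "finite X" "finite Y" and P: "\<And>x. x \<in> X \<Longrightarrow> 0 \<le> P x" "(\<Sum>x\<in>X. P x) = 1"
    and L: "\<And>x d. x \<in> X \<Longrightarrow> d \<in> Y \<Longrightarrow> 0 \<le> L d x c" "\<And>x. x \<in> X \<Longrightarrow> (\<Sum>d\<in>Y. L d x c) = 1"
    using M c by (auto simp: bayes_model_def)
  have w: "0 \<le> P x * L d x c" if "x \<in> X" "d \<in> Y" for x d using P L that by simp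
  have "spread X (\<lambda>x. P x * L d x c) \<le> (\<Sum>x\<in>X. P x * L d x c)" if d: "d \<in> Y" for d
  proof -
    have "spread X (\<lambda>x. P x * L d x c) \<le> (\<Sum>x\<in>X. P x * L d x c * (x - 0)\<^sup>2)"
      by (rule spread_le) (use fin w d in auto)
    also have "\<dots> \<le> (\<Sum>x\<in>X. P x * L d x c)"
    proof (rule sum_mono)
      fix x assume x: "x \<in> X"
      show "P x * L d x c * (x - 0)\<^sup>2 \<le> P x * L d x c"
      proof (cases "P x = 0")
        case False
        then have "\<bar>x\<bar> \<le> 1" using U x by auto
        then have "x\<^sup>2 \<le> 1" by (simp only: abs_square_le_1)
        then show ?thesis using w[OF x d] by (simp add: mult_left_le)
      qed simp
    qed
    finally show ?thesis .
  qed
  then have "(\<Sum>d\<in>Y. spread X (\<lambda>x. P x * L d x c)) \<le> (\<Sum>d\<in>Y. \<Sum>x\<in>X. P x * L d x c)" by (rule sum_mono)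
  also have "\<dots> = (\<Sum>x\<in>X. P x * (\<Sum>d\<in>Y. L d x c))" by (subst sum.swap) (simp add: sum_distrib_left)
  also have "\<dots> = 1" using L(2) P(2) by simp
  finally show "- 1 \<le> utility X Y P L c" by (simp add: utility_spread[OF fin])
  have "0 \<le> (\<Sum>d\<in>Y. spread X (\<lambda>x. P x * L d x c))" by (intro sum_nonneg spread_nonneg w)
  then show "utility X Y P L c \<le> 0" by (simp add: utility_spread[OF fin])
qed

text \<open>The utility varies by at most 1, so the difference quotient is at most
  \<open>1 / (2 * h) \<le> \<epsilon> / 2\<close>, and the remainder contributes the other half. The
  answer 0 is then accurate enough.\<close>

lemma small_partial_deriv:
  assumes M: "bayes_model n X Y P L" and U: "\<forall>x\<in>X. P x \<noteq> 0 \<longrightarrow> x \<in> {0..1}" and c: "c \<in> controls n" and j: "j < n"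
    and g: "thrice_partially_differentiable n (utility X Y P L)"
    and bdd: "bdd_above (third_partials n (utility X Y P L))"
    and T: "Sup (third_partials n (utility X Y P L)) = T" and h: "0 < h" "1 \<le> \<epsilon> * h" "T * h\<^sup>2 \<le> 3 * \<epsilon>"
  shows "\<bar>partial_deriv j (utility X Y P L) c\<bar> \<le> \<epsilon>"
proof -
  let ?u = "utility X Y P L"
  have cd: "\<bar>(?u (c(j := c j + h)) - ?u (c(j := c j - h))) / (2 * h) - partial_deriv j ?u c\<bar> \<le> T * h\<^sup>2 / 6"
    by (rule central_difference[OF j c g _ h(1)]) (use third_partials_bound[OF j _ bdd] T in auto)
  have "\<bar>?u (c(j := c j + h)) - ?u (c(j := c j - h))\<bar> \<le> 1"
    using utility_bounds[OF M U controls_upd[OF c j, of "c j + h"]] utility_bounds[OF M U controls_upd[OF c j, of "c j - h"]]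
    by linarith
  then have "\<bar>(?u (c(j := c j + h)) - ?u (c(j := c j - h))) / (2 * h)\<bar> \<le> \<epsilon> / 2"
    using h by (simp add: abs_divide field_simps)
  then show ?thesis using cd h(3) by linarith
qed

section \<open>Choice of parameters\<close>

text \<open>The number of rounds, each shrinking the interval by 3/4, after which a unit length is
  at most \<open>\<kappa>\<close>.\<close>

definition halvings :: "real \<Rightarrow> nat" where
  "halvings \<kappa> = nat \<lceil>ln (1 / \<kappa>) / ln (4 / 3)\<rceil>"

lemma halvings:
  assumes "0 < \<kappa>" "\<kappa> \<le> 1"
  shows "(3 / 4) ^ halvings \<kappa> \<le> \<kappa>" "(4 / 3) ^ halvings \<kappa> \<le> (4 / 3) / \<kappa>" "real (halvings \<kappa>) \<le> 4 * ln (1 / \<kappa>) + 1"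
proof -
  define a :: real where "a = ln (4 / 3)"
  define x where "x = ln (1 / \<kappa>) / a"
  \<comment> \<open>Yields \<open>ln (4 / 3) \<ge> 1 / 4\<close>, which is where the factor 4 in the
    bound on the rounds comes from.\<close>
  have "ln (3 / 4 :: real) \<le> 3 / 4 - 1" by (rule ln_le_minus_one) simp
  moreover have "ln (3 / 4 :: real) = - a" by (simp add: a_def ln_div)
  ultimately have a: "1 / 4 \<le> a" by simp
  have l0: "0 \<le> ln (1 / \<kappa>)" using assms by simp
  have x0: "0 \<le> x" using l0 a by (simp add: x_def)
  have "0 \<le> \<lceil>x\<rceil>" using x0 by simp
  then have J: "x \<le> real (halvings \<kappa>)" "real (halvings \<kappa>) \<le> x + 1"
    unfolding halvings_def a_def[symmetric] x_def[symmetric] by linarith+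
  have xa: "x * a = ln (1 / \<kappa>)" using a by (simp add: x_def)
  have e1: "exp (x * a) = 1 / \<kappa>" unfolding xa using assms by simp
  have p: "(4 / 3) ^ m = exp (real m * a)" for m by (simp add: a_def exp_of_nat_mult)
  have "1 / \<kappa> \<le> (4 / 3) ^ halvings \<kappa>" unfolding p e1[symmetric] using J a by (simp add: mult_right_mono)
  then have "1 / (4 / 3) ^ halvings \<kappa> \<le> \<kappa>" using assms by (simp add: field_simps)
  then show "(3 / 4) ^ halvings \<kappa> \<le> \<kappa>" by (simp add: power_divide)
  have "(4 / 3) ^ halvings \<kappa> \<le> exp ((x + 1) * a)" unfolding p using J a by (simp add: mult_right_mono)
  also have "\<dots> = (4 / 3) / \<kappa>" using e1 by (simp add: distrib_right exp_add a_def)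
  finally show "(4 / 3) ^ halvings \<kappa> \<le> (4 / 3) / \<kappa>" .
  have "x \<le> 4 * ln (1 / \<kappa>)"
    using mult_left_mono[OF a l0] a by (simp add: x_def field_simps)
  then show "real (halvings \<kappa>) \<le> 4 * ln (1 / \<kappa>) + 1" using J by simp
qed

definition shot_number :: "real \<Rightarrow> nat" where
  "shot_number Z = nat \<lceil>4 / sep_gap\<^sup>2 * ln (360 * Z ^ 3)\<rceil>"

lemma shot_number:
  assumes "3 \<le> Z"
  shows "exp (- (real (shot_number Z) * sep_gap\<^sup>2 / 4)) \<le> 1 / (360 * Z ^ 3)"
    "real (shot_number Z) \<le> (48 / sep_gap\<^sup>2 + 1) * ln Z"
proof -
  define G where "G = 4 / sep_gap\<^sup>2"
  have G: "0 < G" using sep_gap_pos by (simp add: G_def)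
  have Z3: "1 \<le> Z ^ 3" using assms by (intro one_le_power) simp
  have l0: "0 \<le> ln (360 * Z ^ 3)" using Z3 by simp
  have lnZ: "1 \<le> ln Z"
  proof -
    have "exp 1 \<le> Z" using exp_le assms by linarith
    then show ?thesis using assms ln_ge_iff[of Z 1] by simp
  qed
  have ln2: "ln 2 \<le> ln Z" using assms by simp
  have r: "G * ln (360 * Z ^ 3) \<le> real (shot_number Z)" "real (shot_number Z) \<le> G * ln (360 * Z ^ 3) + 1"
  proof -
    have "0 \<le> \<lceil>G * ln (360 * Z ^ 3)\<rceil>" using l0 G by (simp add: order_less_le_trans[of _ 0])
    then show "G * ln (360 * Z ^ 3) \<le> real (shot_number Z)" "real (shot_number Z) \<le> G * ln (360 * Z ^ 3) + 1"
      unfolding shot_number_def G_def[symmetric] by linarith+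
  qed
  have "ln (360 * Z ^ 3) \<le> real (shot_number Z) * sep_gap\<^sup>2 / 4"
    using r(1) sep_gap_pos by (simp add: G_def field_simps)
  then have "exp (- (real (shot_number Z) * sep_gap\<^sup>2 / 4)) \<le> exp (- ln (360 * Z ^ 3))" by simp
  also have "\<dots> = 1 / (360 * Z ^ 3)" using Z3 assms by (simp add: exp_minus inverse_eq_divide)
  finally show "exp (- (real (shot_number Z) * sep_gap\<^sup>2 / 4)) \<le> 1 / (360 * Z ^ 3)" .
  have "ln (360 * Z ^ 3) \<le> ln (2 ^ 9 * Z ^ 3)" using Z3 assms by simp
  also have "\<dots> = 9 * ln 2 + 3 * ln Z" using assms ln_realpow[of "2::real" 9] by (simp add: ln_mult_pos ln_realpow)
  also have "\<dots> \<le> 12 * ln Z" using ln2 by simp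
  finally have "G * ln (360 * Z ^ 3) \<le> G * (12 * ln Z)" using G by (intro mult_left_mono) auto
  then show "real (shot_number Z) \<le> (48 / sep_gap\<^sup>2 + 1) * ln Z"
    using r(2) lnZ by (simp add: G_def algebra_simps)
qed

text \<open>The number is 2 * 29 * (24 * 100 / 3 + 6 * 512): 29 bounds the rounds per logarithm,
  100/3 and 512 belong to the means and to the variance, and the leading 2 is the loss in passing
  from \<open>D / \<delta>\<close> to the query scale. The other factor bounds the repetitions per
  logarithm.\<close>

definition query_constant :: real where
  "query_constant = 224576 * (48 / sep_gap\<^sup>2 + 1)"

text \<open>Two logarithms arise, one from the number of rounds and one from the number of
  repetitions of each test. The remaining factor is of order \<open>D / \<delta>\<close> in both
  regimes.\<close>

lemma query_count:
  fixes D nn nt :: nat and \<delta> Q \<eta> Z :: real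
  assumes D: "1 \<le> D" and \<delta>: "0 < \<delta>" "\<delta> < 1 / 2" and Q: "real D / \<delta> \<le> 2 * Q" and \<eta>: "0 < \<eta>" "\<eta> < 1"
    and Z: "Z = 2 + Q + 1 / \<eta>" and Jt: "Jt = halvings (sqrt (\<delta> / real D) / 25)" and Jf: "Jf = halvings (\<delta> / 32)"
    and r: "r = shot_number Z" and nn: "nn = (if real D * \<delta> < 1 then 1 else nat \<lceil>sqrt (2 * real D / \<delta>)\<rceil>)"
    and nt: "nt = (if real D * \<delta> < 1 then D else 0)"
  shows "2 * (2 * real nt * real Jt * exp (- (real r * sep_gap\<^sup>2 / 4)) + real Jf * exp (- (real r * sep_gap\<^sup>2 / 4))) \<le> \<eta>" (is "2 * (2 * real nt * real Jt * ?\<rho> + real Jf * ?\<rho>) \<le> \<eta>")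
    and "2 * (real nt * (2 * (real Jt * (real r * 2 * (3 * (4 / 3) ^ Jt)))) +
      real Jf * (real r * real (2 + 2 * D + 4 * (nn - 1)) * (3 * (4 / 3) ^ Jf))) \<le> query_constant * Q * ln Z ^ 2"
proof -
  define q where "q = real D / \<delta>"
  have "real D * 1 \<le> real D * (1 / \<delta>)" "1 * (1 / \<delta>) \<le> real D * (1 / \<delta>)"
    using D \<delta> by (auto intro!: mult_left_mono mult_right_mono simp: field_simps)
  then have Dq: "real D \<le> q" and dq: "1 / \<delta> \<le> q" by (simp_all add: q_def)
  have "2 \<le> 1 / \<delta>" using \<delta> by (simp add: field_simps)
  then have q2: "2 \<le> q" using dq by simp
  have qQ: "q \<le> 2 * Q" using Q by (simp add: q_def)
  have \<eta>1: "1 < 1 / \<eta>" using \<eta> by simp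
  have Z3: "3 \<le> Z" and QZ: "Q \<le> Z" and \<eta>Z: "1 / \<eta> \<le> Z" using Z \<eta>1 qQ q2 by auto
  define \<Lambda> where "\<Lambda> = ln Z"
  have \<Lambda>1: "1 \<le> \<Lambda>"
  proof -
    have "exp 1 \<le> Z" using exp_le Z3 by linarith
    then show ?thesis using Z3 ln_ge_iff[of Z 1] by (simp add: \<Lambda>_def)
  qed
  have \<Lambda>Z: "\<Lambda> \<le> Z" using ln_le_minus_one[of Z] Z3 by (simp add: \<Lambda>_def)
  \<comment> \<open>\<open>32 * q\<close> dominates the inverse accuracies of both kinds of
    estimates, and \<open>q \<le> 2 * Q \<le> 2 * Z\<close>.\<close>
  have "ln (32 * q) \<le> ln (2 ^ 6 * Z)" using qQ QZ q2 Z3 by simp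
  also have "\<dots> = 6 * ln 2 + ln Z" using Z3 ln_realpow[of "2::real" 6] by (simp add: ln_mult_pos ln_realpow)
  also have "\<dots> \<le> 7 * \<Lambda>" using Z3 by (simp add: \<Lambda>_def)
  finally have lq: "ln (32 * q) \<le> 7 * \<Lambda>" .
  have jb: "real (halvings \<kappa>) \<le> 29 * \<Lambda>" if "0 < \<kappa>" "\<kappa> \<le> 1" "1 / \<kappa> \<le> 32 * q" for \<kappa>
  proof -
    have "ln (1 / \<kappa>) \<le> ln (32 * q)" using that q2 by simp
    then show ?thesis using halvings(3)[OF that(1,2)] lq \<Lambda>1 by linarith
  qed
  define \<kappa> where "\<kappa> = sqrt (\<delta> / real D) / 25"
  have k0: "0 < \<kappa>" using D \<delta> by (simp add: \<kappa>_def)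
  have kinv: "1 / \<kappa> = 25 * sqrt q" using D \<delta> by (simp add: \<kappa>_def q_def real_sqrt_divide field_simps)
  have "\<delta> / real D \<le> 1" using D \<delta> by (simp add: field_simps)
  then have "sqrt (\<delta> / real D) \<le> 1" by simp
  then have k1: "\<kappa> \<le> 1" unfolding \<kappa>_def by linarith
  have sq: "sqrt q \<le> q" using q2 by (intro real_le_lsqrt) (auto simp: power2_eq_square)
  have Jt': "real Jt \<le> 29 * \<Lambda>" unfolding Jt \<kappa>_def[symmetric] by (rule jb[OF k0 k1]) (use kinv sq q2 in simp)
  have f0: "0 < \<delta> / 32" and f1: "\<delta> / 32 \<le> 1" using \<delta> by auto
  have Jf': "real Jf \<le> 29 * \<Lambda>" unfolding Jf by (rule jb[OF f0 f1]) (use dq in simp)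
  have rho: "?\<rho> \<le> 1 / (360 * Z ^ 3)" unfolding r by (rule shot_number[OF Z3])
  have tlD: "real nt \<le> real D" using nt by simp
  have "2 * (2 * real nt * real Jt * ?\<rho> + real Jf * ?\<rho>) = 2 * (2 * real nt * real Jt + real Jf) * ?\<rho>"
    by (simp add: algebra_simps)
  also have "\<dots> \<le> 2 * (2 * q * (29 * Z) + q * (29 * Z)) * (1 / (360 * Z ^ 3))"
  proof (rule mult_mono[OF _ rho])
    have "real nt * real Jt \<le> q * (29 * Z)" using tlD Dq Jt' \<Lambda>Z Z3 q2 by (intro mult_mono) auto
    moreover have "real Jf \<le> q * (29 * Z)"
    proof -
      have "real Jf \<le> 1 * (29 * Z)" using Jf' \<Lambda>Z by simp
      also have "\<dots> \<le> q * (29 * Z)" using q2 Z3 by (intro mult_right_mono) auto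
      finally show ?thesis .
    qed
    ultimately show "2 * (2 * real nt * real Jt + real Jf) \<le> 2 * (2 * q * (29 * Z) + q * (29 * Z))" by (simp add: algebra_simps)
  qed (use q2 Z3 in auto)
  also have "\<dots> = 174 * q / (360 * Z\<^sup>2)" using Z3 by (simp add: field_simps power2_eq_square power3_eq_cube)
  also have "\<dots> \<le> 174 * (2 * Z) / (360 * Z\<^sup>2)" using qQ QZ Z3 by (intro divide_right_mono) auto
  also have "\<dots> \<le> 1 / Z" using Z3 by (simp add: field_simps power2_eq_square)
  also have "\<dots> \<le> \<eta>" using \<eta>Z \<eta> Z3 by (simp add: field_simps)
  finally show "2 * (2 * real nt * real Jt * ?\<rho> + real Jf * ?\<rho>) \<le> \<eta>" .
  define R where "R = 48 / sep_gap\<^sup>2 + 1"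
  have R0: "0 \<le> R" by (simp add: R_def)
  have r': "real r \<le> R * \<Lambda>" unfolding r R_def \<Lambda>_def by (rule shot_number[OF Z3])
  have Jr: "real J * real r \<le> 29 * R * \<Lambda>\<^sup>2" if "real J \<le> 29 * \<Lambda>" for J
  proof -
    have "real J * real r \<le> (29 * \<Lambda>) * (R * \<Lambda>)" using that r' \<Lambda>1 by (intro mult_mono) auto
    then show ?thesis by (simp add: power2_eq_square mult_ac)
  qed
  have t1: "real nt * (4 / 3) ^ Jt \<le> 100 / 3 * q"
  proof (cases "real D * \<delta> < 1")
    case True
    have "(4 / 3) ^ Jt \<le> (4 / 3) * (1 / \<kappa>)" using halvings(2)[OF k0 k1] unfolding Jt \<kappa>_def[symmetric] by simp
    then have "(4 / 3) ^ Jt \<le> 100 / 3 * sqrt q" unfolding kinv by simp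
    \<comment> \<open>This is where \<open>D * \<delta> < 1\<close> enters: estimating the means is
      then no more expensive than estimating the variance.\<close>
    moreover have "sqrt q \<le> 1 / \<delta>"
    proof (rule real_le_lsqrt)
      have "q = real D * \<delta> * (1 / \<delta>)\<^sup>2" using \<delta> by (simp add: q_def power2_eq_square)
      also have "\<dots> \<le> 1 * (1 / \<delta>)\<^sup>2" using True by (intro mult_right_mono) auto
      finally show "q \<le> (1 / \<delta>)\<^sup>2" by simp
    qed (use q2 \<delta> in auto)
    ultimately have "(4 / 3) ^ Jt \<le> 100 / 3 * (1 / \<delta>)" by simp
    then have "real D * (4 / 3) ^ Jt \<le> real D * (100 / 3 * (1 / \<delta>))" by (intro mult_left_mono) auto
    then show ?thesis using True nt by (simp add: q_def)
  qed (use nt q2 in simp)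
  have n1: "real (2 + 2 * D + 4 * (nn - 1)) \<le> 12 * real D"
  proof (cases "real D * \<delta> < 1")
    case True
    then show ?thesis using nn D by simp
  next
    case False
    \<comment> \<open>Conversely \<open>D * \<delta> \<ge> 1\<close> keeps the Grover powers within
      the order of the \<open>2 * D\<close> queries that loading the tables costs anyway.\<close>
    have "sqrt (2 * real D / \<delta>) \<le> 2 * real D"
    proof (rule real_le_lsqrt)
      have "1 / \<delta> \<le> real D" using False \<delta> by (simp add: field_simps)
      then have "2 * real D * (1 / \<delta>) \<le> 2 * real D * real D" by (intro mult_left_mono) auto
      also have "\<dots> \<le> (2 * real D)\<^sup>2" by (simp add: power2_eq_square)
      finally show "2 * real D / \<delta> \<le> (2 * real D)\<^sup>2" by simp
    qed (use \<delta> in auto)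
    moreover have "real (nn - 1) \<le> sqrt (2 * real D / \<delta>)"
    proof -
      have "0 \<le> sqrt (2 * real D / \<delta>)" using \<delta> by simp
      moreover have "nn = nat \<lceil>sqrt (2 * real D / \<delta>)\<rceil>" using False nn by simp
      ultimately show ?thesis by linarith
    qed
    ultimately have "real (nn - 1) \<le> 2 * real D" by simp
    then show ?thesis using D by simp
  qed
  have t2: "real (2 + 2 * D + 4 * (nn - 1)) * (4 / 3) ^ Jf \<le> 512 * q"
  proof -
    have "(4 / 3) ^ Jf \<le> 128 / 3 * (1 / \<delta>)" using halvings(2)[OF f0 f1] unfolding Jf by simp
    then have "real (2 + 2 * D + 4 * (nn - 1)) * (4 / 3) ^ Jf \<le> (12 * real D) * (128 / 3 * (1 / \<delta>))"
      using n1 by (intro mult_mono) auto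
    then show ?thesis by (simp add: q_def)
  qed
  have "2 * (real nt * (2 * (real Jt * (real r * 2 * (3 * (4 / 3) ^ Jt)))) +
      real Jf * (real r * real (2 + 2 * D + 4 * (nn - 1)) * (3 * (4 / 3) ^ Jf)))
    = 24 * ((real Jt * real r) * (real nt * (4 / 3) ^ Jt)) + 6 * ((real Jf * real r) * (real (2 + 2 * D + 4 * (nn - 1)) * (4 / 3) ^ Jf))"
    by (simp add: algebra_simps)
  also have "\<dots> \<le> 24 * ((29 * R * \<Lambda>\<^sup>2) * (100 / 3 * q)) + 6 * ((29 * R * \<Lambda>\<^sup>2) * (512 * q))"
  proof (rule add_mono)
    show "24 * ((real Jt * real r) * (real nt * (4 / 3) ^ Jt)) \<le> 24 * ((29 * R * \<Lambda>\<^sup>2) * (100 / 3 * q))"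
      by (rule mult_left_mono[OF mult_mono[OF Jr[OF Jt'] t1]]) (use R0 in simp_all)
    show "6 * ((real Jf * real r) * (real (2 + 2 * D + 4 * (nn - 1)) * (4 / 3) ^ Jf)) \<le> 6 * ((29 * R * \<Lambda>\<^sup>2) * (512 * q))"
      by (rule mult_left_mono[OF mult_mono[OF Jr[OF Jf'] t2]]) (use R0 in simp_all)
  qed
  also have "\<dots> = 112288 * R * \<Lambda>\<^sup>2 * q" by simp
  also have "\<dots> \<le> 112288 * R * \<Lambda>\<^sup>2 * (2 * Q)" using qQ R0 by (intro mult_left_mono) auto
  also have "\<dots> = query_constant * Q * ln Z ^ 2" by (simp add: query_constant_def R_def \<Lambda>_def)
  finally show "2 * (real nt * (2 * (real Jt * (real r * 2 * (3 * (4 / 3) ^ Jt)))) +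
      real Jf * (real r * real (2 + 2 * D + 4 * (nn - 1)) * (3 * (4 / 3) ^ Jf))) \<le> query_constant * Q * ln Z ^ 2" .
qed

section \<open>Truncated likelihoods\<close>

lemma likelihood_bits:
  assumes "0 \<le> p"
  shows "real (likelihood_bits b p) \<le> 2 ^ b * p" "2 ^ b * p \<le> real (likelihood_bits b p) + 1"
proof -
  have "0 \<le> \<lfloor>2 ^ b * p\<rfloor>" using assms by simp
  then have "real (likelihood_bits b p) = of_int \<lfloor>2 ^ b * p\<rfloor>" by (simp add: likelihood_bits_def)
  then show "real (likelihood_bits b p) \<le> 2 ^ b * p" "2 ^ b * p \<le> real (likelihood_bits b p) + 1" by linarith+
qed

lemma likelihood_bits_model:
  assumes M: "bayes_model n X Y P L" and c: "c \<in> controls n" and x: "x \<in> X"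
  shows "d \<in> Y \<Longrightarrow> likelihood_bits b (L d x c) \<le> 2 ^ b" "(\<Sum>d\<in>Y. likelihood_bits b (L d x c)) \<le> 2 ^ b"
proof -
  have fin: "finite Y" and L: "\<And>d. d \<in> Y \<Longrightarrow> 0 \<le> L d x c" "(\<Sum>d\<in>Y. L d x c) = 1"
    using M c x by (auto simp: bayes_model_def)
  have "real (\<Sum>d\<in>Y. likelihood_bits b (L d x c)) \<le> (\<Sum>d\<in>Y. 2 ^ b * L d x c)"
    unfolding of_nat_sum by (intro sum_mono likelihood_bits L)
  also have "\<dots> = real (2 ^ b)" using L(2) by (simp flip: sum_distrib_left)
  finally show s: "(\<Sum>d\<in>Y. likelihood_bits b (L d x c)) \<le> 2 ^ b" by (simp only: of_nat_le_iff)
  show "likelihood_bits b (L d x c) \<le> 2 ^ b" if "d \<in> Y"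
    using member_le_sum[OF that, of "\<lambda>d. likelihood_bits b (L d x c)"] fin s by simp
qed

text \<open>Each likelihood loses at most \<open>1 / 2 ^ b\<close>. As the prior has total mass 1,
  the weights of one outcome change by no more than that in total, and so does each of the
  \<open>card Y\<close> spreads.\<close>

lemma truncated_utility:
  assumes M: "bayes_model n X Y P L" and U: "\<forall>x\<in>X. P x \<noteq> 0 \<longrightarrow> x \<in> {0..1}" and c: "c \<in> controls n"
  shows "\<bar>(\<Sum>d\<in>Y. spread X (\<lambda>x. P x * (real (likelihood_bits b (L d x c)) / 2 ^ b))) + utility X Y P L c\<bar> \<le> real (card Y) / 2 ^ b"
proof -
  have fin: "finite X" "finite Y" and P: "\<And>x. x \<in> X \<Longrightarrow> 0 \<le> P x" "(\<Sum>x\<in>X. P x) = 1"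
    and L: "\<And>x d. x \<in> X \<Longrightarrow> d \<in> Y \<Longrightarrow> 0 \<le> L d x c"
    using M c by (auto simp: bayes_model_def)
  let ?w = "\<lambda>d x. P x * (real (likelihood_bits b (L d x c)) / 2 ^ b)"
  let ?w' = "\<lambda>d x. P x * L d x c"
  have w: "0 \<le> ?w d x" "0 \<le> ?w' d x" if "x \<in> X" "d \<in> Y" for x d using P(1) L that by auto
  have dw: "\<bar>?w d x - ?w' d x\<bar> \<le> P x / 2 ^ b" if "x \<in> X" "d \<in> Y" for x d
  proof -
    have "\<bar>real (likelihood_bits b (L d x c)) / 2 ^ b - L d x c\<bar> \<le> 1 / 2 ^ b"
    proof -
      have "real (likelihood_bits b (L d x c)) / 2 ^ b \<le> L d x c"
        using likelihood_bits(1)[OF L[OF that], of b] by (simp add: pos_divide_le_eq mult.commute)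
      moreover have "L d x c \<le> (real (likelihood_bits b (L d x c)) + 1) / 2 ^ b"
        using likelihood_bits(2)[OF L[OF that], of b] by (simp add: pos_le_divide_eq mult.commute)
      ultimately show ?thesis unfolding add_divide_distrib by linarith
    qed
    then have "P x * \<bar>real (likelihood_bits b (L d x c)) / 2 ^ b - L d x c\<bar> \<le> P x * (1 / 2 ^ b)"
      using P(1) that by (intro mult_left_mono) auto
    moreover have "?w d x - ?w' d x = P x * (real (likelihood_bits b (L d x c)) / 2 ^ b - L d x c)"
      by (simp add: algebra_simps)
    ultimately show ?thesis using P(1)[OF that(1)] by (simp add: abs_mult)
  qed
  have sum: "(\<Sum>x\<in>X. \<bar>?w d x - ?w' d x\<bar>) \<le> 1 / 2 ^ b" if "d \<in> Y" for d
  proof -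
    have "(\<Sum>x\<in>X. \<bar>?w d x - ?w' d x\<bar>) \<le> (\<Sum>x\<in>X. P x / 2 ^ b)" using dw that by (intro sum_mono) auto
    also have "\<dots> = 1 / 2 ^ b" using P(2) by (simp flip: sum_divide_distrib)
    finally show ?thesis .
  qed
  have "\<bar>spread X (?w d) - spread X (?w' d)\<bar> \<le> 1 / 2 ^ b" if d: "d \<in> Y" for d
  proof -
    have "spread X (?w d) \<le> spread X (?w' d) + (\<Sum>x\<in>X. \<bar>?w d x - ?w' d x\<bar>)"
      by (rule spread_perturb_le[OF fin(1)]) (use w d U in auto)
    moreover have "spread X (?w' d) \<le> spread X (?w d) + (\<Sum>x\<in>X. \<bar>?w' d x - ?w d x\<bar>)"
      by (rule spread_perturb_le[OF fin(1)]) (use w d U in auto)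
    ultimately show ?thesis using sum[OF d] by (simp add: abs_minus_commute abs_le_iff)
  qed
  then have "(\<Sum>d\<in>Y. \<bar>spread X (?w d) - spread X (?w' d)\<bar>) \<le> (\<Sum>d\<in>Y. 1 / 2 ^ b)" by (rule sum_mono)
  moreover have "(\<Sum>d\<in>Y. spread X (?w d)) + utility X Y P L c = (\<Sum>d\<in>Y. spread X (?w d) - spread X (?w' d))"
    by (simp add: utility_spread[OF fin] sum_subtractf)
  moreover have "(\<Sum>d\<in>Y. 1 / 2 ^ b) = real (card Y) / 2 ^ b" by simp
  ultimately show ?thesis using sum_abs[of "\<lambda>d. spread X (?w d) - spread X (?w' d)" Y] by linarith
qed

context rooted_registers
begin

lemma outp_Output: "qm.outp (Output u) R = (if u \<in> R then 1 else 0)"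
  using norm2_on_unit_at[OF finite_Bs J_root_in[OF cr]] by (simp add: qm.outp_def weight_norm2_on)

lemma expq_Output: "qm.expq (Output u) = 0"
  by (simp add: qm.expq_def)

text \<open>Each of the two utilities contributes estimation error, bias and truncation error; the
  denominator \<open>2 * h\<close> turns their sum into one such error divided by \<open>h\<close>.
  Failure probabilities and costs double.\<close>

lemma difference_quotient_program:
  fixes r :: nat
  assumes c: "c1 \<in> K" "c2 \<in> K" and ys: "distinct ys" "set ys = Y" and ts: "distinct ts" "set ts \<subseteq> Y"
    and J: "(3 / 4) ^ Jt \<le> \<kappa>t" "(3 / 4) ^ Jf \<le> \<kappa>f"
    and bias: "real (card Y) / (real n)\<^sup>2 \<le> \<beta> \<or> set ts = Y \<and> real (card Y) * (289 * \<kappa>t\<^sup>2) \<le> \<beta>"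
    and U: "\<bar>total_spread c1 + U1\<bar> \<le> \<sigma>" "\<bar>total_spread c2 + U2\<bar> \<le> \<sigma>"
    and h: "0 < h" and err: "\<bar>(U1 - U2) / (2 * h) - U'\<bar> \<le> e" "(8 * \<kappa>f + \<beta> + \<sigma>) / h + e \<le> \<epsilon>"
  defines "\<rho> \<equiv> 2 * real (length ts) * real Jt * shot_error r + real Jf * shot_error r"
    and "N \<equiv> real (length ts) * (2 * (real Jt * (real r * 2 * (3 * (4 / 3) ^ Jt)))) +
     real Jf * (real r * real (2 + 2 * length ys + 4 * (n - 1)) * (3 * (4 / 3) ^ Jf))"
    and "p \<equiv> estimate_utility cr r Jt Jf c1 ys ts (\<lambda>u. estimate_utility cr r Jt Jf c2 ys ts (\<lambda>u'. Output ((u - u') / (2 * h))))"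
  shows "1 - 2 * \<rho> \<le> qm.outp p {x. \<bar>x - U'\<bar> \<le> \<epsilon>}" "qm.expq p \<le> 2 * N"
proof -
  let ?R = "{x. \<bar>x - U'\<bar> \<le> \<epsilon>}"
  have s: "qm.succeeds (estimate_utility cr r Jt Jf c ys ts) {u. \<bar>u + total_spread c\<bar> \<le> 8 * \<kappa>f + \<beta>} \<rho>" if "c \<in> K" for c
    unfolding \<rho>_def by (rule succeeds_estimate_utility[OF that ys ts J bias])
  have \<rho>0: "0 \<le> \<rho>" by (simp add: \<rho>_def shot_error_nonneg)
  have inR: "(u - u') / (2 * h) \<in> ?R" if "\<bar>u + total_spread c1\<bar> \<le> 8 * \<kappa>f + \<beta>" "\<bar>u' + total_spread c2\<bar> \<le> 8 * \<kappa>f + \<beta>" for u u'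
  proof -
    have "\<bar>u - U1\<bar> \<le> 8 * \<kappa>f + \<beta> + \<sigma>" "\<bar>u' - U2\<bar> \<le> 8 * \<kappa>f + \<beta> + \<sigma>" using that U by linarith+
    moreover have "\<bar>(u - u') - (U1 - U2)\<bar> \<le> \<bar>u - U1\<bar> + \<bar>u' - U2\<bar>" by linarith
    ultimately have "\<bar>(u - u') - (U1 - U2)\<bar> \<le> 2 * (8 * \<kappa>f + \<beta> + \<sigma>)" by simp
    then have "\<bar>(u - u') - (U1 - U2)\<bar> / (2 * h) \<le> 2 * (8 * \<kappa>f + \<beta> + \<sigma>) / (2 * h)" using h by (intro divide_right_mono) auto
    moreover have "(u - u') / (2 * h) - (U1 - U2) / (2 * h) = ((u - u') - (U1 - U2)) / (2 * h)"
      by (simp add: diff_divide_distrib)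
    moreover have "2 * (8 * \<kappa>f + \<beta> + \<sigma>) / (2 * h) = (8 * \<kappa>f + \<beta> + \<sigma>) / h"
      by (rule mult_divide_mult_cancel_left) simp
    moreover have "\<bar>((u - u') - (U1 - U2)) / (2 * h)\<bar> = \<bar>(u - u') - (U1 - U2)\<bar> / (2 * h)"
      using h by (simp add: abs_divide)
    ultimately have "\<bar>(u - u') / (2 * h) - (U1 - U2) / (2 * h)\<bar> \<le> (8 * \<kappa>f + \<beta> + \<sigma>) / h"
      by (simp only:)
    then show ?thesis using err unfolding mem_Collect_eq by linarith
  qed
  have "1 - \<rho> \<le> qm.outp (estimate_utility cr r Jt Jf c2 ys ts (\<lambda>u'. Output ((u - u') / (2 * h)))) ?R"
    if u: "\<bar>u + total_spread c1\<bar> \<le> 8 * \<kappa>f + \<beta>" for u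
  proof -
    have "1 - \<rho> - 0 \<le> qm.outp (estimate_utility cr r Jt Jf c2 ys ts (\<lambda>u'. Output ((u - u') / (2 * h)))) ?R"
      by (rule qm.succeedsD[OF s[OF c(2)]]) (use inR[OF u] in \<open>auto simp: outp_Output\<close>)
    then show ?thesis by simp
  qed
  then have "1 - \<rho> - \<rho> \<le> qm.outp p ?R"
    unfolding p_def by (intro qm.succeedsD[OF s[OF c(1)] \<rho>0]) simp
  then show "1 - 2 * \<rho> \<le> qm.outp p ?R" by simp
  have k: "qm.costs (estimate_utility cr r Jt Jf c ys ts) N" if "c \<in> K" for c
    unfolding N_def by (rule costs_estimate_utility[OF that ys(2) ts(2)])
  have "qm.expq (estimate_utility cr r Jt Jf c2 ys ts (\<lambda>u'. Output ((u - u') / (2 * h)))) \<le> N + 0" for u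
    by (rule qm.costsD[OF k[OF c(2)]]) (simp add: expq_Output)
  then have "qm.expq p \<le> N + (N + 0)"
    unfolding p_def by (rule qm.costsD[OF k[OF c(1)]])
  then show "qm.expq p \<le> 2 * N" by simp
qed

end

text \<open>The data \<open>P\<close>, \<open>L\<close> and \<open>V\<close> come last: one program
  serves all models with the given sizes and the given bound \<open>T\<close>. The exponent 2 of the
  logarithm is that of \<open>query_count\<close>.\<close>

theorem theorem4:
  shows "\<exists>(C::real) (k::nat). \<forall>(n::nat) (j::nat) (X::real set) (x0::real) (Y::real set) (D::nat)
      (c::control) (T::real) (\<epsilon>::real) (\<eta>::real).
    finite X \<and> x0 \<in> X \<and> finite Y \<and> Y \<noteq> {} \<and> card Y = D \<and> j < n \<and> c \<in> controls n \<and>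
    0 < \<epsilon> \<and> 0 < \<eta> \<and> \<eta> < 1 \<longrightarrow>
    (\<exists>b0. \<forall>b\<ge>b0. \<exists>K W a p.
       finite K \<and> K \<subseteq> controls n \<and>
       a \<in> basis_states X Y K b W \<and> fst a = x0 \<and>
       well_formed (basis_states X Y K b W) p \<and>
       (\<forall>P L V.
          bayes_model n X Y P L \<and>
          (\<forall>x\<in>X. P x \<noteq> 0 \<longrightarrow> x \<in> {0..1}) \<and>
          thrice_partially_differentiable n (utility X Y P L) \<and>
          bdd_above (third_partials n (utility X Y P L)) \<and>
          Sup (third_partials n (utility X Y P L)) = T \<and>
          \<epsilon> \<le> (MIN d\<in>Y. 1 / 2 * evidence X P L c d) \<and>
          prepares_prior X x0 P V \<longrightarrow>
          output_prob (basis_states X Y K b W) V (likelihood_op b L) p (basis_vector a)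
            {r. \<bar>r - partial_deriv j (utility X Y P L) c\<bar> \<le> \<epsilon>} \<ge> 1 - \<eta> \<and>
          expected_queries (basis_states X Y K b W) V (likelihood_op b L) p (basis_vector a)
            \<le> C * query_scale D T \<epsilon> * ln (2 + query_scale D T \<epsilon> + 1 / \<eta>) ^ k))"
proof (rule exI[of _ query_constant], rule exI[of _ 2], intro allI impI, elim conjE)
  fix n j :: nat and X :: "real set" and x0 :: real and Y :: "real set" and D :: nat
    and c :: control and T \<epsilon> \<eta> :: real
  assume finX: "finite X" and x0: "x0 \<in> X" and finY: "finite Y" and Yne: "Y \<noteq> {}" and D: "card Y = D"
    and j: "j < n" and c: "c \<in> controls n" and \<epsilon>: "0 < \<epsilon>" and \<eta>: "0 < \<eta>" "\<eta> < 1"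
  obtain d0 where d0: "d0 \<in> Y" using Yne by blast
  have D1: "1 \<le> D" using D finY Yne by (metis card_gt_0_iff One_nat_def Suc_leI)
  have C0: "0 \<le> query_constant" by (simp add: query_constant_def)
  \<comment> \<open>For \<open>T \<le> 0\<close> the value \<open>1 / \<epsilon>\<close> makes
    \<open>\<epsilon> * h = 1\<close>, which leads to the branch without queries.\<close>
  define h where "h = (if T \<le> 0 then 1 / \<epsilon> else sqrt (3 * \<epsilon> / T))"
  define \<delta> where "\<delta> = \<epsilon> * h / 2"
  let ?Q = "query_scale D T \<epsilon>"
  have h: "0 < h" using \<epsilon> by (simp add: h_def)
  have Th: "T * h\<^sup>2 \<le> 3 * \<epsilon>" using \<epsilon> by (auto simp: h_def mult_nonpos_nonneg order_trans[of _ 0])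
  have \<delta>0: "0 < \<delta>" using \<epsilon> h by (simp add: \<delta>_def)
  show "\<exists>b0. \<forall>b\<ge>b0. \<exists>K W a p.
       finite K \<and> K \<subseteq> controls n \<and>
       a \<in> basis_states X Y K b W \<and> fst a = x0 \<and>
       well_formed (basis_states X Y K b W) p \<and>
       (\<forall>P L V.
          bayes_model n X Y P L \<and>
          (\<forall>x\<in>X. P x \<noteq> 0 \<longrightarrow> x \<in> {0..1}) \<and>
          thrice_partially_differentiable n (utility X Y P L) \<and>
          bdd_above (third_partials n (utility X Y P L)) \<and>
          Sup (third_partials n (utility X Y P L)) = T \<and>
          \<epsilon> \<le> (MIN d\<in>Y. 1 / 2 * evidence X P L c d) \<and>
          prepares_prior X x0 P V \<longrightarrow>
          output_prob (basis_states X Y K b W) V (likelihood_op b L) p (basis_vector a)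
            {r. \<bar>r - partial_deriv j (utility X Y P L) c\<bar> \<le> \<epsilon>} \<ge> 1 - \<eta> \<and>
          expected_queries (basis_states X Y K b W) V (likelihood_op b L) p (basis_vector a)
            \<le> query_constant * ?Q * ln (2 + ?Q + 1 / \<eta>) ^ 2)"
  proof (cases "1 \<le> \<epsilon> * h")
    case True
    show ?thesis
    proof (intro exI[of _ 0] allI impI, rule exI[of _ "{c}"], rule exI[of _ 1], rule exI[of _ "(x0, d0, c, 0, 0)"],
        rule exI[of _ "Output 0"], intro conjI allI impI, goal_cases)
      case (6 b P L V)
      let ?B = "basis_states X Y {c} b 1"
      have a: "(x0, d0, c, 0, 0) \<in> ?B" and fin: "finite ?B" using finX finY x0 d0 by (auto simp: basis_states_def)
      have "\<bar>partial_deriv j (utility X Y P L) c\<bar> \<le> \<epsilon>"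
        by (rule small_partial_deriv[OF _ _ c j _ _ _ h True Th]) (use 6 in auto)
      then show ?case using norm2_on_unit_at[OF fin a] \<eta>
        by (simp add: weight_norm2_on basis_vector_unit_at)
    next
      case (7 b P L V)
      then have "0 \<le> T" using third_partials_bound(2)[OF j c] by blast
      then have "0 \<le> ?Q" using \<epsilon> by (simp add: query_scale_def)
      then show ?case using C0 by simp
    qed (use c finX finY x0 d0 in \<open>auto simp: basis_states_def\<close>)
  next
    case False
    have T: "0 < T"
    proof (rule ccontr)
      assume "\<not> 0 < T"
      then have "\<epsilon> * h = 1" using \<epsilon> by (simp add: h_def)
      then show False using False by simp
    qed
    have hT: "h = sqrt (3 * \<epsilon> / T)" using T by (simp add: h_def)
    have Th': "T * h\<^sup>2 = 3 * \<epsilon>" using T \<epsilon> by (simp add: hT)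
    have \<delta>1: "\<delta> < 1 / 2" using False by (simp add: \<delta>_def)
    have Q0: "0 \<le> ?Q" using T \<epsilon> by (simp add: query_scale_def)
    have Q: "real D / \<delta> \<le> 2 * ?Q"
    proof -
      have p: "\<epsilon> powr (3 / 2) = \<epsilon> * sqrt \<epsilon>"
      proof -
        have "\<epsilon> powr (1 + 1 / 2) = \<epsilon> powr 1 * \<epsilon> powr (1 / 2)" by (rule powr_add)
        then show ?thesis using \<epsilon> by (simp add: powr_half_sqrt)
      qed
      have "h = sqrt 3 * sqrt \<epsilon> / sqrt T" by (simp add: hT real_sqrt_mult real_sqrt_divide)
      \<comment> \<open>So \<open>D / \<delta>\<close> equals the query scale times 2 / sqrt
        3.\<close>
      then have "\<delta> * ?Q = real D * (sqrt 3 / 2)" using T \<epsilon> by (simp add: \<delta>_def query_scale_def p field_simps)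
      moreover have "1 \<le> sqrt 3" by simp
      then have "real D * (1 / 2) \<le> real D * (sqrt 3 / 2)" by (intro mult_left_mono) auto
      ultimately have "real D \<le> 2 * (\<delta> * ?Q)" by simp
      then show ?thesis using \<delta>0 by (simp add: field_simps)
    qed
    define cp where "cp = c(j := c j + h)"
    define cm where "cm = c(j := c j - h)"
    define K where "K = {cp, cm}"
    define ys where "ys = sorted_list_of_set Y"
    define ts where "ts = (if real D * \<delta> < 1 then ys else [])"
    define nn where "nn = (if real D * \<delta> < 1 then 1 else nat \<lceil>sqrt (2 * real D / \<delta>)\<rceil>)"
    define Jt where "Jt = halvings (sqrt (\<delta> / real D) / 25)"
    define Jf where "Jf = halvings (\<delta> / 32)"
    define r where "r = shot_number (2 + ?Q + 1 / \<eta>)"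
    have ys: "distinct ys" "set ys = Y" "length ys = D" using finY D by (auto simp: ys_def)
    have ts: "distinct ts" "set ts \<subseteq> Y" "length ts = (if real D * \<delta> < 1 then D else 0)"
      using ys by (auto simp: ts_def)
    have K: "finite K" "K \<subseteq> controls n" "cp \<in> K" "cm \<in> K"
      using controls_upd[OF c j] by (auto simp: K_def cp_def cm_def)
    have s0: "0 < sqrt (2 * real D / \<delta>)" using D1 \<delta>0 by simp
    have nn0: "0 < nn" using s0 by (simp add: nn_def)
    \<comment> \<open>Precision enough for the truncation error of each utility to be at most
      \<open>\<delta> / 4\<close>.\<close>
    obtain b0 where b0: "4 * real D / \<delta> < 2 ^ b0" using real_arch_pow[of 2 "4 * real D / \<delta>"] by auto
    have Jt: "(3 / 4) ^ Jt \<le> sqrt (\<delta> / real D) / 25" unfolding Jt_def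
    proof (rule halvings(1))
      show "0 < sqrt (\<delta> / real D) / 25" using \<delta>0 D1 by simp
      have "\<delta> / real D \<le> 1" using \<delta>1 D1 by (simp add: field_simps)
      then have "sqrt (\<delta> / real D) \<le> 1" by simp
      then show "sqrt (\<delta> / real D) / 25 \<le> 1" by linarith
    qed
    have Jf: "(3 / 4) ^ Jf \<le> \<delta> / 32" unfolding Jf_def by (rule halvings(1)) (use \<delta>0 \<delta>1 in auto)
    have bias: "real (card Y) / (real nn)\<^sup>2 \<le> \<delta> / 2 \<or> set ts = Y \<and> real (card Y) * (289 * (sqrt (\<delta> / real D) / 25)\<^sup>2) \<le> \<delta> / 2"
    proof (cases "real D * \<delta> < 1")
      case True
      \<comment> \<open>289 / 625 is below 1/2; the divisor 25 in the accuracy of the means is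
        chosen for this.\<close>
      then show ?thesis using ys D D1 \<delta>0 by (simp add: ts_def power_divide)
    next
      case False
      have "sqrt (2 * real D / \<delta>) \<le> real nn" using False s0 by (simp add: nn_def)
      then have "(sqrt (2 * real D / \<delta>))\<^sup>2 \<le> (real nn)\<^sup>2" using s0 by (intro power_mono) auto
      then have "2 * real D / \<delta> \<le> (real nn)\<^sup>2" using \<delta>0 by simp
      then have "real D / (real nn)\<^sup>2 \<le> \<delta> / 2" using \<delta>0 nn0 by (simp add: field_simps)
      then show ?thesis using D by simp
    qed
    note count = query_count[OF D1 \<delta>0 \<delta>1 Q \<eta> refl Jt_def Jf_def r_def nn_def ts(3)]
    show ?thesis
    proof (intro exI[of _ b0] allI impI)
      fix b assume b: "b0 \<le> b"
      have "(2::real) ^ b0 \<le> 2 ^ b" using b by (intro power_increasing) auto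
      then have "4 * real D / \<delta> \<le> 2 ^ b" using b0 by linarith
      then have trunc: "real (card Y) / 2 ^ b \<le> \<delta> / 4" using \<delta>0 D by (simp add: field_simps)
      interpret R: registers X Y K b nn x0 d0
        by unfold_locales (use finX finY K x0 d0 nn0 in auto)
      let ?a = "R.J (R.root cp)"
      let ?p = "R.estimate_utility cp r Jt Jf cp ys ts (\<lambda>u. R.estimate_utility cp r Jt Jf cm ys ts (\<lambda>u'. Output ((u - u') / (2 * h))))"
      let ?B = "basis_states X Y K b R.W"
      have "?a \<in> ?B" by (rule R.J_root_in[OF K(3)])
      moreover have "fst ?a = x0" by (simp add: R.J_def R.root_def)
      moreover have "well_formed ?B ?p"
        by (rule R.well_formed_estimate_utility, rule K, rule K, simp add: ys, rule ts,
            rule R.well_formed_estimate_utility, rule K, rule K, simp add: ys, rule ts) simp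
      moreover have "output_prob ?B V (likelihood_op b L) ?p (basis_vector ?a) {r. \<bar>r - partial_deriv j (utility X Y P L) c\<bar> \<le> \<epsilon>} \<ge> 1 - \<eta> \<and>
          expected_queries ?B V (likelihood_op b L) ?p (basis_vector ?a) \<le> query_constant * ?Q * ln (2 + ?Q + 1 / \<eta>) ^ 2"
        if M: "bayes_model n X Y P L" and U: "\<forall>x\<in>X. P x \<noteq> 0 \<longrightarrow> x \<in> {0..1}"
          and g: "thrice_partially_differentiable n (utility X Y P L)"
          and bdd: "bdd_above (third_partials n (utility X Y P L))"
          and TT: "Sup (third_partials n (utility X Y P L)) = T" and V: "prepares_prior X x0 P V" for P L V
      proof -
        interpret RR: rooted_registers X Y K b nn x0 d0 V "\<lambda>d x c. likelihood_bits b (L d x c)" P cp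
        proof unfold_locales
          show "unitary_on X V" using V by (simp add: prepares_prior_def)
          show "V x x0 = complex_of_real (sqrt (P x))" if "x \<in> X" for x using V that by (simp add: prepares_prior_def)
          show "likelihood_bits b (L d x c) \<le> 2 ^ b" if "d \<in> Y" "x \<in> X" "c \<in> K" for d x c
            using likelihood_bits_model(1)[OF M _ that(2,1)] that(3) K(2) by blast
          show "(\<Sum>d\<in>Y. likelihood_bits b (L d x c)) \<le> 2 ^ b" if "x \<in> X" "c \<in> K" for x c
            using likelihood_bits_model(2)[OF M _ that(1)] that(2) K(2) by blast
          show "0 \<le> P x" if "x \<in> X" for x using M that by (simp add: bayes_model_def)
          show "(\<Sum>x\<in>X. P x) = 1" using M by (simp add: bayes_model_def)
          show "x \<in> {0..1}" if "x \<in> X" "P x \<noteq> 0" for x using U that by blast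
          show "cp \<in> K" by (rule K(3))
        qed
        have tr: "\<bar>RR.total_spread c' + utility X Y P L c'\<bar> \<le> \<delta> / 4" if "c' \<in> K" for c'
        proof -
          have "c' \<in> controls n" using that K(2) by blast
          from truncated_utility[OF M U this, of b] show ?thesis
            using trunc unfolding RR.total_spread_def RR.wt_def by linarith
        qed
        have cd: "\<bar>(utility X Y P L cp - utility X Y P L cm) / (2 * h) - partial_deriv j (utility X Y P L) c\<bar> \<le> \<epsilon> / 2"
        proof -
          have "\<bar>(utility X Y P L cp - utility X Y P L cm) / (2 * h) - partial_deriv j (utility X Y P L) c\<bar> \<le> T * h\<^sup>2 / 6"
            unfolding cp_def cm_def
            by (rule central_difference[OF j c g _ h]) (use third_partials_bound[OF j _ bdd] TT in auto)
          then show ?thesis unfolding Th' by simp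
        qed
        \<comment> \<open>Estimation, bias and truncation contribute \<open>\<delta> / 4\<close>,
          \<open>\<delta> / 2\<close> and \<open>\<delta> / 4\<close>. Their sum
          \<open>\<delta>\<close> divided by \<open>h\<close> is
          \<open>\<epsilon> / 2\<close>.\<close>
        have err: "(8 * (\<delta> / 32) + \<delta> / 2 + \<delta> / 4) / h + \<epsilon> / 2 \<le> \<epsilon>" using h by (simp add: \<delta>_def)
        note prog = RR.difference_quotient_program[OF K(3,4) ys(1,2) ts(1,2) Jt Jf bias tr[OF K(3)] tr[OF K(4)] h cd err]
        have "1 - \<eta> \<le> RR.qm.outp ?p {r. \<bar>r - partial_deriv j (utility X Y P L) c\<bar> \<le> \<epsilon>}"
          using prog(1)[of r] count(1) unfolding RR.shot_error_def ts(3) by simp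
        moreover have "RR.qm.expq ?p \<le> query_constant * ?Q * ln (2 + ?Q + 1 / \<eta>) ^ 2"
          using prog(2)[of r] count(2) unfolding ts(3) ys(3) by linarith
        ultimately show ?thesis
          unfolding RR.qm.outp_def RR.qm.expq_def likelihood_op_lik_op basis_vector_unit_at by blast
      qed
      ultimately show "\<exists>K W a p.
       finite K \<and> K \<subseteq> controls n \<and>
       a \<in> basis_states X Y K b W \<and> fst a = x0 \<and>
       well_formed (basis_states X Y K b W) p \<and>
       (\<forall>P L V.
          bayes_model n X Y P L \<and>
          (\<forall>x\<in>X. P x \<noteq> 0 \<longrightarrow> x \<in> {0..1}) \<and>
          thrice_partially_differentiable n (utility X Y P L) \<and>
          bdd_above (third_partials n (utility X Y P L)) \<and>
          Sup (third_partials n (utility X Y P L)) = T \<and>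
          \<epsilon> \<le> (MIN d\<in>Y. 1 / 2 * evidence X P L c d) \<and>
          prepares_prior X x0 P V \<longrightarrow>
          output_prob (basis_states X Y K b W) V (likelihood_op b L) p (basis_vector a)
            {r. \<bar>r - partial_deriv j (utility X Y P L) c\<bar> \<le> \<epsilon>} \<ge> 1 - \<eta> \<and>
          expected_queries (basis_states X Y K b W) V (likelihood_op b L) p (basis_vector a)
            \<le> query_constant * ?Q * ln (2 + ?Q + 1 / \<eta>) ^ 2)"
        using K(1,2) by (intro exI[of _ K] exI[of _ R.W] exI[of _ ?a] exI[of _ ?p]) blast
    qed
  qed
qed

end
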